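(* For every integer $\ell \ge 4$ there are constants $n_\ell, \beta_\ell > 0$ such that, for all integers $n \ge n_\ell$, there exists an $n$-vertex partial Steiner triple system with at least $\bigl(1 - n^{-\beta_\ell}\bigr) n^2/6$ triples and girth larger than $\ell$.
   Context: A $3$-uniform hypergraph is a partial Steiner triple system if every $2$-element subset of its vertex set is contained in at most one of its triples. The girth of a $3$-uniform hypergraph is the smallest integer $g \ge 4$ for which there is a set of $g$ vertices that spans at least $g-2$ triples (a triple is spanned by a vertex set if all three of its vertices lie in the set); "girth larger than $\ell$" means that for no $4 \le a \le \ell$ is there a set of $a$ vertices spanning at least $a-2$ triples. *)

theory Defs
  imports Complex_Main "HOL-Library.Extended_Nat"
begin

definition three_uniform_hypergraph :: "'a set \<Rightarrow> 'a set set \<Rightarrow> bool" where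
  "three_uniform_hypergraph V E \<longleftrightarrow> finite V \<and> (\<forall>e\<in>E. e \<subseteq> V \<and> card e = 3)"

definition partial_steiner_triple_system :: "'a set \<Rightarrow> 'a set set \<Rightarrow> bool" where
  "partial_steiner_triple_system V E \<longleftrightarrow>
     three_uniform_hypergraph V E \<and>
     (\<forall>p. p \<subseteq> V \<and> card p = 2 \<longrightarrow> card {e \<in> E. p \<subseteq> e} \<le> 1)"

definition spanned_triples :: "'a set set \<Rightarrow> 'a set \<Rightarrow> 'a set set" where
  "spanned_triples E S = {e \<in> E. e \<subseteq> S}"

text \<open>The girth is \<open>\<infinity>\<close> if no vertex set of any size \<open>g \<ge> 4\<close> spans \<open>g - 2\<close> triples,
  since the infimum of the empty set in \<^typ>\<open>enat\<close> is \<open>\<infinity>\<close>.\<close>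

definition girth :: "'a set \<Rightarrow> 'a set set \<Rightarrow> enat" where
  "girth V E = Inf {enat g | g. 4 \<le> g \<and>
     (\<exists>S. S \<subseteq> V \<and> card S = g \<and> g - 2 \<le> card (spanned_triples E S))}"

lemma girth_greater_iff:
  "enat l < girth V E \<longleftrightarrow>
     \<not> (\<exists>a. 4 \<le> a \<and> a \<le> l \<and>
          (\<exists>S. S \<subseteq> V \<and> card S = a \<and> a - 2 \<le> card (spanned_triples E S)))"
  (is "?L \<longleftrightarrow> ?R")
proof -
  let ?P = "\<lambda>g. 4 \<le> g \<and>
     (\<exists>S. S \<subseteq> V \<and> card S = g \<and> g - 2 \<le> card (spanned_triples E S))"
  have *: "enat (Suc l) \<le> Inf {enat g | g. Q g} \<longleftrightarrow> (\<forall>g. Q g \<longrightarrow> Suc l \<le> g)" for Q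
    unfolding le_Inf_iff by (force simp del: Suc_ile_eq)
  have "?L \<longleftrightarrow> eSuc (enat l) \<le> girth V E"
    by (simp add: eSuc_enat Suc_ile_eq)
  also have "\<dots> \<longleftrightarrow> (\<forall>g. ?P g \<longrightarrow> Suc l \<le> g)"
    unfolding girth_def eSuc_enat by (rule *)
  also have "\<dots> \<longleftrightarrow> ?R"
    by (simp add: not_less_eq_eq [symmetric]) blast
  finally show ?thesis .
qed

end

theory Submission
  imports Defs
begin

text \<open>
  If at least \<open>g - 2 \<ge> 2\<close> triples lie in some \<open>g\<close>-set, then they contain a minimal such set of
  triples, a configuration: \<open>k\<close> triples on \<open>k + 2\<close> points all of whose proper parts
  with \<open>i \<ge> 2\<close> triples span at least \<open>i + 3\<close> points. So it suffices to build a large set \<open>M\<close> of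
  triples pairwise meeting in at most one point that contains no configuration with at most \<open>l\<close> triples.

  This is done by a random greedy process, derandomised by a potential function. Besides \<open>M\<close> one keeps
  a set \<open>P\<close> of uncovered pairs and a set \<open>A\<close> of triples that may still be added. A step adds a
  random triple of \<open>A\<close> (removing what it covers or blocks), or discards a pair, or discards a
  triple; the weights of the last two moves are chosen so that every pair of \<open>P\<close> is removed at one
  common rate \<open>\<delta>\<close> and every triple of \<open>A\<close> at one common rate \<open>(3 + \<kappa>) \<delta>\<close>. The degree of a surviving
  pair divided by its trajectory is then an exact martingale, and the number of configurations
  through a triple of \<open>A\<close> with a given number of members in \<open>M\<close> only has to be bounded from above.
  Exponential moments of these quantities, together with high moments of the counts that bound their
  one-step changes, form a potential whose average over the moves hardly grows, so some move is always
  good. Running the process until a proportion \<open>n powr (- \<tau>)\<close> of the pairs is uncovered proves the theorem.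
\<close>

section \<open>Averages of exponentials\<close>

text \<open>A plain random greedy process would need two-sided estimates of the configuration
  counts, since the rate at which triples get blocked enters the degree trajectory. Raising all
  rates to a fixed worst case removes this dependence: a triple through a surviving pair is lost at
  rate exactly \<open>a \<delta>\<close> with \<open>a = 2 + \<kappa>\<close>, so degrees follow
  \<open>n (1 - a \<delta>)^i\<close>. The price is that degrees shrink roughly like the
  \<open>a\<close>-th power of the proportion of uncovered pairs, which forces an early stop and a
  small exponent. A configuration with \<open>q\<close> triples of \<open>A\<close> besides its root
  is measured against the \<open>q\<close>-th power of the degree scale. Each of these triples dies
  at rate \<open>(a + 1) \<delta>\<close>, and the surplus over the scale gives a restoring drift
  that absorbs the inflow from configurations with one member less in \<open>M\<close>. The bounds
  grow geometrically with the number of members in \<open>M\<close>, and \<open>\<kappa>\<close> is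
  computed from them afterwards, so nothing is circular. Minimality of configurations yields the
  vertex counts that keep one-step changes a factor of almost \<open>n\<close> below the tracked
  quantities.\<close>

lemma exp_le_quadratic:
  fixes x :: real
  assumes "x \<le> 1"
  shows "exp x \<le> 1 + x + x\<^sup>2"
proof (cases "x \<ge> 0")
  case True
  then show ?thesis using exp_bound assms by auto
next
  case False
  define t where "t = - x"
  have t: "t > 0" using False by (simp add: t_def)
  have "exp x = 1 / exp t" by (simp add: t_def exp_minus field_simps)
  also have "\<dots> \<le> 1 / (1 + t)"
    using exp_ge_add_one_self[of t] t by (intro divide_left_mono) auto
  also have "\<dots> \<le> 1 - t + t\<^sup>2"
  proof -
    have "(1 - t + t\<^sup>2) * (1 + t) = 1 + t ^ 3" by (simp add: algebra_simps power2_eq_square power3_eq_cube)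
    moreover have "t ^ 3 > 0" using t by simp
    ultimately have "1 \<le> (1 - t + t\<^sup>2) * (1 + t)" by linarith
    then show ?thesis using t by (simp add: divide_le_eq)
  qed
  finally show ?thesis by (simp add: t_def)
qed

text \<open>Each exponential is expanded to second order and the result closed up with
  \<open>1 + t \<le> exp t\<close>, for which total weight at most 1 is enough. This slack matters:
  the sum will run only over the moves under which the tracked pair or triple survives.\<close>

lemma weighted_exp_sum_le:
  fixes w y :: "'m \<Rightarrow> real"
  assumes "\<And>m. m \<in> S \<Longrightarrow> 0 \<le> w m" and "sum w S \<le> 1" and "\<And>m. m \<in> S \<Longrightarrow> y m \<le> 1"
  shows "(\<Sum>m\<in>S. w m * exp (z + y m))
    \<le> exp (z + (\<Sum>m\<in>S. w m * y m) + (\<Sum>m\<in>S. w m * (y m)\<^sup>2))"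
proof -
  have "(\<Sum>m\<in>S. w m * exp (z + y m)) \<le> (\<Sum>m\<in>S. exp z * (w m * (1 + y m + (y m)\<^sup>2)))"
  proof (rule sum_mono)
    fix m assume m: "m \<in> S"
    have "w m * exp (y m) \<le> w m * (1 + y m + (y m)\<^sup>2)"
      using assms(1,3)[OF m] exp_le_quadratic by (intro mult_left_mono) auto
    then show "w m * exp (z + y m) \<le> exp z * (w m * (1 + y m + (y m)\<^sup>2))"
      by (simp add: exp_add mult.left_commute)
  qed
  also have "\<dots> = exp z * (sum w S + (\<Sum>m\<in>S. w m * y m) + (\<Sum>m\<in>S. w m * (y m)\<^sup>2))"
    by (simp add: sum_distrib_left sum.distrib distrib_left)
  also have "\<dots> \<le> exp z * (1 + ((\<Sum>m\<in>S. w m * y m) + (\<Sum>m\<in>S. w m * (y m)\<^sup>2)))"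
    using assms(2) by (intro mult_left_mono) auto
  also have "\<dots> \<le> exp z * exp ((\<Sum>m\<in>S. w m * y m) + (\<Sum>m\<in>S. w m * (y m)\<^sup>2))"
    by (intro mult_left_mono exp_ge_add_one_self) auto
  finally show ?thesis by (simp add: exp_add)
qed

text \<open>Turns a bound on the mean of the potential into an actual move, so that no probability
  space is needed.\<close>

lemma exists_le_weighted_average:
  fixes w f :: "'m \<Rightarrow> real"
  assumes "finite S" and "\<And>m. m \<in> S \<Longrightarrow> 0 \<le> w m" and "sum w S = 1"
    and "(\<Sum>m\<in>S. w m * f m) \<le> c"
  shows "\<exists>m\<in>S. f m \<le> c"
proof (rule ccontr)
  assume neg: "\<not> (\<exists>m\<in>S. f m \<le> c)"
  obtain m0 where m0: "m0 \<in> S" "w m0 > 0"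
    using assms(1-3) by (metis less_eq_real_def sum.neutral zero_neq_one)
  have "c = (\<Sum>m\<in>S. w m * c)" using assms(3) by (simp add: sum_distrib_right[symmetric])
  also have "\<dots> < (\<Sum>m\<in>S. w m * f m)"
  proof (rule sum_strict_mono_ex1)
    show "\<forall>m\<in>S. w m * c \<le> w m * f m"
      using neg assms(2) by (auto intro!: mult_left_mono simp: not_le less_imp_le)
    show "\<exists>m\<in>S. w m * c < w m * f m"
      using neg m0 by (intro bexI[of _ m0]) (auto simp: not_le)
  qed (rule assms(1))
  finally show False using assms(4) by simp
qed

subsection \<open>Moments of the number of structures inside a random set\<close>

text \<open>For \<open>U = {}\<close> this is the conditional \<open>s\<close>-th moment of the number of \<open>x \<in> F\<close> with \<open>T x\<close> inside a random
  superset of \<open>M\<close> that contains each further element with probability \<open>r\<close>.\<close>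

primrec moment_weight :: "('s \<Rightarrow> 'b set) \<Rightarrow> 's set \<Rightarrow> real \<Rightarrow> 'b set \<Rightarrow> nat \<Rightarrow> 'b set \<Rightarrow> real" where
  "moment_weight T F r M 0 U = r ^ card (U - M)"
| "moment_weight T F r M (Suc s) U = (\<Sum>x\<in>F. moment_weight T F r M s (U \<union> T x))"

lemma moment_weight_nonneg: "0 \<le> r \<Longrightarrow> 0 \<le> moment_weight T F r M s U"
  by (induction s arbitrary: U) (auto intro: sum_nonneg)

text \<open>Unfolded, the recursion sums over \<open>s\<close>-tuples from \<open>F\<close>; a tuple
  whose sets all lie in \<open>M\<close> leaves nothing uncovered and contributes
  \<open>r ^ 0 = 1\<close>.\<close>

lemma card_power_le_moment_weight:
  assumes "finite F" "0 \<le> r" "U \<subseteq> M"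
  shows "real (card {x \<in> F. T x \<subseteq> M}) ^ s \<le> moment_weight T F r M s U"
  using assms(3)
proof (induction s arbitrary: U)
  case 0
  then have "U - M = {}" by auto
  then have "card (U - M) = 0" by (simp only: card.empty)
  then show ?case by simp
next
  case (Suc s)
  let ?G = "{x \<in> F. T x \<subseteq> M}"
  have "real (card ?G) ^ Suc s = (\<Sum>x\<in>?G. real (card ?G) ^ s)" by simp
  also have "\<dots> \<le> (\<Sum>x\<in>?G. moment_weight T F r M s (U \<union> T x))"
    using Suc by (intro sum_mono) auto
  also have "\<dots> \<le> (\<Sum>x\<in>F. moment_weight T F r M s (U \<union> T x))"
    using assms(1,2) by (intro sum_mono2) (auto simp: moment_weight_nonneg)
  finally show ?case by simp
qed

text \<open>Grouping by the trace \<open>J = T x \<inter> U\<close> leaves \<open>2 ^ card U\<close>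
  sums, in each of which \<open>U\<close> may be replaced by \<open>J\<close>. Relaxing the trace
  condition to \<open>J \<subseteq> T x\<close> only adds nonnegative terms.\<close>

lemma sum_power_card_diff_le:
  fixes r B :: real
  assumes F: "finite F" "\<And>x. x \<in> F \<Longrightarrow> finite (T x)"
    and U: "finite U" and r: "0 \<le> r"
    and B: "\<And>J. finite J \<Longrightarrow> (\<Sum>x\<in>{x \<in> F. J \<subseteq> T x}. r ^ card (T x - J)) \<le> B"
  shows "(\<Sum>x\<in>F. r ^ card (T x - U)) \<le> 2 ^ card U * B"
proof -
  have "(\<Sum>x\<in>F. r ^ card (T x - U)) = (\<Sum>J\<in>Pow U. \<Sum>x\<in>{x \<in> F. T x \<inter> U = J}. r ^ card (T x - U))"
    by (rule sum.group[symmetric]) (use F U in auto)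
  also have "\<dots> \<le> (\<Sum>J\<in>Pow U. B)"
  proof (rule sum_mono)
    fix J assume J: "J \<in> Pow U"
    then have "finite J" using U finite_subset by auto
    have "(\<Sum>x\<in>{x \<in> F. T x \<inter> U = J}. r ^ card (T x - U)) = (\<Sum>x\<in>{x \<in> F. T x \<inter> U = J}. r ^ card (T x - J))"
      by (intro sum.cong arg_cong[where f = "\<lambda>A. r ^ card A"]) auto
    also have "\<dots> \<le> (\<Sum>x\<in>{x \<in> F. J \<subseteq> T x}. r ^ card (T x - J))"
      using F r by (intro sum_mono2) auto
    also have "\<dots> \<le> B" using B \<open>finite J\<close> by auto
    finally show "(\<Sum>x\<in>{x \<in> F. T x \<inter> U = J}. r ^ card (T x - U)) \<le> B" .
  qed
  also have "\<dots> = 2 ^ card U * B" using U by (simp add: card_Pow)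
  finally show ?thesis .
qed

text \<open>The tuple is revealed one structure at a time, each costing a factor
  \<open>2 ^ t * B\<close>. Here \<open>t\<close> bounds the size of every union that can build up,
  so the factor is the same at each stage.\<close>

lemma moment_weight_empty_le:
  fixes r B :: real
  assumes F: "finite F" "\<And>x. x \<in> F \<Longrightarrow> finite (T x)" "\<And>x. x \<in> F \<Longrightarrow> card (T x) \<le> b"
    and r: "0 \<le> r" and B0: "0 \<le> B"
    and B: "\<And>J. finite J \<Longrightarrow> (\<Sum>x\<in>{x \<in> F. J \<subseteq> T x}. r ^ card (T x - J)) \<le> B"
    and U: "finite U" "card U + s * b \<le> t"
  shows "moment_weight T F r {} s U \<le> (2 ^ t * B) ^ s * r ^ card U"
  using U
proof (induction s arbitrary: U)
  case 0
  then show ?case by simp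
next
  case (Suc s)
  have "moment_weight T F r {} (Suc s) U = (\<Sum>x\<in>F. moment_weight T F r {} s (U \<union> T x))" by simp
  also have "\<dots> \<le> (\<Sum>x\<in>F. (2 ^ t * B) ^ s * r ^ card (U \<union> T x))"
  proof (intro sum_mono Suc.IH)
    fix x assume x: "x \<in> F"
    show "finite (U \<union> T x)" using F(2)[OF x] Suc.prems by auto
    show "card (U \<union> T x) + s * b \<le> t"
      using F(3)[OF x] Suc.prems card_Un_le[of U "T x"] by simp
  qed
  also have "\<dots> = (2 ^ t * B) ^ s * r ^ card U * (\<Sum>x\<in>F. r ^ card (T x - U))"
  proof -
    have "card (U \<union> T x) = card U + card (T x - U)" if "x \<in> F" for x
      using F(2)[OF that] Suc.prems(1) by (metis Diff_disjoint Un_Diff_cancel card_Un_disjoint finite_Diff)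
    then show ?thesis by (simp add: sum_distrib_left power_add mult.assoc)
  qed
  also have "\<dots> \<le> (2 ^ t * B) ^ s * r ^ card U * (2 ^ t * B)"
  proof (intro mult_left_mono)
    have "(\<Sum>x\<in>F. r ^ card (T x - U)) \<le> 2 ^ card U * B"
      by (rule sum_power_card_diff_le) (use F Suc.prems r B in auto)
    also have "\<dots> \<le> 2 ^ t * B"
      using Suc.prems B0 by (intro mult_right_mono power_increasing) auto
    finally show "(\<Sum>x\<in>F. r ^ card (T x - U)) \<le> 2 ^ t * B" .
  qed (use r B0 in auto)
  finally show ?case by (simp add: mult_ac)
qed

lemma power_add_ge_linear:
  fixes a q :: real
  assumes "0 \<le> a" "0 \<le> q"
  shows "a ^ Suc u + real (Suc u) * q * a ^ u \<le> (a + q) ^ Suc u"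
proof (induction u)
  case 0
  then show ?case by simp
next
  case (Suc u)
  have "a ^ Suc (Suc u) + real (Suc (Suc u)) * q * a ^ Suc u
      \<le> (a + q) * (a ^ Suc u + real (Suc u) * q * a ^ u)"
    using assms by (simp add: algebra_simps)
  also have "\<dots> \<le> (a + q) * (a + q) ^ Suc u"
    using assms by (intro mult_left_mono Suc) auto
  finally show ?case by simp
qed

text \<open>Lowering the radius by \<open>q\<close> pays for one random step in which each element
  is added with probability at most \<open>q\<close>; the moment is a supermartingale for a linearly
  shrinking radius. Since a move adds at most one element, the uncovered part of a fixed set shrinks
  by at most one, and only the first two terms of the expansion of \<open>(r + q) ^ Suc u\<close>
  are used.\<close>

lemma moment_weight_average_le:
  fixes w :: "'m \<Rightarrow> real" and r q :: real
  assumes Q: "finite Q" and w: "\<And>m. m \<in> Q \<Longrightarrow> 0 \<le> w m" "sum w Q = 1"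
    and one: "\<And>m. m \<in> Q \<Longrightarrow> finite (D m) \<and> card (D m) \<le> 1"
    and hit: "\<And>x. (\<Sum>m\<in>{m \<in> Q. x \<in> D m}. w m) \<le> q"
    and r: "0 \<le> r" and q: "0 \<le> q"
    and F: "\<And>x. x \<in> F \<Longrightarrow> finite (T x)" and U: "finite U"
  shows "(\<Sum>m\<in>Q. w m * moment_weight T F r (M \<union> D m) s U) \<le> moment_weight T F (r + q) M s U"
  using U
proof (induction s arbitrary: U)
  case 0
  let ?V = "U - M"
  have fin: "finite ?V" using 0 by simp
  show ?case
  proof (cases "card ?V")
    case 0
    then have "?V = {}" using fin by simp
    then have "U - (M \<union> D m) = {}" for m by auto
    then have "card (U - (M \<union> D m)) = 0" for m by (simp only: card.empty)
    then show ?thesis using 0 w(2) by simp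
  next
    case (Suc u)
    let ?h = "\<lambda>m. D m \<inter> ?V \<noteq> {}"
    have bnd: "w m * r ^ card (U - (M \<union> D m)) \<le> w m * r ^ Suc u + (if ?h m then w m * r ^ u else 0)"
      if m: "m \<in> Q" for m
    proof (cases "?h m")
      case True
      then obtain x where x: "x \<in> D m" "x \<in> ?V" by auto
      then have "D m = {x}" using one[OF m] by (metis card_le_Suc0_iff_eq One_nat_def is_singletonI' empty_iff is_singleton_def singletonD)
      then have "U - (M \<union> D m) = ?V - {x}" by auto
      then have "card (U - (M \<union> D m)) = u" using x Suc fin by simp
      then show ?thesis using True w(1)[OF m] r by simp
    next
      case False
      then have "U - (M \<union> D m) = ?V" by auto
      then show ?thesis using False Suc by simp
    qed
    have "(\<Sum>m\<in>Q. w m * moment_weight T F r (M \<union> D m) 0 U)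
        \<le> (\<Sum>m\<in>Q. w m * r ^ Suc u + (if ?h m then w m * r ^ u else 0))"
      using bnd by (intro sum_mono) simp
    also have "\<dots> = r ^ Suc u + (\<Sum>m\<in>{m \<in> Q. ?h m}. w m) * r ^ u"
      using w(2) Q by (simp only: sum.distrib sum_distrib_right[symmetric] mult_1 sum.inter_filter[symmetric])
    also have "(\<Sum>m\<in>{m \<in> Q. ?h m}. w m) \<le> (\<Sum>x\<in>?V. \<Sum>m\<in>{m \<in> Q. x \<in> D m}. w m)"
    proof -
      have "(\<Sum>m\<in>{m \<in> Q. ?h m}. w m) = (\<Sum>m\<in>Q. if ?h m then w m else 0)"
        using Q by (simp add: sum.inter_filter)
      also have "\<dots> \<le> (\<Sum>m\<in>Q. \<Sum>x\<in>?V. if x \<in> D m then w m else 0)"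
      proof (rule sum_mono)
        fix m assume m: "m \<in> Q"
        show "(if ?h m then w m else 0) \<le> (\<Sum>x\<in>?V. if x \<in> D m then w m else 0)"
        proof (cases "?h m")
          case True
          then obtain x where x: "x \<in> D m" "x \<in> ?V" by auto
          have "w m = (if x \<in> D m then w m else 0)" using x by simp
          also have "\<dots> \<le> (\<Sum>x\<in>?V. if x \<in> D m then w m else 0)"
            using x fin w(1)[OF m] by (intro member_le_sum) auto
          finally show ?thesis using True by simp
        qed (use w(1)[OF m] in \<open>auto intro!: sum_nonneg\<close>)
      qed
      also have "\<dots> = (\<Sum>x\<in>?V. \<Sum>m\<in>Q. if x \<in> D m then w m else 0)" by (rule sum.swap)
      also have "\<dots> = (\<Sum>x\<in>?V. \<Sum>m\<in>{m \<in> Q. x \<in> D m}. w m)"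
        using Q by (simp add: sum.inter_filter)
      finally show ?thesis .
    qed
    also have "\<dots> \<le> (\<Sum>x\<in>?V. q)" by (intro sum_mono hit)
    also have "\<dots> = real (Suc u) * q" using Suc by simp
    finally have "(\<Sum>m\<in>Q. w m * moment_weight T F r (M \<union> D m) 0 U) \<le> r ^ Suc u + real (Suc u) * q * r ^ u"
      using r by (simp add: mult_right_mono)
    also have "\<dots> \<le> (r + q) ^ Suc u" by (rule power_add_ge_linear[OF r q])
    also have "\<dots> = moment_weight T F (r + q) M 0 U" using Suc by simp
    finally show ?thesis .
  qed
next
  case (Suc s)
  have "(\<Sum>m\<in>Q. w m * moment_weight T F r (M \<union> D m) (Suc s) U)
      = (\<Sum>x\<in>F. \<Sum>m\<in>Q. w m * moment_weight T F r (M \<union> D m) s (U \<union> T x))"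
    by (simp add: sum_distrib_left) (rule sum.swap)
  also have "\<dots> \<le> (\<Sum>x\<in>F. moment_weight T F (r + q) M s (U \<union> T x))"
    using Suc F by (intro sum_mono) auto
  finally show ?case by simp
qed

section \<open>Configurations\<close>

text \<open>These are the minimal Erdos configurations. Subsets of size 1 are exempt because a
  single triple spans exactly \<open>1 + 2\<close> points. For \<open>k = 2\<close> the condition
  would describe two triples sharing a pair, so the lemmas below ask for
  \<open>3 \<le> k\<close>.\<close>

definition config :: "nat \<Rightarrow> 'a set set \<Rightarrow> bool" where
  "config k H \<longleftrightarrow> card H = k \<and> (\<forall>e\<in>H. card e = 3) \<and> card (\<Union>H) = k + 2 \<and>
     (\<forall>L. L \<subset> H \<longrightarrow> 2 \<le> card L \<longrightarrow> card L + 3 \<le> card (\<Union>L))"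

lemma config_finite:
  assumes "config k H" "3 \<le> k"
  shows "finite H" "\<And>e. e \<in> H \<Longrightarrow> finite e" "finite (\<Union>H)"
proof -
  show f: "finite H" using assms by (intro card_ge_0_finite) (auto simp: config_def)
  show g: "finite e" if "e \<in> H" for e
    using assms that by (intro card_ge_0_finite) (auto simp: config_def)
  show "finite (\<Union>H)" using f g by auto
qed

lemma config_span:
  assumes "config k H" "L \<subset> H" "2 \<le> card L"
  shows "card L + 3 \<le> card (\<Union>L)"
  using assms by (auto simp: config_def)

text \<open>The remaining \<open>k - 1\<close> triples already span
  \<open>(k - 1) + 3 = k + 2\<close> points by minimality, so no point lies in a single
  triple.\<close>

lemma config_Union_remove:
  assumes "config k H" "3 \<le> k" "f \<in> H"
  shows "\<Union>(H - {f}) = \<Union>H"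
proof (rule card_subset_eq)
  have c: "card (H - {f}) = k - 1" using assms config_finite by (auto simp: config_def)
  have "card (H - {f}) + 3 \<le> card (\<Union>(H - {f}))"
    using assms(2,3) c by (intro config_span[OF assms(1)]) (blast, simp)
  moreover have "card (\<Union>(H - {f})) \<le> card (\<Union>H)"
    using config_finite[OF assms(1,2)] by (intro card_mono) auto
  ultimately show "card (\<Union>(H - {f})) = card (\<Union>H)"
    using assms c by (auto simp: config_def)
qed (use config_finite[OF assms(1,2)] in auto)

lemma config_two:
  assumes "config k H" "3 \<le> k" "e \<in> H" "f \<in> H" "e \<noteq> f"
  shows "5 \<le> card (e \<union> f)" "card (e \<inter> f) \<le> 1"
proof -
  have "card {e, f} = 2" using assms by simp
  moreover have "card H = k" using assms(1) by (simp add: config_def)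
  ultimately have "{e, f} \<noteq> H" using assms(2) by fastforce
  then have "{e, f} \<subset> H" using assms(3,4) by blast
  then have "card {e, f} + 3 \<le> card (\<Union>{e, f})"
    using assms(1,5) by (intro config_span) simp_all
  then show *: "5 \<le> card (e \<union> f)" using assms(5) by simp
  have "card (e \<union> f) + card (e \<inter> f) = card e + card f"
    using config_finite(2)[OF assms(1,2)] assms(3,4) card_Un_Int[of e f] by simp
  then show "card (e \<inter> f) \<le> 1" using * assms by (auto simp: config_def)
qed

text \<open>The pair \<open>p\<close> can replace \<open>f\<close> at the cost of one point, which
  lowers the generic bound \<open>card J + 5\<close> for the triples \<open>e\<close>,
  \<open>f\<close> and \<open>J\<close> to \<open>card J + 4\<close>. If these triples exhaust
  \<open>H\<close>, they are not a proper part, but then \<open>H - {f}\<close> spans all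
  \<open>card J + 4\<close> points of \<open>H\<close>.\<close>

lemma config_span_rooted:
  assumes H: "config k H" "3 \<le> k" and ef: "e \<in> H" "f \<in> H" "e \<noteq> f"
    and p: "p \<subseteq> f" "card p = 2" and J: "J \<subseteq> H - {e, f}"
  shows "card J + 4 \<le> card (e \<union> p \<union> \<Union>J)"
proof -
  note fin = config_finite[OF H]
  have finJ: "finite J" using J fin by (meson finite_Diff finite_subset)
  have finU: "finite (\<Union>H)" using fin by simp
  have sub: "e \<union> p \<union> \<Union>J \<subseteq> \<Union>H" using ef p J by auto
  have finR: "finite (e \<union> p \<union> \<Union>J)" using sub finU finite_subset by blast
  have cJ: "card (insert e (insert f J)) = card J + 2" 
  proof -
    have "e \<notin> insert f J" "f \<notin> J" using J ef by blast+
    then show ?thesis using finJ by simp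
  qed
  show ?thesis
  proof (cases "insert e (insert f J) = H")
    case True
    then have "H - {f} = insert e J" using J ef by blast
    then have "e \<union> \<Union>J = \<Union>H" using config_Union_remove[OF H ef(2)] by (simp add: Union_insert)
    moreover have "card (\<Union>H) = card J + 4" using H cJ True by (auto simp: config_def)
    ultimately have "card (e \<union> \<Union>J) = card J + 4" by simp
    moreover have "card (e \<union> \<Union>J) \<le> card (e \<union> p \<union> \<Union>J)"
      using finR by (intro card_mono) auto
    ultimately show ?thesis by simp
  next
    case False
    moreover have "insert e (insert f J) \<subseteq> H" using J ef by blast
    ultimately have "insert e (insert f J) \<subset> H" by blast
    then have "card J + 5 \<le> card (\<Union>(insert e (insert f J)))"
      using config_span[OF H(1), of "insert e (insert f J)"] cJ by simp
    also have "\<dots> \<le> card ((e \<union> p \<union> \<Union>J) \<union> (f - p))"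
      using finR fin ef by (intro card_mono) auto
    also have "\<dots> \<le> card (e \<union> p \<union> \<Union>J) + card (f - p)" by (rule card_Un_le)
    also have "card (f - p) = 1"
      using p fin(2)[OF ef(2)] H ef by (subst card_Diff_subset) (auto simp: config_def intro: finite_subset)
    finally show ?thesis by simp
  qed
qed

lemma card_le_card_diffs:
  assumes "finite A" "finite B" "finite R"
  shows "card (A \<union> B) \<le> card R + card (A - R) + card (B - (A \<union> R))"
proof -
  have "card (A \<union> B) \<le> card (R \<union> (A - R) \<union> (B - (A \<union> R)))"
    using assms by (intro card_mono) auto
  also have "\<dots> \<le> card (R \<union> (A - R)) + card (B - (A \<union> R))" by (rule card_Un_le)
  also have "\<dots> \<le> card R + card (A - R) + card (B - (A \<union> R))" using card_Un_le[of R "A - R"] by simp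
  finally show ?thesis .
qed

lemma card_Diff_add_le:
  assumes "finite A" "B \<subseteq> A" "B \<subseteq> R"
  shows "card (A - R) + card B \<le> card A"
proof -
  have "card (A - R) + card B = card ((A - R) \<union> B)"
    using assms finite_subset by (subst card_Un_disjoint) auto
  also have "\<dots> \<le> card A" using assms by (intro card_mono) auto
  finally show ?thesis .
qed

text \<open>This is the vertex count for a member \<open>f\<close> of \<open>H\<close> that is
  blocked by \<open>g\<close> through a second configuration \<open>G\<close>. Once
  \<open>e\<close>, \<open>g\<close> and the triples \<open>J\<close> are placed, the new points
  exceed the required triples still missing by at most \<open>k - 2 - card I\<close>, the same
  balance as for one configuration rooted at \<open>e\<close> and a pair. The order in which the
  points of \<open>H\<close> and \<open>G\<close> are counted depends on how \<open>J\<close> meets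
  them.\<close>

lemma two_configs_span:
  assumes H: "config k H" "3 \<le> k" and G: "config k' G" "3 \<le> k'"
    and e: "e \<in> H" "e \<notin> G" and f: "f \<in> H" "f \<in> G" and g: "g \<in> G" "g \<noteq> f"
    and eg: "card (e \<inter> g) \<le> 1"
    and I: "I \<subseteq> H - {e, f}" and J: "J \<subseteq> I \<union> (G - {f, g})"
  shows "card (\<Union>H \<union> \<Union>G) + card I
    \<le> card (e \<union> g \<union> \<Union>J) + (k - 2) + card ((I \<union> (G - {f, g})) - J)"
proof -
  note finH = config_finite[OF H] and finG = config_finite[OF G]
  define R where "R = e \<union> g \<union> \<Union>J"
  define Q where "Q = G - {f, g}"
  define L1 where "L1 = J \<inter> H"
  define L where "L = Q \<inter> (H \<union> J)"
  have ef: "e \<noteq> f" using e f by auto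
  have J': "J \<subseteq> H \<union> G" using J I by auto
  have finJ: "finite J" using J' finH finG finite_subset by blast
  have finI: "finite I" using I finH finite_subset by blast
  have finQ: "finite Q" using finG by (simp add: Q_def)
  have Rsub: "R \<subseteq> \<Union>H \<union> \<Union>G" using J' e g by (auto simp: R_def)
  have finR: "finite R" using Rsub finH finG by (meson finite_Un finite_subset)
  have cH: "card H = k" "card (\<Union>H) = k + 2" using H by (auto simp: config_def)
  have cG: "card G = k'" "card (\<Union>G) = k' + 2" using G by (auto simp: config_def)
  have c3: "card e = 3" "card f = 3" "card g = 3" using H G e f g by (auto simp: config_def)
  have cQ: "card Q + 2 = k'"
    using cG f g finG G(2) by (simp add: Q_def card_Diff_subset)
  have fL1: "finite L1" and fL: "finite L" using finJ finQ by (auto simp: L1_def L_def)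
  have cL: "card L \<le> card Q" using finQ by (intro card_mono) (auto simp: L_def)
  have T1: "card I + card (Q - (H \<union> J)) \<le> card ((I \<union> Q) - J) + card (I \<inter> J)"
  proof -
    have "card I = card (I - J) + card (I \<inter> J)"
      using finI by (metis card_Int_Diff add.commute)
    moreover have "card (I - J) + card (Q - (H \<union> J)) = card ((I - J) \<union> (Q - (H \<union> J)))"
      using finI finQ I by (subst card_Un_disjoint) auto
    moreover have "\<dots> \<le> card ((I \<union> Q) - J)"
      using finI finQ by (intro card_mono) auto
    ultimately show ?thesis by simp
  qed
  have IL1: "card (I \<inter> J) \<le> card L1" using fL1 I by (intro card_mono) (auto simp: L1_def)
  have QL: "card (Q - (H \<union> J)) + card L = card Q"
  proof -
    have "card Q = card (Q \<inter> (H \<union> J)) + card (Q - (H \<union> J))" by (rule card_Int_Diff[OF finQ])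
    then show ?thesis by (simp add: L_def)
  qed
  have IT: "card I \<le> card ((I \<union> Q) - J) + card (I \<inter> J)" using T1 by simp
  have A1: "card (\<Union>H - R) + card (\<Union>(insert e L1)) \<le> k + 2"
  proof -
    have "\<Union>(insert e L1) \<subseteq> \<Union>H" "\<Union>(insert e L1) \<subseteq> R"
      using e by (auto simp: L1_def R_def)
    then show ?thesis using card_Diff_add_le[OF finH(3)] cH by metis
  qed
  have A2: "card (\<Union>G - (\<Union>H \<union> R)) + card (\<Union>(insert f (insert g L))) \<le> k' + 2"
  proof -
    have "insert f (insert g L) \<subseteq> G" using f g by (auto simp: L_def Q_def)
    then have "\<Union>(insert f (insert g L)) \<subseteq> \<Union>G" by (rule Union_mono)
    moreover have "\<Union>(insert f (insert g L)) \<subseteq> \<Union>H \<union> R"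
      using f by (auto simp: L_def R_def)
    ultimately show ?thesis using card_Diff_add_le[OF finG(3)] cG by metis
  qed
  have all: "card (\<Union>H \<union> \<Union>G) \<le> card R + card (\<Union>H - R) + card (\<Union>G - (\<Union>H \<union> R))"
    using finH finG finR by (intro card_le_card_diffs) auto
  have L1e: "card L1 + 4 \<le> card (\<Union>(insert e L1))" if "L1 \<noteq> {}"
  proof -
    have "e \<notin> L1" "f \<notin> L1" using J I e unfolding L1_def by blast+
    then have "card (insert e L1) = card L1 + 1" "insert e L1 \<subset> H"
      using fL1 e f ef unfolding L1_def by (simp, blast)
    moreover have "card L1 \<ge> 1" using that fL1 by (simp add: Suc_leI card_gt_0_iff)
    ultimately show ?thesis using config_span[OF H(1), of "insert e L1"] by simp
  qed
  have Lne: "card L + 5 \<le> card (\<Union>(insert f (insert g L)))" if "L \<noteq> Q"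
  proof -
    have "f \<notin> L" "g \<notin> L" by (auto simp: L_def Q_def)
    then have "card (insert f (insert g L)) = card L + 2" using fL g by simp
    moreover have "insert f (insert g L) \<subset> G"
      using that f g unfolding L_def Q_def by blast
    ultimately show ?thesis using config_span[OF G(1), of "insert f (insert g L)"] by simp
  qed
  have Leq: "card (\<Union>G - (\<Union>H \<union> R)) = 0" if "L = Q"
  proof -
    have "G = insert f (insert g L)" using that f g by (auto simp: Q_def)
    then have "\<Union>G \<subseteq> \<Union>H \<union> R" using f by (auto simp: L_def R_def)
    then show ?thesis by (metis Diff_eq_empty_iff card.empty)
  qed
  have "card (\<Union>H \<union> \<Union>G) + card I \<le> card R + (k - 2) + card ((I \<union> Q) - J)"
  proof (cases "L1 = {}")
    \<comment> \<open>Here \<open>J\<close> meets \<open>H\<close>: the points of \<open>H\<close>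
      come first, where \<open>insert e L1\<close> has the surplus of a proper part, and then those
      of \<open>G\<close>, at most one for each triple of \<open>Q\<close> outside \<open>H\<close>
      and \<open>J\<close>.\<close>
    case False
    have "card (\<Union>G - (\<Union>H \<union> R)) + card L \<le> card Q"
      using Leq Lne A2 cQ by (cases "L = Q") auto
    then show ?thesis using all A1 L1e[OF False] T1 IL1 QL by simp
  next
    case True
    then have A1': "card (\<Union>H - R) + 3 \<le> k + 2" using A1 c3 by simp
    have IJ: "card (I \<inter> J) = 0" using True IL1 by simp
    show ?thesis
    proof (cases "L = Q")
      case False
      then show ?thesis using all A1' A2 Lne[OF False] T1 IJ QL cQ cL by simp
    next
      case LQ: True
      have JH: "J \<inter> H = {}" using True by (simp add: L1_def)
      show ?thesis
      proof (cases "J = {}")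
        \<comment> \<open>Now \<open>G - {g}\<close> lies in \<open>H\<close>, so all points of
          \<open>G\<close> are points of \<open>H\<close>, and the hypothesis on
          \<open>e \<inter> g\<close> makes the root span five points.\<close>
        case True
        have "G - {g} = insert f Q" using f g by (auto simp: Q_def)
        moreover have "insert f Q \<subseteq> H" using LQ True f by (auto simp: L_def)
        ultimately have "\<Union>G \<subseteq> \<Union>H"
          using config_Union_remove[OF G g(1)] by (metis Union_mono)
        then have "\<Union>H \<union> \<Union>G = \<Union>H" by auto
        moreover have "5 \<le> card R"
        proof -
          have "card (e \<union> g) + card (e \<inter> g) = card e + card g"
            using finH(2)[OF e(1)] finG(2)[OF g(1)] card_Un_Int[of e g] by simp
          then show ?thesis using eg c3 True by (simp add: R_def)
        qed
        ultimately show ?thesis using IT IJ cH H(2) by simp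
      next
        \<comment> \<open>\<open>J\<close> lies entirely in \<open>G\<close>, so the order is
          reversed: the points of \<open>G\<close> first, where \<open>insert g J\<close> is a
          proper part, then those of \<open>H\<close>, of which \<open>K\<close> is already
          covered.\<close>
        case Jne: False
        have JQ: "J \<subseteq> Q" using J JH I by (auto simp: Q_def)
        have gJ: "card J + 4 \<le> card (\<Union>(insert g J))"
        proof -
          have "g \<notin> J" using JQ by (auto simp: Q_def)
          then have "card (insert g J) = card J + 1" using finJ by simp
          moreover have "insert g J \<subset> G" using JQ f g unfolding Q_def by blast
          moreover have "card J \<ge> 1" using Jne finJ by (simp add: Suc_leI card_gt_0_iff)
          ultimately show ?thesis using config_span[OF G(1), of "insert g J"] by simp
        qed
        have B1: "card (\<Union>G - R) + card (\<Union>(insert g J)) \<le> k' + 2"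
        proof -
          have "insert g J \<subseteq> G" using JQ g by (auto simp: Q_def)
          then have "\<Union>(insert g J) \<subseteq> \<Union>G" by (rule Union_mono)
          moreover have "\<Union>(insert g J) \<subseteq> R" by (auto simp: R_def)
          ultimately show ?thesis using card_Diff_add_le[OF finG(3)] cG by metis
        qed
        define K where "K = insert e (insert f (Q - J))"
        have KH: "K \<subseteq> H" using e f LQ by (auto simp: K_def L_def)
        have "e \<notin> Q" "f \<notin> Q" using e by (auto simp: Q_def)
        then have cK: "card K = card (Q - J) + 2" using finQ ef by (simp add: K_def)
        have KR: "\<Union>K \<subseteq> \<Union>G \<union> R" using f by (auto simp: K_def Q_def R_def)
        have B2: "card (\<Union>H - (\<Union>G \<union> R)) + card (Q - J) + 2 \<le> k"
        proof (cases "K = H")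
          case True
          then have "card (\<Union>H - (\<Union>G \<union> R)) = 0" using KR by (metis Diff_eq_empty_iff card.empty)
          then show ?thesis using cK True cH by simp
        next
          case False
          then have "K \<subset> H" using KH by blast
          then have "card K + 3 \<le> card (\<Union>K)" using cK by (intro config_span[OF H(1)]) simp_all
          moreover have "card (\<Union>H - (\<Union>G \<union> R)) + card (\<Union>K) \<le> k + 2"
            using card_Diff_add_le[OF finH(3) Union_mono[OF KH] KR] cH by simp
          ultimately show ?thesis using cK by simp
        qed
        have "card (Q - J) + card J = card Q"
          using JQ finQ finJ by (metis card_Diff_subset card_mono le_add_diff_inverse2)
        moreover have "card (\<Union>G \<union> \<Union>H) \<le> card R + card (\<Union>G - R) + card (\<Union>H - (\<Union>G \<union> R))"
          using finH finG finR by (intro card_le_card_diffs) auto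
        ultimately show ?thesis using B1 B2 gJ cQ IT IJ by (simp add: Un_commute)
      qed
    qed
  qed
  then show ?thesis by (simp add: R_def Q_def)
qed

text \<open>A smallest set of at least two triples on too few points is a configuration by its
  minimality. Its size is not 2 because two triples meeting in at most one point span five
  points.\<close>

lemma exists_config_of_dense:
  assumes fin: "finite L" "\<forall>e\<in>L. card e = 3" and L: "2 \<le> card L" "card L \<le> j" "card (\<Union>L) \<le> card L + 2"
    and lin: "\<And>e f. e \<in> L \<Longrightarrow> f \<in> L \<Longrightarrow> e \<noteq> f \<Longrightarrow> card (e \<inter> f) \<le> 1"
  shows "\<exists>k H. 3 \<le> k \<and> k \<le> j \<and> H \<subseteq> L \<and> config k H"
proof -
  let ?P = "\<lambda>H. H \<subseteq> L \<and> 2 \<le> card H \<and> card (\<Union>H) \<le> card H + 2"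
  obtain H where H: "?P H" and min: "\<And>H'. ?P H' \<Longrightarrow> card H \<le> card H'"
    using ex_has_least_nat[of ?P L card] L by auto
  have finH: "finite H" using H fin finite_subset by auto
  have fin3: "finite e" if "e \<in> L" for e
    using fin that by (intro card_ge_0_finite) auto
  have span: "card L' + 3 \<le> card (\<Union>L')" if "L' \<subset> H" "2 \<le> card L'" for L'
  proof (rule ccontr)
    assume "\<not> ?thesis"
    then have "?P L'" using that H by auto
    then have "card H \<le> card L'" by (rule min)
    then show False using psubset_card_mono[OF finH that(1)] by simp
  qed
  have "card H \<noteq> 2"
  proof
    assume "card H = 2"
    then obtain e f where ef: "H = {e, f}" "e \<noteq> f" by (metis card_2_iff)
    then have "card (e \<union> f) + card (e \<inter> f) = card e + card f"
      using fin3[of e] fin3[of f] H card_Un_Int[of e f] by simp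
    then show False using lin[of e f] ef H fin(2) by simp
  qed
  then have c3: "3 \<le> card H" using H by simp
  obtain f where f: "f \<in> H" using c3 by fastforce
  have "card (H - {f}) + 3 \<le> card (\<Union>(H - {f}))"
    using f c3 finH by (intro span) (blast, simp)
  moreover have "card (\<Union>(H - {f})) \<le> card (\<Union>H)"
    using finH fin3 H by (intro card_mono) auto
  ultimately have "card (\<Union>H) = card H + 2" using H f finH c3 by simp
  then have "config (card H) H" using span H fin by (auto simp: config_def)
  moreover have "card H \<le> j" using H fin L by (meson card_mono le_trans)
  ultimately show ?thesis using c3 H by blast
qed

section \<open>Families of rooted structures\<close>

definition triples :: "nat \<Rightarrow> nat set set" where
  "triples n = {e. e \<subseteq> {..<n} \<and> card e = 3}"

definition pairs :: "nat \<Rightarrow> nat set set" where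
  "pairs n = {p. p \<subseteq> {..<n} \<and> card p = 2}"

definition configs :: "nat \<Rightarrow> nat \<Rightarrow> nat set set set" where
  "configs n k = {H. H \<subseteq> triples n \<and> config k H}"

lemma choose_le_power: "n choose k \<le> n ^ k"
  by (cases "k \<le> n") (auto simp: binomial_le_pow binomial_eq_0)

lemma finite_triples [simp]: "finite (triples n)"
  by (rule finite_subset[of _ "Pow {..<n}"]) (auto simp: triples_def)

lemma finite_pairs [simp]: "finite (pairs n)"
  by (rule finite_subset[of _ "Pow {..<n}"]) (auto simp: pairs_def)

lemma finite_configs [simp]: "finite (configs n k)"
  by (rule finite_subset[of _ "Pow (triples n)"]) (auto simp: configs_def)

lemma card_triples_le: "card (triples n) \<le> n ^ 3"
  using n_subsets[of "{..<n}" 3] choose_le_power[of n 3] by (simp add: triples_def)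

lemma card_pairs: "card (pairs n) = n choose 2"
  using n_subsets[of "{..<n}" 2] by (simp add: pairs_def)

lemma card_pairs_le: "card (pairs n) \<le> n ^ 2"
  using choose_le_power[of n 2] by (simp add: card_pairs)

lemma card_supersets_le:
  assumes "finite A" "R \<subseteq> A"
  shows "card {W. R \<subseteq> W \<and> W \<subseteq> A \<and> card W = j} \<le> card A ^ (j - card R)"
proof -
  let ?S = "{W. R \<subseteq> W \<and> W \<subseteq> A \<and> card W = j}"
  have finR: "finite R" using assms finite_subset by auto
  have "inj_on (\<lambda>W. W - R) ?S" by (auto simp: inj_on_def)
  then have "card ?S = card ((\<lambda>W. W - R) ` ?S)" by (simp add: card_image)
  also have "\<dots> \<le> card {B. B \<subseteq> A \<and> card B = j - card R}"
    using assms finR by (intro card_mono) (auto simp: card_Diff_subset)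
  also have "\<dots> = card A choose (j - card R)" using n_subsets[OF assms(1)] by simp
  also have "\<dots> \<le> card A ^ (j - card R)" by (rule choose_le_power)
  finally show ?thesis .
qed

lemma sum_supersets_le:
  assumes "finite A" "R \<subseteq> A" "A \<noteq> {}"
  shows "(\<Sum>W\<in>{W. R \<subseteq> W \<and> W \<subseteq> A \<and> card W \<le> w}. 1 / real (card A) ^ (card W - card R)) \<le> real w + 1"
proof -
  let ?S = "{W. R \<subseteq> W \<and> W \<subseteq> A \<and> card W \<le> w}"
  have n: "card A > 0" using assms by (simp add: card_gt_0_iff)
  have "(\<Sum>W\<in>?S. 1 / real (card A) ^ (card W - card R))
      = (\<Sum>j\<in>{..w}. \<Sum>W\<in>{W \<in> ?S. card W = j}. 1 / real (card A) ^ (card W - card R))"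
    by (rule sum.group[symmetric]) (use assms in auto)
  also have "\<dots> \<le> (\<Sum>j\<in>{..w}. 1)"
  proof (rule sum_mono)
    fix j assume "j \<in> {..w}"
    let ?Sj = "{W \<in> ?S. card W = j}"
    have "card ?Sj \<le> card {W. R \<subseteq> W \<and> W \<subseteq> A \<and> card W = j}"
      using assms by (intro card_mono) auto
    also have "\<dots> \<le> card A ^ (j - card R)" by (rule card_supersets_le[OF assms(1,2)])
    finally have c: "real (card ?Sj) \<le> real (card A) ^ (j - card R)" by (simp only: of_nat_power[symmetric] of_nat_le_iff)
    have "(\<Sum>W\<in>?Sj. 1 / real (card A) ^ (card W - card R)) = (\<Sum>W\<in>?Sj. 1 / real (card A) ^ (j - card R))"
      by (intro sum.cong) auto
    also have "\<dots> = real (card ?Sj) / real (card A) ^ (j - card R)" by simp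
    also have "\<dots> \<le> 1" using c n by (simp add: divide_le_eq)
    finally show "(\<Sum>W\<in>?Sj. 1 / real (card A) ^ (card W - card R)) \<le> 1" .
  qed
  also have "\<dots> = real w + 1" by simp
  finally show ?thesis .
qed

type_synonym struct = "nat set set \<times> nat set \<times> nat set set \<times> nat set set"

text \<open>A structure \<open>(H, f, T, G)\<close> consists of a configuration \<open>H\<close>, a triple \<open>f\<close> of it, a second
  configuration \<open>G\<close> (or \<open>{}\<close>) and the set \<open>T\<close> of those of their triples that are required to lie in \<open>M\<close>.\<close>

definition st_chosen :: "struct \<Rightarrow> nat set set" where
  "st_chosen = (\<lambda>(H, f, T, G). T)"

definition st_verts :: "struct \<Rightarrow> nat set" where
  "st_verts = (\<lambda>(H, f, T, G). \<Union>H \<union> \<Union>G)"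

text \<open>A crude count: on a vertex set of size at most \<open>w\<close> each of the four
  components of a structure has at most \<open>2 ^ (2 ^ w)\<close> values, and \<open>w + 1\<close>
  is the number of possible sizes.\<close>

definition st_const :: "nat \<Rightarrow> real" where
  "st_const w = (2 ^ (2 ^ w)) ^ 4 * (real w + 1)"

lemma card_structs_on_le:
  assumes "finite W" "card W \<le> w"
    and F: "\<And>H f T G. (H, f, T, G) \<in> F \<Longrightarrow> f \<in> H \<and> T \<subseteq> H \<union> G \<and> \<Union>H \<union> \<Union>G = W"
  shows "real (card F) \<le> (2 ^ (2 ^ w)) ^ 4"
proof -
  let ?P = "Pow (Pow W) \<times> Pow W \<times> Pow (Pow W) \<times> Pow (Pow W)"
  have "F \<subseteq> ?P"
  proof
    fix S assume S: "S \<in> F"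
    obtain H f T G where S': "S = (H, f, T, G)" by (cases S) auto
    have "f \<in> H" "T \<subseteq> H \<union> G" "\<Union>H \<union> \<Union>G = W" using F S S' by blast+
    then have "H \<subseteq> Pow W" "G \<subseteq> Pow W" by auto
    then show "S \<in> ?P" using \<open>f \<in> H\<close> \<open>T \<subseteq> H \<union> G\<close> unfolding S' by blast
  qed
  then have "card F \<le> card ?P" using assms(1) by (intro card_mono) auto
  also have "\<dots> = 2 ^ (2 ^ card W) * (2 ^ card W * (2 ^ (2 ^ card W) * 2 ^ (2 ^ card W)))"
    using assms(1) by (simp add: card_cartesian_product card_Pow)
  also have "\<dots> \<le> 2 ^ (2 ^ w) * (2 ^ (2 ^ w) * (2 ^ (2 ^ w) * 2 ^ (2 ^ w)))"
  proof -
    have a: "(2::nat) ^ (2 ^ card W) \<le> 2 ^ (2 ^ w)" using assms(2) by (intro power_increasing) auto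
    have "card W \<le> 2 ^ w" using assms(2) less_exp[of w] by linarith
    then have b: "(2::nat) ^ card W \<le> 2 ^ (2 ^ w)" by (intro power_increasing) auto
    show ?thesis using a b by (intro mult_mono) auto
  qed
  also have "\<dots> = (2 ^ (2 ^ w)) ^ 4" by (simp add: numeral_eq_Suc)
  finally have "card F \<le> (2 ^ (2 ^ w)) ^ 4" .
  then have "real (card F) \<le> real ((2 ^ (2 ^ w)) ^ 4)" by (simp only: of_nat_le_iff)
  then show ?thesis by simp
qed

text \<open>A family of structures is spread out enough for its moments to be small as soon as every
  partial choice \<open>J\<close> of the triples of a structure, together with the root \<open>R\<close>, already
  pins down enough of its vertices.\<close>

lemma sum_structs_le:
  fixes n :: nat and y :: real
  assumes n: "n > 0" and y: "1 \<le> y" and finF: "finite F"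
    and F: "\<And>H f T G. (H, f, T, G) \<in> F \<Longrightarrow> f \<in> H \<and> T \<subseteq> H \<union> G \<and> \<Union>H \<union> \<Union>G \<subseteq> {..<n} \<and>
        card (\<Union>H \<union> \<Union>G) \<le> w \<and> card T \<le> b \<and> finite T \<and> R \<subseteq> \<Union>H \<union> \<Union>G"
    and span: "\<And>H f T G J. (H, f, T, G) \<in> F \<Longrightarrow> J \<subseteq> T \<Longrightarrow>
        card (\<Union>H \<union> \<Union>G) \<le> card (R \<union> \<Union>J) + v + card (T - J)"
  shows "(\<Sum>x\<in>{x \<in> F. J \<subseteq> st_chosen x}. (y / n) ^ card (st_chosen x - J)) \<le> st_const w * real n ^ v * y ^ b"
proof -
  let ?F = "{x \<in> F. J \<subseteq> st_chosen x}"
  define R' where "R' = R \<union> \<Union>J"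
  let ?W = "{W. R' \<subseteq> W \<and> W \<subseteq> {..<n} \<and> card W \<le> w}"
  show ?thesis
  proof (cases "?F = {}")
    case True
    then have "(\<Sum>x\<in>?F. (y / n) ^ card (st_chosen x - J)) = 0" by (simp only: sum.empty)
    also have "0 \<le> st_const w * real n ^ v * y ^ b" using y by (simp add: st_const_def)
    finally show ?thesis .
  next
    case False
    have mem: "R' \<subseteq> st_verts x \<and> st_verts x \<subseteq> {..<n} \<and> card (st_verts x) \<le> w" if "x \<in> ?F" for x
    proof -
      obtain H f T G where x: "x = (H, f, T, G)" by (cases x) auto
      then have xF: "(H, f, T, G) \<in> F" and JT: "J \<subseteq> T" using that by (auto simp: st_chosen_def)
      have "\<Union>J \<subseteq> \<Union>H \<union> \<Union>G" using F[OF xF] JT by blast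
      then show ?thesis using F[OF xF] by (simp add: x R'_def st_verts_def)
    qed
    have R'n: "R' \<subseteq> {..<n}" using mem False by blast
    have pw: "(y / n) ^ card (st_chosen x - J) \<le> y ^ b * real n ^ v * (1 / real n ^ (card (st_verts x) - card R'))"
      if "x \<in> ?F" for x
    proof -
      obtain H f T G where x: "x = (H, f, T, G)" by (cases x) auto
      then have xF: "(H, f, T, G) \<in> F" and JT: "J \<subseteq> T" using that by (auto simp: st_chosen_def)
      let ?t = "card (T - J)"
      have "?t \<le> card T" using F[OF xF] by (intro card_mono) auto
      then have tb: "?t \<le> b" using F[OF xF] by simp
      \<comment> \<open>The powers of \<open>1 / n\<close> contributed by the missing triples pay
        for the new vertices up to \<open>n ^ v\<close>, while the powers of \<open>y\<close> are
        bounded wholesale by \<open>y ^ b\<close>.\<close>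
      have "card (st_verts x) - card R' \<le> v + ?t"
        using span[OF xF JT] by (simp add: x R'_def st_verts_def)
      then have "real n ^ (card (st_verts x) - card R') \<le> real n ^ (v + ?t)"
        using n by (intro power_increasing) auto
      then have "1 / real n ^ ?t \<le> real n ^ v * (1 / real n ^ (card (st_verts x) - card R'))"
        using n by (simp add: divide_simps power_add mult.commute)
      moreover have "y ^ ?t \<le> y ^ b" using tb y by (intro power_increasing) auto
      ultimately have "y ^ ?t * (1 / real n ^ ?t) \<le> y ^ b * (real n ^ v * (1 / real n ^ (card (st_verts x) - card R')))"
        using y by (intro mult_mono) auto
      then show ?thesis by (simp add: x st_chosen_def power_divide)
    qed
    have "(\<Sum>x\<in>?F. (y / n) ^ card (st_chosen x - J))
        \<le> (\<Sum>x\<in>?F. y ^ b * real n ^ v * (1 / real n ^ (card (st_verts x) - card R')))"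
      by (intro sum_mono pw)
    also have "\<dots> = y ^ b * real n ^ v * (\<Sum>x\<in>?F. 1 / real n ^ (card (st_verts x) - card R'))"
      by (simp add: sum_distrib_left)
    also have "\<dots> \<le> y ^ b * real n ^ v * ((2 ^ (2 ^ w)) ^ 4 * (real w + 1))"
    proof (rule mult_left_mono)
    have "(\<Sum>x\<in>?F. 1 / real n ^ (card (st_verts x) - card R'))
        = (\<Sum>W\<in>?W. \<Sum>x\<in>{x \<in> ?F. st_verts x = W}. 1 / real n ^ (card (st_verts x) - card R'))"
    proof (rule sum.group[symmetric])
      show "st_verts ` ?F \<subseteq> ?W" using mem by blast
    qed (use finF in auto)
    also have "\<dots> \<le> (\<Sum>W\<in>?W. (2 ^ (2 ^ w)) ^ 4 * (1 / real n ^ (card W - card R')))"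
    proof (rule sum_mono)
      fix W assume W: "W \<in> ?W"
      then have finW: "finite W" using finite_subset by auto
      let ?FW = "{x \<in> ?F. st_verts x = W}"
      have "real (card ?FW) \<le> (2 ^ (2 ^ w)) ^ 4"
      proof (rule card_structs_on_le[OF finW])
        show "card W \<le> w" using W by simp
        fix H f T G assume "(H, f, T, G) \<in> ?FW"
        then show "f \<in> H \<and> T \<subseteq> H \<union> G \<and> \<Union>H \<union> \<Union>G = W"
          using F[of H f T G] by (simp add: st_verts_def)
      qed
      moreover have "(\<Sum>x\<in>?FW. 1 / real n ^ (card (st_verts x) - card R')) = real (card ?FW) * (1 / real n ^ (card W - card R'))"
        by simp
      ultimately show "(\<Sum>x\<in>?FW. 1 / real n ^ (card (st_verts x) - card R')) \<le> (2 ^ (2 ^ w)) ^ 4 * (1 / real n ^ (card W - card R'))"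
        by (simp add: divide_right_mono)
    qed
    also have "\<dots> = (2 ^ (2 ^ w)) ^ 4 * (\<Sum>W\<in>?W. 1 / real n ^ (card W - card R'))"
      by (simp add: sum_distrib_left)
    also have "\<dots> \<le> (2 ^ (2 ^ w)) ^ 4 * (real w + 1)"
      using sum_supersets_le[of "{..<n}" R' w] R'n n by (intro mult_left_mono) auto
    finally show "(\<Sum>x\<in>?F. 1 / real n ^ (card (st_verts x) - card R')) \<le> (2 ^ (2 ^ w)) ^ 4 * (real w + 1)" .
    qed (use y in simp)
    finally show ?thesis by (simp add: st_const_def mult_ac)
  qed
qed

section \<open>Families of rooted structures that control one-step changes\<close>

definition fam_two :: "nat \<Rightarrow> nat set \<Rightarrow> nat set \<Rightarrow> nat \<Rightarrow> nat \<Rightarrow> struct set" where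
  "fam_two n e g k c = {(H, f, T, G). H \<in> configs n k \<and> e \<in> H \<and> g \<in> H \<and> e \<noteq> g \<and> f = g \<and>
     T \<subseteq> H - {e, g} \<and> card T = c \<and> G = {}}"

definition fam_pair :: "nat \<Rightarrow> nat set \<Rightarrow> nat set \<Rightarrow> nat \<Rightarrow> nat \<Rightarrow> struct set" where
  "fam_pair n e p k c = {(H, f, T, G). H \<in> configs n k \<and> e \<in> H \<and> f \<in> H \<and> e \<noteq> f \<and> p \<subseteq> f \<and>
     T \<subseteq> H - {e, f} \<and> card T = c \<and> G = {}}"

definition fam_linked :: "nat \<Rightarrow> nat set \<Rightarrow> nat set \<Rightarrow> nat \<Rightarrow> nat \<Rightarrow> nat \<Rightarrow> struct set" where
  "fam_linked n e g k c k' = {(H, f, T, G). H \<in> configs n k \<and> G \<in> configs n k' \<and> e \<in> H \<and> e \<notin> G \<and>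
     f \<in> H \<and> f \<in> G \<and> g \<in> G \<and> g \<noteq> f \<and> card (e \<inter> g) \<le> 1 \<and>
     (\<exists>I. I \<subseteq> H - {e, f} \<and> card I = c \<and> T = I \<union> (G - {f, g}))}"

text \<open>The three families count what one move can do to a configuration through
  \<open>e\<close>: the triple \<open>g\<close> joins \<open>M\<close>, a triple containing the pair
  \<open>p\<close> is lost, or a triple is blocked by \<open>g\<close> through a second
  configuration. The second component is the power of \<open>n\<close> that the number of such
  structures inside \<open>M\<close> may reach, up to the factor \<open>Y\<close>.\<close>

definition fams :: "nat \<Rightarrow> nat \<Rightarrow> (struct set \<times> nat) set" where
  "fams n l =
     (\<lambda>(e, g, k, c). (fam_two n e g k c, k - 3 - c)) `
       {(e, g, k, c). e \<in> triples n \<and> g \<in> triples n \<and> 3 \<le> k \<and> k \<le> l \<and> c + 3 \<le> k} \<union>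
     (\<lambda>(e, p, k, c). (fam_pair n e p k c, k - 2 - c)) `
       {(e, p, k, c). e \<in> triples n \<and> p \<in> pairs n \<and> 3 \<le> k \<and> k \<le> l \<and> c + 2 \<le> k} \<union>
     (\<lambda>(e, g, k, c, k'). (fam_linked n e g k c k', k - 2 - c)) `
       {(e, g, k, c, k'). e \<in> triples n \<and> g \<in> triples n \<and> 3 \<le> k \<and> k \<le> l \<and> c + 2 \<le> k \<and> 3 \<le> k' \<and> k' \<le> l}"

lemma configs_Union_subset: "H \<in> configs n k \<Longrightarrow> \<Union>H \<subseteq> {..<n}"
  by (auto simp: configs_def triples_def)

lemma configs_facts:
  assumes "H \<in> configs n k" "3 \<le> k"
  shows "config k H" "card H = k" "card (\<Union>H) = k + 2" "finite H"
proof -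
  show "config k H" using assms by (simp add: configs_def)
  then show "card H = k" "card (\<Union>H) = k + 2" "finite H"
    using config_finite(1)[OF _ assms(2)] unfolding config_def by blast+
qed

lemma finite_fam:
  "finite (fam_two n e g k c)" "finite (fam_pair n e p k c)" "finite (fam_linked n e g k c k')"
proof -
  let ?P = "Pow (triples n) \<times> triples n \<times> Pow (triples n) \<times> Pow (triples n)"
  have sub: "fam_two n e g k c \<subseteq> ?P" "fam_pair n e p k c \<subseteq> ?P" "fam_linked n e g k c k' \<subseteq> ?P"
    by (auto simp: fam_two_def fam_pair_def fam_linked_def configs_def)
  have fin: "finite ?P" by simp
  show "finite (fam_two n e g k c)" "finite (fam_pair n e p k c)" "finite (fam_linked n e g k c k')"
    using sub[THEN finite_subset, OF fin] by simp_all
qed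

text \<open>Since \<open>c \<le> k - 3\<close>, the triples \<open>e\<close>, \<open>g\<close> and
  \<open>J\<close> never exhaust \<open>H\<close>. They therefore span at least
  \<open>card J + 5\<close> of its \<open>k + 2\<close> points, one more than is guaranteed for a
  root made of \<open>e\<close> and a pair.\<close>

lemma fam_two_sum_le:
  assumes "n > 0" "1 \<le> y" and k: "3 \<le> k" "k \<le> l" and c: "c + 3 \<le> k"
  shows "(\<Sum>x\<in>{x \<in> fam_two n e g k c. J \<subseteq> st_chosen x}. (y / n) ^ card (st_chosen x - J))
    \<le> st_const (2 * l + 4) * real n ^ (k - 3 - c) * y ^ (2 * l)"
proof (rule sum_structs_le[where R = "e \<union> g", OF assms(1,2) finite_fam(1)])
  fix H f T G assume x: "(H, f, T, G) \<in> fam_two n e g k c"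
  then have H: "H \<in> configs n k" and eg: "e \<in> H" "g \<in> H" "e \<noteq> g" and f: "f = g"
    and T: "T \<subseteq> H - {e, g}" "card T = c" and G: "G = {}" by (auto simp: fam_two_def)
  note Hf = configs_facts[OF H k(1)]
  have finT: "finite T" using T Hf finite_subset by blast
  show "f \<in> H \<and> T \<subseteq> H \<union> G \<and> \<Union>H \<union> \<Union>G \<subseteq> {..<n} \<and> card (\<Union>H \<union> \<Union>G) \<le> 2 * l + 4 \<and>
      card T \<le> 2 * l \<and> finite T \<and> e \<union> g \<subseteq> \<Union>H \<union> \<Union>G"
  proof -
    have "f \<in> H" "T \<subseteq> H \<union> G" "e \<union> g \<subseteq> \<Union>H \<union> \<Union>G" using eg f T by blast+
    moreover have "\<Union>H \<union> \<Union>G = \<Union>H" using G by simp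
    moreover have "card T \<le> 2 * l" "k + 2 \<le> 2 * l + 4" using T k c by simp_all
    ultimately show ?thesis using Hf finT configs_Union_subset[OF H] by simp
  qed
  fix J assume J: "J \<subseteq> T"
  have finJ: "finite J" using J finT finite_subset by blast
  have cJ: "card (insert e (insert g J)) = card J + 2"
  proof -
    have "e \<notin> insert g J" "g \<notin> J" using J T eg by blast+
    then show ?thesis using finJ by simp
  qed
  have JT: "card J \<le> card T" using J finT by (simp add: card_mono)
  have "card (insert e (insert g J)) < card H" using cJ JT T c Hf(2) by simp
  then have "insert e (insert g J) \<noteq> H" by fastforce
  moreover have "insert e (insert g J) \<subseteq> H" using J T eg by blast
  ultimately have "insert e (insert g J) \<subset> H" by blast
  then have "card J + 5 \<le> card (\<Union>(insert e (insert g J)))"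
    using config_span[OF Hf(1), of "insert e (insert g J)"] cJ by simp
  moreover have "\<Union>(insert e (insert g J)) = e \<union> g \<union> \<Union>J" by auto
  moreover have "card (T - J) = c - card J" using T J finJ by (simp add: card_Diff_subset)
  ultimately show "card (\<Union>H \<union> \<Union>G) \<le> card (e \<union> g \<union> \<Union>J) + (k - 3 - c) + card (T - J)"
    using Hf G JT T c by simp
qed

lemma fam_pair_sum_le:
  assumes "n > 0" "1 \<le> y" and k: "3 \<le> k" "k \<le> l" and c: "c + 2 \<le> k" and p: "card p = 2"
  shows "(\<Sum>x\<in>{x \<in> fam_pair n e p k c. J \<subseteq> st_chosen x}. (y / n) ^ card (st_chosen x - J))
    \<le> st_const (2 * l + 4) * real n ^ (k - 2 - c) * y ^ (2 * l)"
proof (rule sum_structs_le[where R = "e \<union> p", OF assms(1,2) finite_fam(2)])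
  fix H f T G assume x: "(H, f, T, G) \<in> fam_pair n e p k c"
  then have H: "H \<in> configs n k" and ef: "e \<in> H" "f \<in> H" "e \<noteq> f" and pf: "p \<subseteq> f"
    and T: "T \<subseteq> H - {e, f}" "card T = c" and G: "G = {}" by (auto simp: fam_pair_def)
  note Hf = configs_facts[OF H k(1)]
  have finT: "finite T" using T Hf finite_subset by blast
  show "f \<in> H \<and> T \<subseteq> H \<union> G \<and> \<Union>H \<union> \<Union>G \<subseteq> {..<n} \<and> card (\<Union>H \<union> \<Union>G) \<le> 2 * l + 4 \<and>
      card T \<le> 2 * l \<and> finite T \<and> e \<union> p \<subseteq> \<Union>H \<union> \<Union>G"
  proof -
    have "f \<in> H" "T \<subseteq> H \<union> G" "e \<union> p \<subseteq> \<Union>H \<union> \<Union>G" using ef pf T by blast+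
    moreover have "\<Union>H \<union> \<Union>G = \<Union>H" using G by simp
    moreover have "card T \<le> 2 * l" "k + 2 \<le> 2 * l + 4" using T k c by simp_all
    ultimately show ?thesis using Hf finT configs_Union_subset[OF H] by simp
  qed
  fix J assume J: "J \<subseteq> T"
  have finJ: "finite J" using J finT finite_subset by blast
  have JT: "card J \<le> card T" using J finT by (simp add: card_mono)
  have "card J + 4 \<le> card (e \<union> p \<union> \<Union>J)"
    using J T by (intro config_span_rooted[OF Hf(1) k(1) ef pf p]) blast
  moreover have "card (T - J) = c - card J" using T J finJ by (simp add: card_Diff_subset)
  ultimately show "card (\<Union>H \<union> \<Union>G) \<le> card (e \<union> p \<union> \<Union>J) + (k - 2 - c) + card (T - J)"
    using Hf G JT T c by simp
qed

lemma fam_linked_sum_le: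
  assumes "n > 0" "1 \<le> y" and k: "3 \<le> k" "k \<le> l" and c: "c + 2 \<le> k" and k': "3 \<le> k'" "k' \<le> l"
  shows "(\<Sum>x\<in>{x \<in> fam_linked n e g k c k'. J \<subseteq> st_chosen x}. (y / n) ^ card (st_chosen x - J))
    \<le> st_const (2 * l + 4) * real n ^ (k - 2 - c) * y ^ (2 * l)"
proof (rule sum_structs_le[where R = "e \<union> g", OF assms(1,2) finite_fam(3)])
  fix H f T G assume x: "(H, f, T, G) \<in> fam_linked n e g k c k'"
  then obtain I where H: "H \<in> configs n k" and G: "G \<in> configs n k'" and e: "e \<in> H" "e \<notin> G"
    and f: "f \<in> H" "f \<in> G" and g: "g \<in> G" "g \<noteq> f" and eg: "card (e \<inter> g) \<le> 1"
    and I: "I \<subseteq> H - {e, f}" "card I = c" and T: "T = I \<union> (G - {f, g})"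
    by (auto simp: fam_linked_def)
  note Hf = configs_facts[OF H k(1)] and Gf = configs_facts[OF G k'(1)]
  have finI: "finite I" using I Hf finite_subset by blast
  have finT: "finite T" using T Gf finI by simp
  have "card T \<le> card I + card (G - {f, g})" using T card_Un_le by simp
  also have "card (G - {f, g}) \<le> k'" using Gf by (metis Diff_subset card_mono)
  finally have cT: "card T \<le> 2 * l" using I k c k' by simp
  have "card (\<Union>H \<union> \<Union>G) \<le> card (\<Union>H) + card (\<Union>G)" by (rule card_Un_le)
  then have cV: "card (\<Union>H \<union> \<Union>G) \<le> 2 * l + 4" using Hf Gf k k' by simp
  have "T \<subseteq> H \<union> G" using I T by blast
  moreover have "e \<union> g \<subseteq> \<Union>H \<union> \<Union>G" using e g by blast
  moreover have "\<Union>H \<union> \<Union>G \<subseteq> {..<n}" using configs_Union_subset H G by (metis Un_least)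
  ultimately show "f \<in> H \<and> T \<subseteq> H \<union> G \<and> \<Union>H \<union> \<Union>G \<subseteq> {..<n} \<and> card (\<Union>H \<union> \<Union>G) \<le> 2 * l + 4 \<and>
      card T \<le> 2 * l \<and> finite T \<and> e \<union> g \<subseteq> \<Union>H \<union> \<Union>G"
    using f cT finT cV by blast
  fix J assume J: "J \<subseteq> T"
  have "card (\<Union>H \<union> \<Union>G) + card I \<le> card (e \<union> g \<union> \<Union>J) + (k - 2) + card (T - J)"
    using two_configs_span[OF Hf(1) k(1) Gf(1) k'(1) e f g eg I(1)] J unfolding T by blast
  then show "card (\<Union>H \<union> \<Union>G) \<le> card (e \<union> g \<union> \<Union>J) + (k - 2 - c) + card (T - J)"
    using I c by simp
qed

lemma fams_facts:
  assumes "(F, v) \<in> fams n l"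
  shows "finite F" "\<And>x. x \<in> F \<Longrightarrow> finite (st_chosen x)" "\<And>x. x \<in> F \<Longrightarrow> card (st_chosen x) \<le> 2 * l"
    "\<And>y J. n > 0 \<Longrightarrow> 1 \<le> y \<Longrightarrow> (\<Sum>x\<in>{x \<in> F. J \<subseteq> st_chosen x}. (y / n) ^ card (st_chosen x - J))
      \<le> st_const (2 * l + 4) * real n ^ v * y ^ (2 * l)"
proof -
  consider (2) e g k c where "F = fam_two n e g k c" "v = k - 3 - c" "3 \<le> k" "k \<le> l" "c + 3 \<le> k"
    | (3) e p k c where "F = fam_pair n e p k c" "v = k - 2 - c" "3 \<le> k" "k \<le> l" "c + 2 \<le> k" "card p = 2"
    | (4) e g k c k' where "F = fam_linked n e g k c k'" "v = k - 2 - c" "3 \<le> k" "k \<le> l" "c + 2 \<le> k" "3 \<le> k'" "k' \<le> l"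
    using assms unfolding fams_def pairs_def by auto
  note cases = this
  show "finite F" by (rule cases) (simp_all add: finite_fam)
  have *: "finite (st_chosen x) \<and> card (st_chosen x) \<le> 2 * l" if x: "x \<in> F" for x
  proof -
    obtain H f T G where x': "x = (H, f, T, G)" by (cases x) auto
    show ?thesis
    proof (rule cases)
      fix e g k c assume "F = fam_two n e g k c" and k: "3 \<le> k" "k \<le> l" "c + 3 \<le> k"
      then have "H \<in> configs n k" "T \<subseteq> H" "card T = c" using x x' by (auto simp: fam_two_def)
      then show ?thesis using k configs_facts(4)[of H n k] finite_subset by (auto simp: x' st_chosen_def)
    next
      fix e p k c assume "F = fam_pair n e p k c" and k: "3 \<le> k" "k \<le> l" "c + 2 \<le> k"
      then have "H \<in> configs n k" "T \<subseteq> H" "card T = c" using x x' by (auto simp: fam_pair_def)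
      then show ?thesis using k configs_facts(4)[of H n k] finite_subset by (auto simp: x' st_chosen_def)
    next
      fix e g k c k' assume "F = fam_linked n e g k c k'" and k: "3 \<le> k" "k \<le> l" "c + 2 \<le> k" "3 \<le> k'" "k' \<le> l"
      then obtain I where H: "H \<in> configs n k" "G \<in> configs n k'" and I: "I \<subseteq> H" "card I = c" and T: "T = I \<union> (G - {f, g})"
        using x x' by (auto simp: fam_linked_def)
      note Hf = configs_facts[OF H(1) k(1)] and Gf = configs_facts[OF H(2) k(4)]
      have "finite T" using I T Hf Gf finite_subset by blast
      moreover have "card T \<le> card I + card (G - {f, g})" using T card_Un_le by simp
      moreover have "card (G - {f, g}) \<le> k'" using Gf by (metis Diff_subset card_mono)
      ultimately show ?thesis using I k by (simp add: x' st_chosen_def)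
    qed
  qed
  show "\<And>x. x \<in> F \<Longrightarrow> finite (st_chosen x)" "\<And>x. x \<in> F \<Longrightarrow> card (st_chosen x) \<le> 2 * l" using * by auto
  fix y :: real and J assume n: "n > 0" and y: "1 \<le> y"
  show "(\<Sum>x\<in>{x \<in> F. J \<subseteq> st_chosen x}. (y / n) ^ card (st_chosen x - J))
      \<le> st_const (2 * l + 4) * real n ^ v * y ^ (2 * l)"
    by (rule cases) (simp_all only: fam_two_sum_le[OF n y] fam_pair_sum_le[OF n y] fam_linked_sum_le[OF n y])
qed

text \<open>The exponent 6 is what the power \<open>s\<close> of the moments has to beat when the
  contributions of all families are added.\<close>

lemma finite_fams: "finite (fams n l)" and card_fams_le: "n > 0 \<Longrightarrow> card (fams n l) \<le> 3 * (l + 1) ^ 3 * n ^ 6"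
proof -
  let ?A = "{(e, g, k, c). e \<in> triples n \<and> g \<in> triples n \<and> 3 \<le> k \<and> k \<le> l \<and> c + 3 \<le> k}"
  let ?B = "{(e, p, k, c). e \<in> triples n \<and> p \<in> pairs n \<and> 3 \<le> k \<and> k \<le> l \<and> c + 2 \<le> k}"
  let ?C = "{(e, g, k, c, k'). e \<in> triples n \<and> g \<in> triples n \<and> 3 \<le> k \<and> k \<le> l \<and> c + 2 \<le> k \<and> 3 \<le> k' \<and> k' \<le> l}"
  let ?A' = "triples n \<times> triples n \<times> {..l} \<times> {..l}"
  let ?B' = "triples n \<times> pairs n \<times> {..l} \<times> {..l}"
  let ?C' = "triples n \<times> triples n \<times> {..l} \<times> {..l} \<times> {..l}"
  have sub: "?A \<subseteq> ?A'" "?B \<subseteq> ?B'" "?C \<subseteq> ?C'" by auto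
  have fin': "finite ?A'" "finite ?B'" "finite ?C'" by auto
  have fin: "finite ?A" "finite ?B" "finite ?C" by (rule finite_subset[OF sub(1) fin'(1)], rule finite_subset[OF sub(2) fin'(2)], rule finite_subset[OF sub(3) fin'(3)])
  show "finite (fams n l)" unfolding fams_def using fin by blast
  assume n: "n > 0"
  have tt: "card (triples n) * card (triples n) \<le> n ^ 6"
    using mult_mono[OF card_triples_le card_triples_le, of n n] by (simp add: power_add[symmetric])
  have tp: "card (triples n) * card (pairs n) \<le> n ^ 6"
  proof -
    have "card (triples n) * card (pairs n) \<le> n ^ 3 * n ^ 2"
      by (intro mult_mono card_triples_le card_pairs_le) auto
    also have "\<dots> = n ^ 5" by (simp add: power_add[symmetric])
    also have "\<dots> \<le> n ^ 6" using n by (intro power_increasing) auto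
    finally show ?thesis .
  qed
  have l2: "(l + 1) * (l + 1) \<le> (l + 1) ^ 3" by (simp add: power3_eq_cube)
  have "card ?A \<le> card ?A'" by (rule card_mono[OF fin'(1) sub(1)])
  also have "\<dots> = (card (triples n) * card (triples n)) * ((l + 1) * (l + 1))"
    by (simp only: card_cartesian_product card_atMost Suc_eq_plus1 mult.assoc)
  also have "\<dots> \<le> n ^ 6 * (l + 1) ^ 3" using tt l2 by (intro mult_mono) auto
  finally have A: "card ?A \<le> n ^ 6 * (l + 1) ^ 3" .
  have "card ?B \<le> card ?B'" by (rule card_mono[OF fin'(2) sub(2)])
  also have "\<dots> = (card (triples n) * card (pairs n)) * ((l + 1) * (l + 1))"
    by (simp only: card_cartesian_product card_atMost Suc_eq_plus1 mult.assoc)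
  also have "\<dots> \<le> n ^ 6 * (l + 1) ^ 3" using tp l2 by (intro mult_mono) auto
  finally have B: "card ?B \<le> n ^ 6 * (l + 1) ^ 3" .
  have "card ?C \<le> card ?C'" by (rule card_mono[OF fin'(3) sub(3)])
  also have "\<dots> = (card (triples n) * card (triples n)) * (l + 1) ^ 3"
    by (simp only: card_cartesian_product card_atMost Suc_eq_plus1 power3_eq_cube mult.assoc)
  also have "\<dots> \<le> n ^ 6 * (l + 1) ^ 3" using tt by (intro mult_mono) auto
  finally have C: "card ?C \<le> n ^ 6 * (l + 1) ^ 3" .
  let ?f = "\<lambda>(e, g, k, c). (fam_two n e g k c, k - 3 - c)"
  let ?g = "\<lambda>(e, p, k, c). (fam_pair n e p k c, k - 2 - c)"
  let ?h = "\<lambda>(e, g, k, c, k'). (fam_linked n e g k c k', k - 2 - c)"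
  have "card (fams n l) \<le> card (?f ` ?A \<union> ?g ` ?B) + card (?h ` ?C)"
    unfolding fams_def by (rule card_Un_le)
  also have "\<dots> \<le> card (?f ` ?A) + card (?g ` ?B) + card (?h ` ?C)" using card_Un_le by auto
  also have "\<dots> \<le> card ?A + card ?B + card ?C"
    using card_image_le[OF fin(1), of ?f] card_image_le[OF fin(2), of ?g] card_image_le[OF fin(3), of ?h] by linarith
  also have "\<dots> \<le> 3 * (l + 1) ^ 3 * n ^ 6" using A B C by (simp add: mult_ac)
  finally show "card (fams n l) \<le> 3 * (l + 1) ^ 3 * n ^ 6" .
qed

section \<open>Moves and their weights\<close>

datatype move = Add "nat set" | Waste "nat set" | Del "nat set" | Null

definition conf :: "nat \<Rightarrow> nat \<Rightarrow> nat set set \<Rightarrow> nat set \<Rightarrow> nat set \<Rightarrow> bool" where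
  "conf n l M f e \<longleftrightarrow> e \<noteq> f \<and>
     (\<exists>k H. 3 \<le> k \<and> k \<le> l \<and> H \<in> configs n k \<and> e \<in> H \<and> f \<in> H \<and> H \<subseteq> insert e (insert f M))"

text \<open>\<open>Add e\<close> also removes \<open>e\<close> itself, because
  \<open>card (e \<inter> e) = 3\<close>; no separate clause is needed for it.\<close>

fun lost :: "nat \<Rightarrow> nat \<Rightarrow> nat set set \<Rightarrow> nat set set \<Rightarrow> move \<Rightarrow> nat set set" where
  "lost n l M A (Add e) = {f \<in> A. 2 \<le> card (f \<inter> e) \<or> conf n l M f e}"
| "lost n l M A (Waste p) = {f \<in> A. p \<subseteq> f}"
| "lost n l M A (Del f) = {f} \<inter> A"
| "lost n l M A Null = {}"

fun gone :: "nat set set \<Rightarrow> move \<Rightarrow> nat set set" where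
  "gone P (Add e) = {p \<in> P. p \<subseteq> e}"
| "gone P (Waste p) = {p} \<inter> P"
| "gone P (Del f) = {}"
| "gone P Null = {}"

fun added :: "move \<Rightarrow> nat set set" where
  "added (Add e) = {e}"
| "added (Waste p) = {}"
| "added (Del f) = {}"
| "added Null = {}"

definition moves :: "nat set set \<Rightarrow> nat set set \<Rightarrow> move set" where
  "moves A P = insert Null (Add ` A \<union> Waste ` P \<union> Del ` A)"

definition deg :: "nat set set \<Rightarrow> nat set \<Rightarrow> nat" where
  "deg A p = card {f \<in> A. p \<subseteq> f}"

section \<open>Admissible states and their preservation by every move\<close>

definition valid_state :: "nat \<Rightarrow> nat \<Rightarrow> nat set set \<Rightarrow> nat set set \<Rightarrow> nat set set \<Rightarrow> bool" where
  "valid_state n l M A P \<longleftrightarrow> M \<subseteq> triples n \<and> A \<subseteq> triples n \<and> P \<subseteq> pairs n \<and>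
     (\<forall>f\<in>A. \<forall>p. p \<subseteq> f \<longrightarrow> card p = 2 \<longrightarrow> p \<in> P) \<and>
     (\<forall>e\<in>M. \<forall>p. p \<subseteq> e \<longrightarrow> card p = 2 \<longrightarrow> p \<notin> P) \<and>
     (\<forall>e\<in>M. \<forall>f\<in>M. e \<noteq> f \<longrightarrow> card (e \<inter> f) \<le> 1) \<and>
     (\<forall>k H. 3 \<le> k \<longrightarrow> k \<le> l \<longrightarrow> H \<in> configs n k \<longrightarrow> \<not> H \<subseteq> M \<and> (\<forall>f\<in>A. \<not> H \<subseteq> insert f M))"

lemma valid_stateD:
  assumes "valid_state n l M A P"
  shows "M \<subseteq> triples n" "A \<subseteq> triples n" "P \<subseteq> pairs n"
    "\<And>f p. f \<in> A \<Longrightarrow> p \<subseteq> f \<Longrightarrow> card p = 2 \<Longrightarrow> p \<in> P"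
    "\<And>e p. e \<in> M \<Longrightarrow> p \<subseteq> e \<Longrightarrow> card p = 2 \<Longrightarrow> p \<notin> P"
    "\<And>e f. e \<in> M \<Longrightarrow> f \<in> M \<Longrightarrow> e \<noteq> f \<Longrightarrow> card (e \<inter> f) \<le> 1"
    "\<And>k H. 3 \<le> k \<Longrightarrow> k \<le> l \<Longrightarrow> H \<in> configs n k \<Longrightarrow> \<not> H \<subseteq> M"
    "\<And>k H f. 3 \<le> k \<Longrightarrow> k \<le> l \<Longrightarrow> H \<in> configs n k \<Longrightarrow> f \<in> A \<Longrightarrow> \<not> H \<subseteq> insert f M"
  using assms by (simp_all add: valid_state_def)

lemma card_pairs_of_triple:
  assumes "card e = 3"
  shows "card {p. p \<subseteq> e \<and> card p = 2} = 3" "finite {p. p \<subseteq> e \<and> card p = 2}"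
proof -
  have fin: "finite e" using assms by (intro card_ge_0_finite) simp
  show "card {p. p \<subseteq> e \<and> card p = 2} = 3" using n_subsets[OF fin, of 2] assms by (simp add: choose_two)
  show "finite {p. p \<subseteq> e \<and> card p = 2}" using fin by simp
qed

lemma obtain_pair_in_inter:
  assumes "2 \<le> card (f \<inter> e)"
  obtains p where "p \<subseteq> f" "p \<subseteq> e" "card p = 2"
  using obtain_subset_with_card_n[OF assms] by (metis le_inf_iff)

lemma triples_facts: "e \<in> triples n \<Longrightarrow> card e = 3 \<and> finite e \<and> e \<subseteq> {..<n}"
  by (auto simp: triples_def intro: finite_subset)

lemma pairs_facts: "p \<in> pairs n \<Longrightarrow> card p = 2 \<and> finite p \<and> p \<subseteq> {..<n}"
  by (auto simp: pairs_def intro: finite_subset)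

lemma valid_state_disjoint:
  assumes "valid_state n l M A P"
  shows "M \<inter> A = {}"
proof (rule ccontr)
  assume "M \<inter> A \<noteq> {}"
  then obtain e where e: "e \<in> M" "e \<in> A" by auto
  then have "e \<in> triples n" using valid_stateD(1)[OF assms] by blast
  then have "2 \<le> card e" using triples_facts[of e n] by simp
  then obtain p where "p \<subseteq> e" "card p = 2" using obtain_subset_with_card_n[of 2 e] by metis
  then show False using e valid_stateD(4,5)[OF assms] by metis
qed

lemma valid_state_initial:
  "valid_state n l {} (triples n) (pairs n)"
proof -
  have no: "\<not> H \<subseteq> insert f {}" if "3 \<le> k" "H \<in> configs n k" for k H f
  proof
    assume "H \<subseteq> insert f {}"
    then have "card H \<le> card {f}" by (intro card_mono) auto
    then show False using configs_facts(2)[OF that(2,1)] that(1) by simp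
  qed
  then have "\<not> H \<subseteq> {}" if "3 \<le> k" "H \<in> configs n k" for k H using that by blast
  with no show ?thesis unfolding valid_state_def by (auto simp: triples_def pairs_def)
qed

text \<open>Only \<open>Add e\<close> is critical. A configuration inside
  \<open>insert f (insert e M)\<close> contains both \<open>e\<close> and \<open>f\<close>, since
  otherwise the old state would already exclude it; then \<open>conf\<close> holds and
  \<open>f\<close> has left \<open>A\<close>.\<close>

lemma valid_state_step:
  assumes v: "valid_state n l M A P" and m: "m \<in> moves A P"
  shows "valid_state n l (M \<union> added m) (A - lost n l M A m) (P - gone P m)"
proof (cases "\<exists>e\<in>A. m = Add e")
  case False
  then have add: "added m = {}" using m by (auto simp: moves_def)
  have "p \<notin> gone P m" if "f \<in> A - lost n l M A m" "p \<subseteq> f" for f p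
    using False m that by (auto simp: moves_def)
  note gone = this
  show ?thesis
    unfolding valid_state_def add Un_empty_right
  proof (intro conjI ballI allI impI)
    show "M \<subseteq> triples n" "A - lost n l M A m \<subseteq> triples n" "P - gone P m \<subseteq> pairs n"
      using valid_stateD(1-3)[OF v] by blast+
  next
    fix f p assume "f \<in> A - lost n l M A m" "p \<subseteq> f" "card p = 2"
    then show "p \<in> P - gone P m" using gone valid_stateD(4)[OF v] by blast
  next
    fix e p assume "e \<in> M" "p \<subseteq> e" "card p = 2"
    then show "p \<notin> P - gone P m" using valid_stateD(5)[OF v] by blast
  next
    fix e f assume "e \<in> M" "f \<in> M" "e \<noteq> f"
    then show "card (e \<inter> f) \<le> 1" by (rule valid_stateD(6)[OF v])
  next
    fix k H assume "3 \<le> k" "k \<le> l" "H \<in> configs n k"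
    then show "\<not> H \<subseteq> M" by (rule valid_stateD(7)[OF v])
  next
    fix k H f assume "3 \<le> k" "k \<le> l" "H \<in> configs n k" "f \<in> A - lost n l M A m"
    then show "\<not> H \<subseteq> insert f M" using valid_stateD(8)[OF v, of k H f] by simp
  qed
next
  case True
  then obtain e where e: "e \<in> A" and m': "m = Add e" by auto
  have te: "e \<in> triples n" using valid_stateD(2)[OF v] e by blast
  have eM: "card (e \<inter> f) \<le> 1" if f: "f \<in> M" for f
  proof (rule ccontr)
    assume "\<not> ?thesis"
    then have "2 \<le> card (e \<inter> f)" by simp
    then obtain p where "p \<subseteq> e" "p \<subseteq> f" "card p = 2" by (rule obtain_pair_in_inter)
    then show False using valid_stateD(4,5)[OF v] e f by metis
  qed
  show ?thesis unfolding valid_state_def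
  proof (intro conjI)
    show "M \<union> added m \<subseteq> triples n" using valid_stateD(1)[OF v] te m' by simp
    show "A - lost n l M A m \<subseteq> triples n" using valid_stateD(2)[OF v] by blast
    show "P - gone P m \<subseteq> pairs n" using valid_stateD(3)[OF v] by blast
    show "\<forall>f\<in>A - lost n l M A m. \<forall>p. p \<subseteq> f \<longrightarrow> card p = 2 \<longrightarrow> p \<in> P - gone P m"
    proof (intro ballI allI impI)
      fix f p assume f: "f \<in> A - lost n l M A m" and p: "p \<subseteq> f" "card p = 2"
      have "\<not> p \<subseteq> e"
      proof
        assume "p \<subseteq> e"
        then have "card p \<le> card (f \<inter> e)"
          using p triples_facts[OF te] by (intro card_mono) auto
        then show False using f p m' by simp
      qed
      moreover have "p \<in> P" using valid_stateD(4)[OF v _ p] f by blast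
      ultimately show "p \<in> P - gone P m" using m' by simp
    qed
    show "\<forall>e'\<in>M \<union> added m. \<forall>p. p \<subseteq> e' \<longrightarrow> card p = 2 \<longrightarrow> p \<notin> P - gone P m"
    proof (intro ballI allI impI)
      fix e' p assume "e' \<in> M \<union> added m" and p: "p \<subseteq> e'" "card p = 2"
      then consider "e' \<in> M" | "p \<subseteq> e" using m' by auto
      then show "p \<notin> P - gone P m" using valid_stateD(5)[OF v _ p] m' by cases simp_all
    qed
    show "\<forall>e'\<in>M \<union> added m. \<forall>f\<in>M \<union> added m. e' \<noteq> f \<longrightarrow> card (e' \<inter> f) \<le> 1"
    proof (intro ballI impI)
      fix e' f assume ef: "e' \<in> M \<union> added m" "f \<in> M \<union> added m" "e' \<noteq> f"
      consider "e' \<in> M" "f \<in> M" | "e' = e" "f \<in> M" | "e' \<in> M" "f = e" using ef m' by auto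
      then show "card (e' \<inter> f) \<le> 1"
      proof cases
        case 1
        then show ?thesis using valid_stateD(6)[OF v] ef by blast
      next
        case 2
        then show ?thesis using eM by simp
      next
        case 3
        then show ?thesis using eM[of e'] by (simp add: Int_commute)
      qed
    qed
    show "\<forall>k H. 3 \<le> k \<longrightarrow> k \<le> l \<longrightarrow> H \<in> configs n k \<longrightarrow>
        \<not> H \<subseteq> M \<union> added m \<and> (\<forall>f\<in>A - lost n l M A m. \<not> H \<subseteq> insert f (M \<union> added m))"
    proof (intro allI impI conjI ballI)
      fix k H assume k: "3 \<le> k" "k \<le> l" and H: "H \<in> configs n k"
      have eH: "\<not> H \<subseteq> insert e M" using valid_stateD(8)[OF v k H e] .
      then show "\<not> H \<subseteq> M \<union> added m" using m' by auto
      fix f assume f: "f \<in> A - lost n l M A m"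
      have fH: "\<not> H \<subseteq> insert f M" using valid_stateD(8)[OF v k H] f by blast
      have nc: "\<not> conf n l M f e" using f m' by auto
      have ne: "e \<noteq> f"
      proof
        assume "e = f"
        then have "f \<in> lost n l M A m" using m' e triples_facts[OF te] by simp
        then show False using f by blast
      qed
      show "\<not> H \<subseteq> insert f (M \<union> added m)"
      proof
        assume "H \<subseteq> insert f (M \<union> added m)"
        then have s: "H \<subseteq> insert e (insert f M)" using m' by auto
        then have "e \<in> H" "f \<in> H" using eH fH by blast+
        then show False using nc ne k H s unfolding conf_def by blast
      qed
    qed
  qed
qed

text \<open>The weight of \<^term>\<open>Waste p\<close> tops up the rate at which \<open>p\<close> gets covered to \<open>D\<close>, and the weight of
  \<^term>\<open>Del f\<close> tops up the total rate at which \<open>f\<close> disappears to \<open>(3 + \<kappa>) D\<close>. The probabilities are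
  obtained by scaling with \<open>\<delta> / D\<close>, the remaining mass going to the idle move.\<close>

locale weighted_moves =
  fixes n l :: nat and M A P :: "nat set set" and D \<kappa> \<delta> :: real
  assumes valid: "valid_state n l M A P"
    and D1: "1 \<le> D" and \<delta>0: "0 < \<delta>" and \<kappa>0: "0 \<le> \<kappa>"
    and deg_le: "\<And>p. p \<in> P \<Longrightarrow> real (deg A p) \<le> D"
    and conf_le: "\<And>f. f \<in> A \<Longrightarrow> real (card {e \<in> A. conf n l M f e}) \<le> \<kappa> * D"
    and small: "\<delta> * (real n ^ 3 * (4 + \<kappa>) + real n ^ 2) \<le> 1"
begin

abbreviation "los \<equiv> lost n l M A"

fun wt :: "move \<Rightarrow> real" where
  "wt (Add e) = 1"
| "wt (Waste p) = D - deg A p"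
| "wt (Del f) = (3 + \<kappa>) * D - card {e \<in> A. f \<in> los (Add e)} - (\<Sum>p\<in>{p \<in> P. p \<subseteq> f}. D - deg A p)"
| "wt Null = 0"

definition W :: real where
  "W = (\<Sum>e\<in>A. wt (Add e)) + (\<Sum>p\<in>P. wt (Waste p)) + (\<Sum>f\<in>A. wt (Del f))"

fun pr :: "move \<Rightarrow> real" where
  "pr Null = 1 - \<delta> / D * W"
| "pr m = \<delta> / D * wt m"

lemma finite_state [simp]: "finite A" "finite P" "finite M"
  using valid_stateD(1-3)[OF valid] finite_subset[OF _ finite_triples[of n]] finite_subset[OF _ finite_pairs[of n]] by simp_all

lemma finite_moves [simp]: "finite (moves A P)"
  by (simp add: moves_def)

lemma A_triple: "f \<in> A \<Longrightarrow> f \<in> triples n"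
  using valid_stateD(2)[OF valid] by blast

lemma pairs_of: "f \<in> A \<Longrightarrow> {p \<in> P. p \<subseteq> f} = {p. p \<subseteq> f \<and> card p = 2}"
  using valid_stateD(3,4)[OF valid] unfolding pairs_def by blast

lemma sum_moves: "(\<Sum>m\<in>moves A P. h m) = h Null + (\<Sum>e\<in>A. h (Add e)) + (\<Sum>p\<in>P. h (Waste p)) + (\<Sum>f\<in>A. h (Del f))"
  for h :: "move \<Rightarrow> real"
proof -
  have "(\<Sum>m\<in>moves A P. h m) = h Null + (\<Sum>m\<in>Add ` A \<union> Waste ` P \<union> Del ` A. h m)"
    unfolding moves_def by (subst sum.insert) auto
  also have "(\<Sum>m\<in>Add ` A \<union> Waste ` P \<union> Del ` A. h m) = (\<Sum>m\<in>Add ` A. h m) + (\<Sum>m\<in>Waste ` P. h m) + (\<Sum>m\<in>Del ` A. h m)"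
    by (subst sum.union_disjoint, auto)+
  also have "(\<Sum>m\<in>Add ` A. h m) = (\<Sum>e\<in>A. h (Add e))" by (subst sum.reindex) (auto simp: inj_on_def)
  also have "(\<Sum>m\<in>Waste ` P. h m) = (\<Sum>e\<in>P. h (Waste e))" by (subst sum.reindex) (auto simp: inj_on_def)
  also have "(\<Sum>m\<in>Del ` A. h m) = (\<Sum>e\<in>A. h (Del e))" by (subst sum.reindex) (auto simp: inj_on_def)
  finally show ?thesis by simp
qed

text \<open>A triple can be lost to \<open>e\<close> through one of its three pairs or through a
  configuration, whence the allowance \<open>\<kappa> D\<close> on top of the degrees. The wasted
  pairs supply \<open>3 D\<close> minus the same degrees, so the total stays below
  \<open>(3 + \<kappa>) D\<close> and the weight of \<open>Del\<close> is nonnegative.\<close>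

lemma cover_le:
  assumes "f \<in> A"
  shows "real (card {e \<in> A. f \<in> los (Add e)}) \<le> (\<Sum>p\<in>{p \<in> P. p \<subseteq> f}. real (deg A p)) + \<kappa> * D"
proof -
  let ?Pf = "{p \<in> P. p \<subseteq> f}"
  have "{e \<in> A. f \<in> los (Add e)} \<subseteq> (\<Union>p\<in>?Pf. {e \<in> A. p \<subseteq> e}) \<union> {e \<in> A. conf n l M f e}"
  proof
    fix e assume e: "e \<in> {e \<in> A. f \<in> los (Add e)}"
    show "e \<in> (\<Union>p\<in>?Pf. {e \<in> A. p \<subseteq> e}) \<union> {e \<in> A. conf n l M f e}"
    proof (cases "2 \<le> card (f \<inter> e)")
      case True
      then obtain p where p: "p \<subseteq> f" "p \<subseteq> e" "card p = 2" by (rule obtain_pair_in_inter)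
      then have "p \<in> ?Pf" using pairs_of[OF assms] by blast
      then show ?thesis using p e by blast
    qed (use e in auto)
  qed
  then have "card {e \<in> A. f \<in> los (Add e)} \<le> card ((\<Union>p\<in>?Pf. {e \<in> A. p \<subseteq> e}) \<union> {e \<in> A. conf n l M f e})"
    by (intro card_mono) auto
  also have "\<dots> \<le> card (\<Union>p\<in>?Pf. {e \<in> A. p \<subseteq> e}) + card {e \<in> A. conf n l M f e}"
    by (rule card_Un_le)
  also have "\<dots> \<le> (\<Sum>p\<in>?Pf. deg A p) + card {e \<in> A. conf n l M f e}"
    unfolding deg_def by (intro add_right_mono card_UN_le) auto
  finally have "real (card {e \<in> A. f \<in> los (Add e)}) \<le> real ((\<Sum>p\<in>?Pf. deg A p) + card {e \<in> A. conf n l M f e})"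
    by (simp only: of_nat_le_iff)
  then show ?thesis using conf_le[OF assms] by simp
qed

lemma card_Pf: "f \<in> A \<Longrightarrow> card {p \<in> P. p \<subseteq> f} = 3"
  using card_pairs_of_triple(1)[of f] pairs_of[of f] triples_facts[OF A_triple, of f] by simp

lemma wt_nonneg: "m \<in> moves A P \<Longrightarrow> 0 \<le> wt m"
proof -
  assume m: "m \<in> moves A P"
  show ?thesis
  proof (cases m)
    case (Waste p)
    then show ?thesis using m deg_le by (auto simp: moves_def)
  next
    case (Del f)
    then have f: "f \<in> A" using m by (auto simp: moves_def)
    have "(\<Sum>p\<in>{p \<in> P. p \<subseteq> f}. D - deg A p) = 3 * D - (\<Sum>p\<in>{p \<in> P. p \<subseteq> f}. real (deg A p))"
      using card_Pf[OF f] by (simp add: sum_subtractf)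
    then show ?thesis using cover_le[OF f] Del by (simp add: algebra_simps)
  qed auto
qed

text \<open>Needed for the idle move to have nonnegative probability.\<close>

lemma W_le: "\<delta> / D * W \<le> 1"
proof -
  have cA: "real (card A) \<le> real n ^ 3"
  proof -
    have "card A \<le> card (triples n)" using valid_stateD(2)[OF valid] by (intro card_mono) auto
    then have "card A \<le> n ^ 3" using card_triples_le[of n] by simp
    then show ?thesis by (simp only: of_nat_power[symmetric] of_nat_le_iff)
  qed
  have cP: "real (card P) \<le> real n ^ 2"
  proof -
    have "card P \<le> card (pairs n)" using valid_stateD(3)[OF valid] by (intro card_mono) auto
    then have "card P \<le> n ^ 2" using card_pairs_le[of n] by simp
    then show ?thesis by (simp only: of_nat_power[symmetric] of_nat_le_iff)
  qed
  have w1: "(\<Sum>e\<in>A. wt (Add e)) \<le> real (card A) * D"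
    using D1 mult_left_mono[of 1 D "real (card A)"] by simp
  have w2: "(\<Sum>p\<in>P. wt (Waste p)) \<le> real (card P) * D"
    using sum_mono[of P "\<lambda>p. wt (Waste p)" "\<lambda>_. D"] by simp
  have w3: "(\<Sum>f\<in>A. wt (Del f)) \<le> real (card A) * ((3 + \<kappa>) * D)"
  proof -
    have "wt (Del f) \<le> (3 + \<kappa>) * D" for f
    proof -
      have "0 \<le> (\<Sum>p\<in>{p \<in> P. p \<subseteq> f}. D - deg A p)" using deg_le by (intro sum_nonneg) auto
      then show ?thesis by simp
    qed
    then have "(\<Sum>f\<in>A. wt (Del f)) \<le> (\<Sum>f\<in>A. (3 + \<kappa>) * D)" by (intro sum_mono)
    then show ?thesis by simp
  qed
  have "W \<le> D * (real (card A) * (4 + \<kappa>) + real (card P))"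
    using w1 w2 w3 by (simp add: W_def algebra_simps)
  then have "\<delta> / D * W \<le> \<delta> / D * (D * (real (card A) * (4 + \<kappa>) + real (card P)))"
    using \<delta>0 D1 by (intro mult_left_mono) auto
  also have "\<dots> = \<delta> * (real (card A) * (4 + \<kappa>) + real (card P))" using D1 by simp
  also have "\<dots> \<le> \<delta> * (real n ^ 3 * (4 + \<kappa>) + real n ^ 2)"
    using \<delta>0 cA cP \<kappa>0 by (intro mult_left_mono add_mono mult_right_mono) auto
  also have "\<dots> \<le> 1" by (rule small)
  finally show ?thesis .
qed

lemma pr_nonneg: "m \<in> moves A P \<Longrightarrow> 0 \<le> pr m"
  using wt_nonneg[of m] W_le \<delta>0 D1 by (cases m) auto

lemma sum_pr_mult:
  fixes h :: "move \<Rightarrow> real"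
  shows "(\<Sum>m\<in>moves A P. pr m * h m) = pr Null * h Null + \<delta> / D * ((\<Sum>e\<in>A. h (Add e))
    + (\<Sum>p\<in>P. wt (Waste p) * h (Waste p)) + (\<Sum>f\<in>A. wt (Del f) * h (Del f)))"
  unfolding sum_moves by (simp add: sum_distrib_left algebra_simps del: wt.simps pr.simps(1) add: wt.simps(1))

lemma sum_pr: "sum pr (moves A P) = 1"
  using sum_pr_mult[of "\<lambda>_. 1"] by (simp add: W_def)

lemma sum_pr_filter: "(\<Sum>m\<in>{m \<in> moves A P. Q m}. pr m) = (\<Sum>m\<in>moves A P. pr m * of_bool (Q m))"
  by (simp add: sum.inter_filter of_bool_def if_distrib cong: if_cong)

lemma pr_gone:
  assumes "p \<in> P"
  shows "(\<Sum>m\<in>{m \<in> moves A P. p \<in> gone P m}. pr m) = \<delta>"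
proof -
  have "(\<Sum>e\<in>A. of_bool (p \<subseteq> e)) = real (deg A p)"
    by (simp add: of_bool_def deg_def sum.inter_filter[symmetric])
  moreover have "(\<Sum>q\<in>P. wt (Waste q) * of_bool (p = q)) = wt (Waste p)"
    using assms by (simp add: of_bool_def if_distrib cong: if_cong)
  ultimately show ?thesis
    unfolding sum_pr_filter sum_pr_mult using assms D1 by simp
qed

lemma pr_lost:
  assumes "f \<in> A"
  shows "(\<Sum>m\<in>{m \<in> moves A P. f \<in> los m}. pr m) = (3 + \<kappa>) * \<delta>"
proof -
  have "(\<Sum>e\<in>A. of_bool (f \<in> los (Add e))) = real (card {e \<in> A. f \<in> los (Add e)})"
    by (simp add: of_bool_def sum.inter_filter[symmetric] del: lost.simps)
  moreover have "(\<Sum>p\<in>P. wt (Waste p) * of_bool (f \<in> los (Waste p))) = (\<Sum>p\<in>{p \<in> P. p \<subseteq> f}. D - deg A p)"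
    using assms by (simp add: of_bool_def if_distrib sum.inter_filter cong: if_cong)
  moreover have "(\<Sum>g\<in>A. wt (Del g) * of_bool (f \<in> los (Del g))) = wt (Del f)"
    using assms by (simp add: of_bool_def if_distrib del: wt.simps cong: if_cong)
  ultimately show ?thesis
    unfolding sum_pr_filter sum_pr_mult using D1 by (simp del: lost.simps add: lost.simps(4))
qed

lemma pr_added: "(\<Sum>m\<in>{m \<in> moves A P. e \<in> added m}. pr m) \<le> \<delta> / D"
proof -
  have "(\<Sum>f\<in>A. of_bool (e \<in> added (Add f))) = (\<Sum>f\<in>A. if e = f then 1 else (0::real))"
    by (simp add: of_bool_def)
  also have "\<dots> \<le> 1" by (simp only: sum.delta' finite_state) simp
  finally have "\<delta> / D * (\<Sum>f\<in>A. of_bool (e \<in> added (Add f))) \<le> \<delta> / D * 1"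
    using D1 \<delta>0 by (intro mult_left_mono) auto
  then show ?thesis
    unfolding sum_pr_filter sum_pr_mult by (simp only: added.simps empty_iff of_bool_eq mult_zero_right sum.neutral_const add_0 add_0_right mult_1_right)
qed

lemma gone_lost: "f \<in> A \<Longrightarrow> p \<in> gone P m \<Longrightarrow> p \<subseteq> f \<Longrightarrow> f \<in> los m"
proof -
  assume f: "f \<in> A" and p: "p \<in> gone P m" "p \<subseteq> f"
  have pP: "p \<in> P" using p(1) by (cases m) simp_all
  then have c: "card p = 2" using pairs_facts valid_stateD(3)[OF valid] by blast
  show ?thesis
  proof (cases m)
    case (Add e)
    have "finite f" using triples_facts[OF A_triple[OF f]] by simp
    then have "card p \<le> card (f \<inter> e)" using p Add by (intro card_mono) auto
    then show ?thesis using f Add c by auto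
  qed (use f p in auto)
qed

text \<open>Losing \<open>p\<close> always costs \<open>f\<close>, so the probability
  \<open>\<delta>\<close> of that event is subtracted exactly from
  \<open>(3 + \<kappa>) \<delta>\<close>. As the result does not depend on the state, the mean
  decrease of the degree of a surviving pair is known exactly.\<close>

lemma pr_lost_kept:
  assumes "f \<in> A" "p \<in> P" "p \<subseteq> f"
  shows "(\<Sum>m\<in>{m \<in> moves A P. p \<notin> gone P m \<and> f \<in> los m}. pr m) = (2 + \<kappa>) * \<delta>"
proof -
  have "{m \<in> moves A P. f \<in> los m} = {m \<in> moves A P. p \<in> gone P m} \<union> {m \<in> moves A P. p \<notin> gone P m \<and> f \<in> los m}"
    using gone_lost[OF assms(1) _ assms(3)] by blast
  moreover have "{m \<in> moves A P. p \<in> gone P m} \<inter> {m \<in> moves A P. p \<notin> gone P m \<and> f \<in> los m} = {}" by blast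
  ultimately have "(\<Sum>m\<in>{m \<in> moves A P. f \<in> los m}. pr m)
      = (\<Sum>m\<in>{m \<in> moves A P. p \<in> gone P m}. pr m) + (\<Sum>m\<in>{m \<in> moves A P. p \<notin> gone P m \<and> f \<in> los m}. pr m)"
    by (simp add: sum.union_disjoint)
  then show ?thesis using pr_gone[OF assms(2)] pr_lost[OF assms(1)] by (simp add: algebra_simps)
qed

text \<open>No \<open>Waste\<close> move hits both triples, because they share no pair, and no
  \<open>Del\<close> move does, because they differ; only \<open>Add\<close> remains.\<close>

lemma pr_lost_both:
  assumes "f \<in> A" "f' \<in> A" "f \<noteq> f'" "card (f \<inter> f') \<le> 1"
  shows "(\<Sum>m\<in>{m \<in> moves A P. f \<in> los m \<and> f' \<in> los m}. pr m)
    = \<delta> / D * real (card {e \<in> A. f \<in> los (Add e) \<and> f' \<in> los (Add e)})"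
proof -
  have "(\<Sum>e\<in>A. of_bool (f \<in> los (Add e) \<and> f' \<in> los (Add e)))
      = real (card {e \<in> A. f \<in> los (Add e) \<and> f' \<in> los (Add e)})"
    by (simp only: of_bool_def sum.inter_filter[symmetric] finite_state) simp
  moreover have "(\<Sum>p\<in>P. wt (Waste p) * of_bool (f \<in> los (Waste p) \<and> f' \<in> los (Waste p))) = 0"
  proof (rule sum.neutral, rule ballI)
    fix p assume p: "p \<in> P"
    then have "card p = 2" using pairs_facts valid_stateD(3)[OF valid] by blast
    have "\<not> (p \<subseteq> f \<and> p \<subseteq> f')"
    proof
      assume "p \<subseteq> f \<and> p \<subseteq> f'"
      then have "card p \<le> card (f \<inter> f')"
        using triples_facts[OF A_triple[OF assms(1)]] by (intro card_mono) auto
      then show False using assms(4) \<open>card p = 2\<close> by simp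
    qed
    then show "wt (Waste p) * of_bool (f \<in> los (Waste p) \<and> f' \<in> los (Waste p)) = 0" by auto
  qed
  moreover have "(\<Sum>g\<in>A. wt (Del g) * of_bool (f \<in> los (Del g) \<and> f' \<in> los (Del g))) = 0"
    using assms(3) by (intro sum.neutral) auto
  ultimately show ?thesis
    unfolding sum_pr_filter sum_pr_mult by (simp del: lost.simps add: lost.simps(4))
qed

end

section \<open>One-step changes in a typical state\<close>

text \<open>The ratio \<open>16 l\<close> makes the inflow into level \<open>c\<close> from level
  \<open>c - 1\<close> (at most \<open>l\<close> members, each added with probability at most
  \<open>\<delta>\<close> over the degree scale) one sixteenth of \<open>\<delta>\<close> times the
  bound. The leading factor 2 leaves a gap of at least 1 below the bound at time 0.\<close>

definition live_bound :: "nat \<Rightarrow> nat \<Rightarrow> real" where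
  "live_bound l c = 2 * st_const (2 * l + 4) * (16 * real l) ^ c"

text \<open>The value taken for \<open>\<kappa>\<close>: a bound on the number of triples blocking a
  given one, relative to the degree scale, summed over at most \<open>l\<close> sizes of
  configurations.\<close>

definition kill_ratio :: "nat \<Rightarrow> real" where
  "kill_ratio l = real l * live_bound l l"

definition live_configs :: "nat \<Rightarrow> nat \<Rightarrow> nat \<Rightarrow> nat set set \<Rightarrow> nat set set \<Rightarrow> nat set \<Rightarrow> nat set set set" where
  "live_configs n k c M A e = {H \<in> configs n k. e \<in> H \<and> H \<subseteq> M \<union> A \<and> card (H \<inter> M) = c}"

lemma finite_live_configs [simp]: "finite (live_configs n k c M A e)"
  by (simp add: live_configs_def)

lemma st_const_ge1: "1 \<le> st_const w"
proof -
  have "1 * 1 \<le> (2 ^ (2 ^ w)) ^ 4 * (real w + 1)" by (intro mult_mono one_le_power) auto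
  then show ?thesis by (simp add: st_const_def)
qed

lemma live_bound_ge1: "1 \<le> l \<Longrightarrow> 1 \<le> live_bound l c"
proof -
  assume l: "1 \<le> l"
  have "1 * 1 \<le> (2 * st_const (2 * l + 4)) * (16 * real l) ^ c"
    using l st_const_ge1[of "2 * l + 4"] by (intro mult_mono one_le_power) auto
  then show ?thesis by (simp add: live_bound_def)
qed

lemma live_bound_mono: "1 \<le> l \<Longrightarrow> c \<le> d \<Longrightarrow> live_bound l c \<le> live_bound l d"
  unfolding live_bound_def using st_const_ge1[of "2 * l + 4"]
  by (intro mult_left_mono power_increasing) auto

lemma live_bound_Suc: "live_bound l (Suc c) = 16 * real l * live_bound l c"
  by (simp add: live_bound_def)

lemma kill_ratio_nonneg: "0 \<le> kill_ratio l"
  using st_const_ge1[of "2 * l + 4"] by (simp add: kill_ratio_def live_bound_def)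

text \<open>\<open>N\<close> is the number of steps, \<open>s\<close> the order of the moments,
  \<open>\<epsilon>\<close> the relative error of the degrees, \<open>\<mu>\<close> the factor in
  the exponential moments, \<open>Y\<close> the slack of the structure counts and
  \<open>\<theta>\<close> a lower bound for the factor by which degrees shrink. \<open>jump\<close>
  bounds the increments of the exponents, \<open>second\<close> the quadratic term of the degrees in
  one step, \<open>joint\<close> makes simultaneous losses rare, and \<open>low\<close> serves
  counts well below their bound.\<close>

locale girth_params =
  fixes n l N s :: nat and \<delta> \<epsilon> \<mu> Y \<theta> :: real
  assumes l4: "4 \<le> l" and n0: "0 < n"
    and \<delta>0: "0 < \<delta>" and \<delta>_small: "real l * (2 + kill_ratio l) * \<delta> \<le> 1 / 2"
    and total: "\<delta> * (real n ^ 3 * (4 + kill_ratio l) + real n ^ 2) \<le> 1"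
    and \<epsilon>0: "0 < \<epsilon>" and \<epsilon>_half: "\<epsilon> \<le> 1 / 2"
    and \<theta>0: "0 < \<theta>" and \<theta>1: "\<theta> \<le> 1" and \<theta>N: "\<theta> \<le> (1 - (2 + kill_ratio l) * \<delta>) ^ N" and n\<theta>: "1 \<le> n * \<theta>"
    and Y1: "1 \<le> Y" and \<mu>0: "0 < \<mu>"
    and jump: "32 * real l * (3 + kill_ratio l) * \<mu> * (2 * (real l + 4) * Y / (n * \<theta> ^ l)) \<le> 1"
    and second: "4 * (2 + kill_ratio l) * \<mu>\<^sup>2 * (2 * (real l + 4) * Y / (n * \<theta> ^ l)) * \<delta> \<le> 1"
    and joint: "real l * (real l + 3)\<^sup>2 * Y / (n * \<theta>) \<le> 1 / 2"
    and low: "\<mu> * \<delta> * live_bound l l \<le> 1"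
begin

text \<open>\<open>a \<delta>\<close> is the rate at which a triple through a surviving pair is
  lost, \<open>sc i\<close> the resulting degree trajectory with inverse \<open>g i\<close>,
  \<open>Dm i\<close> an upper bound for all degrees, used as the common weight \<open>D\<close>,
  and \<open>J1\<close> a bound for every normalised one-step change.\<close>

definition a :: real where "a = 2 + kill_ratio l"
definition J1 :: real where "J1 = 2 * (real l + 4) * Y / (n * \<theta> ^ l)"
definition sc :: "nat \<Rightarrow> real" where "sc i = n * (1 - a * \<delta>) ^ i"
definition g :: "nat \<Rightarrow> real" where "g i = 1 / sc i"
definition Dm :: "nat \<Rightarrow> real" where "Dm i = (1 + \<epsilon>) * sc i"

lemma a2: "2 \<le> a" using kill_ratio_nonneg by (simp add: a_def)

lemma a\<delta>: "0 < a * \<delta>" "a * \<delta> \<le> 1 / 2" "real l * (a * \<delta>) \<le> 1 / 2"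
proof -
  show p: "0 < a * \<delta>" using a2 \<delta>0 by simp
  show q: "real l * (a * \<delta>) \<le> 1 / 2" using \<delta>_small by (simp add: a_def mult.assoc)
  have "1 * (a * \<delta>) \<le> real l * (a * \<delta>)" using l4 p by (intro mult_right_mono) auto
  then show "a * \<delta> \<le> 1 / 2" using q by simp
qed

lemma sc_pos: "0 < sc i" using n0 a\<delta> by (simp add: sc_def)

lemma sc_ge: "i \<le> N \<Longrightarrow> n * \<theta> \<le> sc i"
proof -
  assume "i \<le> N"
  then have "(1 - a * \<delta>) ^ N \<le> (1 - a * \<delta>) ^ i"
    using a\<delta> by (intro power_decreasing) auto
  then have "\<theta> \<le> (1 - a * \<delta>) ^ i" using \<theta>N by (simp add: a_def)
  then show ?thesis by (simp add: sc_def mult_left_mono)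
qed

lemma g_pos: "0 < g i" using sc_pos by (simp add: g_def)

lemma g_Suc: "g i = g (Suc i) * (1 - a * \<delta>)"
proof -
  have "1 - a * \<delta> \<noteq> 0" using a\<delta> by simp
  then show ?thesis using n0 by (simp add: g_def sc_def)
qed

lemma g_sc: "g i * sc i = 1" using sc_pos[of i] by (simp add: g_def)

lemma g_Suc_le:
  assumes "m \<le> l"
  shows "g (Suc i) ^ m * (1 - real m * (a * \<delta>)) \<le> g i ^ m" "g (Suc i) ^ m \<le> 2 * g i ^ m" "g i ^ m \<le> g (Suc i) ^ m"
proof -
  have b: "1 - real m * (a * \<delta>) \<le> (1 - a * \<delta>) ^ m"
    using Bernoulli_inequality[of "- (a * \<delta>)" m] a\<delta> by simp
  have eq: "g i ^ m = g (Suc i) ^ m * (1 - a * \<delta>) ^ m" by (subst g_Suc) (simp add: power_mult_distrib)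
  have gp: "0 \<le> g (Suc i) ^ m" using g_pos[of "Suc i"] by simp
  show 1: "g (Suc i) ^ m * (1 - real m * (a * \<delta>)) \<le> g i ^ m"
    unfolding eq using b gp by (intro mult_left_mono)
  have "real m * (a * \<delta>) \<le> real l * (a * \<delta>)" using assms a\<delta> by (intro mult_right_mono) auto
  then have "1 / 2 \<le> 1 - real m * (a * \<delta>)" using a\<delta> by simp
  then have "g (Suc i) ^ m * (1 / 2) \<le> g (Suc i) ^ m * (1 - real m * (a * \<delta>))" using gp by (intro mult_left_mono)
  then show "g (Suc i) ^ m \<le> 2 * g i ^ m" using 1 by simp
  have "(1 - a * \<delta>) ^ m \<le> 1" using a\<delta> by (intro power_le_one) auto
  then show "g i ^ m \<le> g (Suc i) ^ m" unfolding eq using gp by (simp add: mult_left_le)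
qed

text \<open>A count with \<open>m\<close> free triples in \<open>A\<close> changes by about
  \<open>n ^ (m - 1)\<close> in one move and is measured against \<open>sc i ^ m\<close>, which is
  at least \<open>(n \<theta>) ^ m\<close>. The quotient keeps a factor \<open>1 / n\<close>,
  weakened only by powers of \<open>\<theta>\<close>.\<close>

lemma g_power_n:
  assumes "i \<le> N" "m \<le> l" "1 \<le> m"
  shows "g i ^ m * real n ^ (m - 1) \<le> 1 / (n * \<theta> ^ l)"
proof -
  have "g i ^ m \<le> (1 / (n * \<theta>)) ^ m"
  proof (rule power_mono)
    show "g i \<le> 1 / (n * \<theta>)" using sc_ge[OF assms(1)] sc_pos[of i] n0 \<theta>0 by (simp add: g_def frac_le)
    show "0 \<le> g i" using g_pos[of i] by simp
  qed
  then have "g i ^ m * real n ^ (m - 1) \<le> (1 / (n * \<theta>)) ^ m * real n ^ (m - 1)"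
    by (intro mult_right_mono) auto
  also have "\<dots> = 1 / (n * \<theta> ^ m)"
    using assms(3) n0 \<theta>0 by (cases m) (auto simp: power_divide power_mult_distrib)
  also have "\<dots> \<le> 1 / (n * \<theta> ^ l)"
    using n0 \<theta>0 \<theta>1 assms(2) by (intro divide_left_mono mult_left_mono power_decreasing mult_pos_pos) auto
  finally show ?thesis .
qed

lemma J1_pos: "0 < J1" using l4 Y1 n0 \<theta>0 by (auto simp: J1_def intro!: divide_pos_pos mult_pos_pos add_nonneg_pos)

lemma \<mu>J1: "32 * real l * (3 + kill_ratio l) * (\<mu> * J1) \<le> 1" "\<mu> * J1 \<le> 1"
proof -
  show 1: "32 * real l * (3 + kill_ratio l) * (\<mu> * J1) \<le> 1" using jump by (simp add: J1_def mult.assoc)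
  have "1 * 1 * 1 \<le> 32 * real l * (3 + kill_ratio l)" using l4 kill_ratio_nonneg[of l] by (intro mult_mono) auto
  then have "1 * (\<mu> * J1) \<le> 32 * real l * (3 + kill_ratio l) * (\<mu> * J1)"
    using \<mu>0 J1_pos by (intro mult_right_mono) auto
  then show "\<mu> * J1 \<le> 1" using 1 by simp
qed

end

locale good_state = girth_params +
  fixes i :: nat and M A P :: "nat set set"
  assumes valid: "valid_state n l M A P" and iN: "i < N"
    and deg_upper: "\<And>p. p \<in> P \<Longrightarrow> real (deg A p) \<le> (1 + \<epsilon>) * sc i"
    and deg_lower: "\<And>p. p \<in> P \<Longrightarrow> (1 - \<epsilon>) * sc i \<le> real (deg A p)"
    and live_configs_le: "\<And>k c e. 3 \<le> k \<Longrightarrow> k \<le> l \<Longrightarrow> c + 2 \<le> k \<Longrightarrow> e \<in> A \<Longrightarrow>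
      real (card (live_configs n k c M A e)) \<le> live_bound l c * sc i ^ (k - 1 - c)"
    and fams_le: "\<And>F v. (F, v) \<in> fams n l \<Longrightarrow> real (card {x \<in> F. st_chosen x \<subseteq> M}) \<le> real n ^ v * Y"
begin

lemma MA: "M \<inter> A = {}" by (rule valid_state_disjoint[OF valid])

lemma live_configs_card:
  assumes k: "3 \<le> k" and H: "H \<in> live_configs n k c M A e" and e: "e \<in> A"
  shows "card (H \<inter> A - {e}) = k - 1 - c" "finite H" "card (H \<inter> A) + c = k"
proof -
  have Hf: "finite H" "card H = k" using configs_facts[of H n k] H k by (auto simp: live_configs_def)
  show "finite H" by (rule Hf)
  have "card H = card (H \<inter> M) + card (H \<inter> A)"
  proof -
    have "H = (H \<inter> M) \<union> (H \<inter> A)" using H by (auto simp: live_configs_def)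
    moreover have "(H \<inter> M) \<inter> (H \<inter> A) = {}" using MA by blast
    ultimately show ?thesis using Hf card_Un_disjoint[of "H \<inter> M" "H \<inter> A"] by (metis finite_Int)
  qed
  then show *: "card (H \<inter> A) + c = k" using Hf H by (simp add: live_configs_def)
  have "e \<in> H \<inter> A" using H e by (simp add: live_configs_def)
  then have "card (H \<inter> A - {e}) = card (H \<inter> A) - 1" using Hf by simp
  then show "card (H \<inter> A - {e}) = k - 1 - c" using * by simp
qed

text \<open>If \<open>e\<close> and \<open>f\<close> complete a configuration, its other
  \<open>k - 2\<close> triples lie in \<open>M\<close>. It is thus live at the top level
  \<open>k - 2\<close>, where \<open>e\<close> is the only triple of \<open>A\<close> besides
  \<open>f\<close>, so blocking triples are no more numerous than these configurations.\<close>

lemma conf_count: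
  assumes f: "f \<in> A"
  shows "real (card {e \<in> A. conf n l M f e}) \<le> kill_ratio l * Dm i"
proof -
  let ?U = "\<Union>k\<in>{3..l}. \<Union>H\<in>live_configs n k (k - 2) M A f. H \<inter> A - {f}"
  have "{e \<in> A. conf n l M f e} \<subseteq> ?U"
  proof
    fix e assume "e \<in> {e \<in> A. conf n l M f e}"
    then have e: "e \<in> A" and "conf n l M f e" by auto
    then obtain k H where ef: "e \<noteq> f" and k: "3 \<le> k" "k \<le> l" and H: "H \<in> configs n k" "e \<in> H" "f \<in> H"
      "H \<subseteq> insert e (insert f M)" unfolding conf_def by blast
    have Hf: "finite H" "card H = k" using configs_facts[OF H(1) k(1)] by auto
    have eM: "e \<notin> M" "f \<notin> M" using MA e f by blast+
    have "H \<inter> M = H - {e, f}" using H eM by blast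
    then have "card (H \<inter> M) = k - 2" using Hf H ef by (simp add: card_Diff_subset)
    then have "H \<in> live_configs n k (k - 2) M A f" using H e f by (auto simp: live_configs_def)
    then show "e \<in> ?U" using k H e ef by auto
  qed
  moreover have "finite A" using valid_stateD(2)[OF valid] by (rule finite_subset) simp
  then have "finite ?U" by (rule rev_finite_subset) blast
  ultimately have "card {e \<in> A. conf n l M f e} \<le> card ?U"
    by (intro card_mono)
  also have "\<dots> \<le> (\<Sum>k\<in>{3..l}. card (\<Union>H\<in>live_configs n k (k - 2) M A f. H \<inter> A - {f}))"
    by (rule card_UN_le) simp
  also have "\<dots> \<le> (\<Sum>k\<in>{3..l}. card (live_configs n k (k - 2) M A f))"
  proof (rule sum_mono)
    fix k assume k: "k \<in> {3..l}"
    have "card (\<Union>H\<in>live_configs n k (k - 2) M A f. H \<inter> A - {f}) \<le> (\<Sum>H\<in>live_configs n k (k - 2) M A f. card (H \<inter> A - {f}))"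
      by (rule card_UN_le) simp
    also have "\<dots> = (\<Sum>H\<in>live_configs n k (k - 2) M A f. 1)"
      using live_configs_card(1)[OF _ _ f, of k _ "k - 2"] k by (intro sum.cong) auto
    finally show "card (\<Union>H\<in>live_configs n k (k - 2) M A f. H \<inter> A - {f}) \<le> card (live_configs n k (k - 2) M A f)" by simp
  qed
  finally have "real (card {e \<in> A. conf n l M f e}) \<le> (\<Sum>k\<in>{3..l}. real (card (live_configs n k (k - 2) M A f)))"
    by (simp only: of_nat_sum[symmetric] of_nat_le_iff)
  also have "\<dots> \<le> (\<Sum>k\<in>{3..l}. live_bound l l * sc i)"
  proof (rule sum_mono)
    fix k assume k: "k \<in> {3..l}"
    have "real (card (live_configs n k (k - 2) M A f)) \<le> live_bound l (k - 2) * sc i ^ (k - 1 - (k - 2))"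
      using k f by (intro live_configs_le) auto
    also have "k - 1 - (k - 2) = 1" using k by auto
    also have "live_bound l (k - 2) * sc i ^ 1 \<le> live_bound l l * sc i"
    proof -
      have "live_bound l (k - 2) \<le> live_bound l l" using k l4 by (intro live_bound_mono) auto
      then show ?thesis using sc_pos[of i] by simp
    qed
    finally show "real (card (live_configs n k (k - 2) M A f)) \<le> live_bound l l * sc i" .
  qed
  also have "\<dots> = real (card {3..l}) * (live_bound l l * sc i)" by simp
  also have "\<dots> \<le> real l * (live_bound l l * sc i)"
    using sc_pos[of i] live_bound_ge1[of l l] l4 by (intro mult_right_mono) auto
  also have "\<dots> = kill_ratio l * sc i" by (simp add: kill_ratio_def)
  also have "\<dots> \<le> kill_ratio l * Dm i"
    using sc_pos[of i] \<epsilon>0 kill_ratio_nonneg[of l] by (intro mult_left_mono) (auto simp: Dm_def)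
  finally show ?thesis .
qed

lemma Dm_ge: "sc i \<le> Dm i" "n * \<theta> \<le> Dm i" "1 \<le> Dm i"
proof -
  show 1: "sc i \<le> Dm i" using sc_pos[of i] \<epsilon>0 by (simp add: Dm_def)
  then show "n * \<theta> \<le> Dm i" using sc_ge[of i] iN by simp
  then show "1 \<le> Dm i" using n\<theta> by simp
qed

sublocale weighted_moves n l M A P "Dm i" "kill_ratio l" \<delta>
  by unfold_locales (use valid Dm_ge \<delta>0 kill_ratio_nonneg deg_upper conf_count total in \<open>auto simp: Dm_def\<close>)

abbreviation "good_structs F \<equiv> {x \<in> F. st_chosen x \<subseteq> M}"

lemma card_image_structs:
  assumes "(F, v) \<in> fams n l"
  shows "real (card (h ` good_structs F)) \<le> real n ^ v * Y"
proof -
  have "card (h ` good_structs F) \<le> card (good_structs F)"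
    using fams_facts(1)[OF assms] by (intro card_image_le) simp
  then have "real (card (h ` good_structs F)) \<le> real (card (good_structs F))" by simp
  also have "\<dots> \<le> real n ^ v * Y" by (rule fams_le[OF assms])
  finally show ?thesis .
qed

lemma fam_pair_mem:
  assumes "e \<in> triples n" "p \<in> pairs n" "3 \<le> k" "k \<le> l" "c + 2 \<le> k"
  shows "(fam_pair n e p k c, k - 2 - c) \<in> fams n l"
proof -
  have *: "(e, p, k, c) \<in> {(e, p, k, c). e \<in> triples n \<and> p \<in> pairs n \<and> 3 \<le> k \<and> k \<le> l \<and> c + 2 \<le> k}"
    using assms by simp
  show ?thesis unfolding fams_def
    by (rule UnI1, rule UnI2, rule image_eqI[OF _ *]) simp
qed

lemma fam_two_mem:
  assumes "e \<in> triples n" "h \<in> triples n" "3 \<le> k" "k \<le> l" "c + 3 \<le> k"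
  shows "(fam_two n e h k c, k - 3 - c) \<in> fams n l"
proof -
  have *: "(e, h, k, c) \<in> {(e, h, k, c). e \<in> triples n \<and> h \<in> triples n \<and> 3 \<le> k \<and> k \<le> l \<and> c + 3 \<le> k}"
    using assms by simp
  show ?thesis unfolding fams_def
    by (rule UnI1, rule UnI1, rule image_eqI[OF _ *]) simp
qed

lemma fam_linked_mem:
  assumes "e \<in> triples n" "h \<in> triples n" "3 \<le> k" "k \<le> l" "c + 2 \<le> k" "3 \<le> k'" "k' \<le> l"
  shows "(fam_linked n e h k c k', k - 2 - c) \<in> fams n l"
proof -
  have *: "(e, h, k, c, k') \<in> {(e, h, k, c, k'). e \<in> triples n \<and> h \<in> triples n \<and> 3 \<le> k \<and> k \<le> l \<and> c + 2 \<le> k \<and> 3 \<le> k' \<and> k' \<le> l}"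
    using assms by simp
  show ?thesis unfolding fams_def
    by (rule UnI2, rule image_eqI[OF _ *]) simp
qed

section \<open>Largest changes caused by a single move\<close>

lemma card_UN_real_le:
  fixes b :: real
  assumes "finite I" "\<And>j. j \<in> I \<Longrightarrow> real (card (S j)) \<le> b"
  shows "real (card (\<Union>j\<in>I. S j)) \<le> real (card I) * b"
proof -
  have "card (\<Union>j\<in>I. S j) \<le> (\<Sum>j\<in>I. card (S j))" by (rule card_UN_le[OF assms(1)])
  then have "real (card (\<Union>j\<in>I. S j)) \<le> (\<Sum>j\<in>I. real (card (S j)))"
    by (simp only: of_nat_sum[symmetric] of_nat_le_iff)
  also have "\<dots> \<le> (\<Sum>j\<in>I. b)" by (intro sum_mono assms(2))
  finally show ?thesis by simp
qed

lemma card_ks: "real (card {3..l}) \<le> real l" by simp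

text \<open>A triple through \<open>p\<close> that meets \<open>e\<close> in two points is
  \<open>insert w p\<close> with \<open>w \<in> e\<close>, as \<open>e\<close> does not contain the
  surviving pair: three at most. Those blocked through a configuration are counted by
  \<open>fam_pair\<close> with all other triples chosen, where the exponent of \<open>n\<close> is
  0.\<close>

lemma deg_jump:
  assumes p: "p \<in> P" and m: "m \<in> moves A P" and kept: "p \<notin> gone P m"
  shows "real (card {f \<in> A. p \<subseteq> f \<and> f \<in> los m}) \<le> (real l + 3) * Y"
proof -
  let ?S = "{f \<in> A. p \<subseteq> f \<and> f \<in> los m}"
  have pp: "p \<in> pairs n" using p valid_stateD(3)[OF valid] by blast
  note pf = pairs_facts[OF pp]
  have le1: "1 \<le> (real l + 3) * Y"
  proof -
    have "1 * 1 \<le> (real l + 3) * Y" using Y1 by (intro mult_mono) auto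
    then show ?thesis by simp
  qed
  show ?thesis
  proof (cases m)
    case (Add e)
    then have e: "e \<in> A" using m by (auto simp: moves_def)
    note ef = triples_facts[OF A_triple[OF e]]
    have pe: "\<not> p \<subseteq> e" using kept p Add by auto
    let ?U = "\<Union>k\<in>{3..l}. (fst \<circ> snd) ` good_structs (fam_pair n e p k (k - 2))"
    have "?S \<subseteq> (\<lambda>w. insert w p) ` e \<union> ?U"
    proof
      fix f assume "f \<in> ?S"
      then have f: "f \<in> A" "p \<subseteq> f" and fl: "2 \<le> card (f \<inter> e) \<or> conf n l M f e" using Add by auto
      note ff = triples_facts[OF A_triple[OF f(1)]]
      show "f \<in> (\<lambda>w. insert w p) ` e \<union> ?U"
      proof (cases "2 \<le> card (f \<inter> e)")
        case True
        have "card (f - p) = 1" using ff pf f by (simp add: card_Diff_subset)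
        then obtain w where w: "f - p = {w}" by (auto simp: card_1_singleton_iff)
        have "w \<in> e"
        proof (rule ccontr)
          assume "w \<notin> e"
          then have "f \<inter> e \<subseteq> p" using w by (metis DiffI IntD1 IntD2 singletonD subsetI)
          then have "f \<inter> e = p" using True pf by (intro card_seteq) auto
          then show False using pe by blast
        qed
        moreover have "f = insert w p" using w f by blast
        ultimately show ?thesis by blast
      next
        case False
        then obtain k H where fe: "e \<noteq> f" and k: "3 \<le> k" "k \<le> l" and H: "H \<in> configs n k" "e \<in> H" "f \<in> H"
          "H \<subseteq> insert e (insert f M)" using fl unfolding conf_def by blast
        note Hf = configs_facts[OF H(1) k(1)]
        have "card (H - {e, f}) = k - 2" using Hf H fe by (simp add: card_Diff_subset)
        then have "(H, f, H - {e, f}, {}) \<in> fam_pair n e p k (k - 2)" using H f fe by (simp add: fam_pair_def)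
        moreover have "st_chosen (H, f, H - {e, f}, {}) \<subseteq> M" using H by (auto simp: st_chosen_def)
        ultimately have "(H, f, H - {e, f}, {}) \<in> good_structs (fam_pair n e p k (k - 2))" by blast
        then have "f \<in> (fst \<circ> snd) ` good_structs (fam_pair n e p k (k - 2))" by (rule rev_image_eqI) simp
        then show ?thesis using k by auto
      qed
    qed
    moreover have "finite ((\<lambda>w. insert w p) ` e \<union> ?U)" using ef finite_fam by auto
    ultimately have "card ?S \<le> card ((\<lambda>w. insert w p) ` e \<union> ?U)" by (rule card_mono[rotated])
    also have "\<dots> \<le> card ((\<lambda>w. insert w p) ` e) + card ?U" by (rule card_Un_le)
    also have "card ((\<lambda>w. insert w p) ` e) \<le> 3" using card_image_le[of e "\<lambda>w. insert w p"] ef by simp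
    finally have "real (card ?S) \<le> 3 + real (card ?U)" by linarith
    also have "real (card ?U) \<le> real (card {3..l}) * Y"
    proof (rule card_UN_real_le)
      fix k assume k: "k \<in> {3..l}"
      have "(fam_pair n e p k (k - 2), k - 2 - (k - 2)) \<in> fams n l"
        using k A_triple[OF e] pp by (intro fam_pair_mem) auto
      from card_image_structs[OF this, of "fst \<circ> snd"] show "real (card ((fst \<circ> snd) ` good_structs (fam_pair n e p k (k - 2)))) \<le> Y"
        by simp
    qed simp
    also have "\<dots> \<le> real l * Y" using Y1 card_ks by (intro mult_right_mono) auto
    finally show ?thesis using Y1 by (simp add: algebra_simps)
  next
    case (Waste q)
    then have q: "q \<in> P" "q \<noteq> p" using m kept p by (auto simp: moves_def)
    then have qf: "card q = 2" "finite q" using pairs_facts valid_stateD(3)[OF valid] by blast+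
    have "?S \<subseteq> {p \<union> q}"
    proof
      fix f assume "f \<in> ?S"
      then have f: "f \<in> A" "p \<subseteq> f" "q \<subseteq> f" using Waste by auto
      note ff = triples_facts[OF A_triple[OF f(1)]]
      have "card (p \<union> q) \<ge> 3"
      proof (rule ccontr)
        assume "\<not> ?thesis"
        then have "card (p \<union> q) \<le> card p" "card (p \<union> q) \<le> card q" using pf qf by simp_all
        then have "p = p \<union> q" "q = p \<union> q" using pf qf by (metis Un_upper1 Un_upper2 card_seteq finite_Un)+
        then show False using q by simp
      qed
      then have "p \<union> q = f" using ff f by (intro card_seteq) auto
      then show "f \<in> {p \<union> q}" by simp
    qed
    then have "card ?S \<le> 1" using card_mono[of "{p \<union> q}" ?S] by simp
    then show ?thesis using le1 by linarith
  next
    case (Del f)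
    then have "?S \<subseteq> {f}" by auto
    then have "card ?S \<le> 1" using card_mono[of "{f}" ?S] by simp
    then show ?thesis using le1 by linarith
  next
    case Null
    then have "?S = {}" by simp
    then show ?thesis using le1 by (simp only: card.empty)
  qed
qed

text \<open>A configuration that gains the member \<open>h\<close> contains both \<open>e\<close>
  and \<open>h\<close> and had \<open>c - 1\<close> members in \<open>M\<close> before. This is
  \<open>fam_two\<close> with exponent \<open>k - 3 - (c - 1)\<close>.\<close>

lemma gain_jump:
  assumes k: "3 \<le> k" "k \<le> l" and c: "c + 2 \<le> k" and e: "e \<in> A" and m: "m \<in> moves A P" and kept: "e \<notin> los m"
  shows "real (card {H \<in> configs n k. e \<in> H \<and> H \<subseteq> M \<union> A \<and> card (H \<inter> M) + 1 = c \<and> added m \<inter> H \<noteq> {}})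
    \<le> real n ^ (k - 2 - c) * Y"
proof -
  let ?S = "{H \<in> configs n k. e \<in> H \<and> H \<subseteq> M \<union> A \<and> card (H \<inter> M) + 1 = c \<and> added m \<inter> H \<noteq> {}}"
  have ge0: "0 \<le> real n ^ (k - 2 - c) * Y" using Y1 by simp
  show ?thesis
  proof (cases "?S = {}")
    case True
    then show ?thesis using ge0 by (simp only: card.empty)
  next
    case False
    then have c1: "1 \<le> c" and "added m \<noteq> {}" by auto
    then obtain h where mh: "m = Add h" by (cases m) auto
    then have h: "h \<in> A" using m by (auto simp: moves_def)
    have eh: "e \<noteq> h" using kept mh e triples_facts[OF A_triple[OF e]] by auto
    have "?S \<subseteq> fst ` good_structs (fam_two n e h k (c - 1))"
    proof
      fix H assume "H \<in> ?S"
      then have H: "H \<in> configs n k" "e \<in> H" "H \<subseteq> M \<union> A" "card (H \<inter> M) = c - 1" "h \<in> H"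
        using mh by auto
      have "H \<inter> M \<subseteq> H - {e, h}" using MA e h by blast
      then have "(H, h, H \<inter> M, {}) \<in> fam_two n e h k (c - 1)" using H eh by (simp add: fam_two_def)
      moreover have "st_chosen (H, h, H \<inter> M, {}) \<subseteq> M" by (simp add: st_chosen_def)
      ultimately have "(H, h, H \<inter> M, {}) \<in> good_structs (fam_two n e h k (c - 1))" by blast
      then show "H \<in> fst ` good_structs (fam_two n e h k (c - 1))" by (rule rev_image_eqI) simp
    qed
    then have "card ?S \<le> card (fst ` good_structs (fam_two n e h k (c - 1)))"
      using finite_fam by (intro card_mono) auto
    then have "real (card ?S) \<le> real (card (fst ` good_structs (fam_two n e h k (c - 1))))" by simp
    also have "\<dots> \<le> real n ^ (k - 3 - (c - 1)) * Y"
      using k c c1 A_triple e h by (intro card_image_structs fam_two_mem) auto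
    also have "k - 3 - (c - 1) = k - 2 - c" using c1 by simp
    finally show ?thesis .
  qed
qed

lemma live_configs_fam_pair:
  assumes k: "3 \<le> k" and H: "H \<in> live_configs n k c M A e" and e: "e \<in> A" and f: "f \<in> H \<inter> A - {e}" and p: "p \<subseteq> f"
  shows "H \<in> fst ` good_structs (fam_pair n e p k c)"
proof -
  have "H \<inter> M \<subseteq> H - {e, f}" using MA e f by blast
  then have "(H, f, H \<inter> M, {}) \<in> fam_pair n e p k c" using H f p by (simp add: fam_pair_def live_configs_def) blast
  moreover have "st_chosen (H, f, H \<inter> M, {}) \<subseteq> M" by (simp add: st_chosen_def)
  ultimately have "(H, f, H \<inter> M, {}) \<in> good_structs (fam_pair n e p k c)" by blast
  then show ?thesis by (rule rev_image_eqI) simp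
qed

text \<open>An added triple \<open>h\<close> kills a member \<open>f\<close> either through one of
  the three pairs of \<open>h\<close>, counted by \<open>fam_pair\<close>, or through a second
  configuration, counted by \<open>fam_linked\<close>.\<close>

lemma loss_jump:
  assumes k: "3 \<le> k" "k \<le> l" and c: "c + 2 \<le> k" and e: "e \<in> A" and m: "m \<in> moves A P" and kept: "e \<notin> los m"
  shows "real (card {H \<in> live_configs n k c M A e. \<exists>f\<in>H \<inter> A - {e}. f \<in> los m}) \<le> (real l + 4) * Y * real n ^ (k - 2 - c)"
proof -
  let ?S = "{H \<in> live_configs n k c M A e. \<exists>f\<in>H \<inter> A - {e}. f \<in> los m}"
  let ?b = "real n ^ (k - 2 - c) * Y"
  have b0: "0 \<le> ?b" using Y1 by simp
  have one: "?b \<le> (real l + 4) * Y * real n ^ (k - 2 - c)"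
  proof -
    have "1 * ?b \<le> (real l + 4) * ?b" using b0 by (intro mult_right_mono) auto
    then show ?thesis by (simp add: mult_ac)
  qed
  have f3: "real (card (fst ` good_structs (fam_pair n e p k c))) \<le> ?b" if "p \<in> pairs n" for p
    using k c A_triple[OF e] that by (intro card_image_structs fam_pair_mem) auto
  have fin3: "finite (fst ` good_structs (fam_pair n e p k c))" for p using finite_fam(2) by simp
  show ?thesis
  proof (cases m)
    case (Add h)
    then have h: "h \<in> A" using m by (auto simp: moves_def)
    note ht = triples_facts[OF A_triple[OF h]]
    have eh1: "card (e \<inter> h) \<le> 1" using kept Add e by auto
    have eh: "e \<noteq> h" using eh1 ht by auto
    let ?Ph = "{p. p \<subseteq> h \<and> card p = 2}"
    let ?U = "\<Union>p\<in>?Ph. fst ` good_structs (fam_pair n e p k c)"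
    let ?V = "\<Union>k'\<in>{3..l}. fst ` good_structs (fam_linked n e h k c k')"
    have Phn: "?Ph \<subseteq> pairs n" using ht by (auto simp: pairs_def)
    have "?S \<subseteq> ?U \<union> ?V"
    proof
      fix H assume "H \<in> ?S"
      then obtain f where H: "H \<in> live_configs n k c M A e" and f: "f \<in> H \<inter> A - {e}" and fl: "f \<in> los m" by blast
      show "H \<in> ?U \<union> ?V"
      proof (cases "2 \<le> card (f \<inter> h)")
        case True
        then obtain p where p: "p \<subseteq> f" "p \<subseteq> h" "card p = 2" by (rule obtain_pair_in_inter)
        then have "H \<in> fst ` good_structs (fam_pair n e p k c)" using live_configs_fam_pair[OF k(1) H e f] by simp
        then show ?thesis using p by blast
      next
        case False
        then have "conf n l M f h" using fl Add by simp
        then obtain k' G where fh: "h \<noteq> f" and k': "3 \<le> k'" "k' \<le> l" and G: "G \<in> configs n k'" "h \<in> G" "f \<in> G"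
          "G \<subseteq> insert h (insert f M)" unfolding conf_def by blast
        have eG: "e \<notin> G" using G eh f e MA by blast
        have "H \<inter> M \<subseteq> H - {e, f}" using MA e f by blast
        then have "(H, f, (H \<inter> M) \<union> (G - {f, h}), G) \<in> fam_linked n e h k c k'"
          using H f G eG eh1 fh unfolding fam_linked_def live_configs_def by blast
        moreover have "st_chosen (H, f, (H \<inter> M) \<union> (G - {f, h}), G) \<subseteq> M"
          using G by (auto simp: st_chosen_def)
        ultimately have "(H, f, (H \<inter> M) \<union> (G - {f, h}), G) \<in> good_structs (fam_linked n e h k c k')" by blast
        then have "H \<in> fst ` good_structs (fam_linked n e h k c k')" by (rule rev_image_eqI) simp
        then show ?thesis using k' by auto
      qed
    qed
    moreover have finPh: "finite ?Ph" using card_pairs_of_triple(2) ht by blast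
    have fin4: "finite (fst ` good_structs (fam_linked n e h k c k'))" for k' using finite_fam(3) by simp
    have finUV: "finite (?U \<union> ?V)" using finPh fin3 fin4 by blast
    ultimately have "card ?S \<le> card (?U \<union> ?V)" by (intro card_mono)
    also have "\<dots> \<le> card ?U + card ?V" by (rule card_Un_le)
    finally have "real (card ?S) \<le> real (card ?U) + real (card ?V)" by linarith
    also have "real (card ?U) \<le> real (card ?Ph) * ?b"
      using Phn f3 by (intro card_UN_real_le finPh) blast
    also have "real (card ?V) \<le> real (card {3..l}) * ?b"
      using k c A_triple e h by (intro card_UN_real_le card_image_structs fam_linked_mem) auto
    also have "\<dots> \<le> real l * ?b" using b0 card_ks by (intro mult_right_mono) auto
    also have "card ?Ph = 3" using card_pairs_of_triple(1) ht by blast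
    finally have "real (card ?S) \<le> (real l + 3) * ?b" by (simp add: algebra_simps)
    also have "\<dots> \<le> (real l + 4) * ?b" using b0 by (intro mult_right_mono) auto
    finally show ?thesis by (simp add: mult_ac)
  next
    case (Waste p)
    then have p: "p \<in> pairs n" using m valid_stateD(3)[OF valid] by (auto simp: moves_def)
    have "?S \<subseteq> fst ` good_structs (fam_pair n e p k c)"
    proof
      fix H assume "H \<in> ?S"
      then obtain f where H: "H \<in> live_configs n k c M A e" and f: "f \<in> H \<inter> A - {e}" and fl: "f \<in> los m" by blast
      then show "H \<in> fst ` good_structs (fam_pair n e p k c)" using live_configs_fam_pair[OF k(1) H e f] Waste by simp
    qed
    then have "card ?S \<le> card (fst ` good_structs (fam_pair n e p k c))" using fin3 by (intro card_mono)
    then show ?thesis using f3[OF p] one by linarith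
  next
    case (Del f')
    then have f': "f' \<in> A" using m by (auto simp: moves_def)
    note ft = triples_facts[OF A_triple[OF f']]
    have "2 \<le> card f'" using ft by simp
    \<comment> \<open>Any pair inside the deleted triple will do, as containing it is weaker than
      being \<open>f'\<close>.\<close>
    then obtain p where p: "p \<subseteq> f'" "card p = 2" using obtain_subset_with_card_n[of 2 f'] by metis
    then have pn: "p \<in> pairs n" using ft by (auto simp: pairs_def)
    have "?S \<subseteq> fst ` good_structs (fam_pair n e p k c)"
    proof
      fix H assume "H \<in> ?S"
      then obtain f where H: "H \<in> live_configs n k c M A e" and f: "f \<in> H \<inter> A - {e}" and fl: "f \<in> los m" by blast
      then have "f = f'" using Del by simp
      then show "H \<in> fst ` good_structs (fam_pair n e p k c)" using live_configs_fam_pair[OF k(1) H e f] p by simp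
    qed
    then have "card ?S \<le> card (fst ` good_structs (fam_pair n e p k c))" using fin3 by (intro card_mono)
    then show ?thesis using f3[OF pn] one by linarith
  next
    case Null
    then have "?S = {}" by simp
    then show ?thesis using b0 one by (simp only: card.empty)
  qed
qed

text \<open>Each of \<open>f\<close> and \<open>f'\<close> is hit by \<open>h\<close> through one of
  3 pairs or through a configuration of one of at most \<open>l\<close> sizes. The four combinations
  give \<open>9 + 3 l + 3 l + l ^ 2\<close> cases, each with at most \<open>Y\<close>
  triples.\<close>

lemma joint_loss:
  assumes f: "f \<in> A" "f' \<in> A" "f \<noteq> f'" "card (f \<inter> f') \<le> 1"
  shows "real (card {h \<in> A. f \<in> los (Add h) \<and> f' \<in> los (Add h)}) \<le> (real l + 3)\<^sup>2 * Y"
proof -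
  let ?S = "{h \<in> A. f \<in> los (Add h) \<and> f' \<in> los (Add h)}"
  let ?Q = "\<lambda>f. {p. p \<subseteq> f \<and> card p = (2::nat)}"
  let ?B = "(\<lambda>(p, q). p \<union> q) ` (?Q f \<times> ?Q f')"
  let ?C = "\<lambda>f f'. \<Union>q\<in>?Q f'. \<Union>k\<in>{3..l}. (fst \<circ> snd) ` good_structs (fam_pair n f q k (k - 2))"
  let ?D = "\<Union>k\<in>{3..l}. \<Union>k'\<in>{3..l}. (fst \<circ> snd) ` good_structs (fam_linked n f f' k (k - 2) k')"
  note ft = triples_facts[OF A_triple[OF f(1)]] and ft' = triples_facts[OF A_triple[OF f(2)]]
  have cQ: "card (?Q e) = 3" "finite (?Q e)" "?Q e \<subseteq> pairs n" if "e \<in> A" for e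
    using card_pairs_of_triple[of e] triples_facts[OF A_triple[OF that]] by (auto simp: pairs_def)
  have conf_fam_pair: "h \<in> ?C e e'" if e: "e \<in> A" "e' \<in> A" and h: "h \<in> A" "conf n l M e h" "2 \<le> card (e' \<inter> h)" for e e' h
  proof -
    obtain q where q: "q \<subseteq> e'" "q \<subseteq> h" "card q = 2" using h(3) by (rule obtain_pair_in_inter)
    obtain k H where eh: "h \<noteq> e" and k: "3 \<le> k" "k \<le> l" and H: "H \<in> configs n k" "h \<in> H" "e \<in> H"
      "H \<subseteq> insert h (insert e M)" using h(2) unfolding conf_def by blast
    note Hf = configs_facts[OF H(1) k(1)]
    have "card (H - {e, h}) = k - 2" using Hf H eh by (simp add: card_Diff_subset)
    then have "(H, h, H - {e, h}, {}) \<in> fam_pair n e q k (k - 2)" using H q eh by (simp add: fam_pair_def)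
    moreover have "st_chosen (H, h, H - {e, h}, {}) \<subseteq> M" using H by (auto simp: st_chosen_def)
    ultimately have "(H, h, H - {e, h}, {}) \<in> good_structs (fam_pair n e q k (k - 2))" by blast
    then have "h \<in> (fst \<circ> snd) ` good_structs (fam_pair n e q k (k - 2))" by (rule rev_image_eqI) simp
    moreover have "k \<in> {3..l}" "q \<in> ?Q e'" using k q by simp_all
    ultimately show ?thesis by blast
  qed
  have "?S \<subseteq> ?B \<union> ?C f f' \<union> ?C f' f \<union> ?D"
  proof
    fix h assume "h \<in> ?S"
    then have h: "h \<in> A" and l1: "2 \<le> card (f \<inter> h) \<or> conf n l M f h" and l2: "2 \<le> card (f' \<inter> h) \<or> conf n l M f' h"
      by auto
    note ht = triples_facts[OF A_triple[OF h]]
    consider (1) "2 \<le> card (f \<inter> h)" "2 \<le> card (f' \<inter> h)" | (2) "conf n l M f h" "2 \<le> card (f' \<inter> h)"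
      | (3) "2 \<le> card (f \<inter> h)" "conf n l M f' h" | (4) "conf n l M f h" "conf n l M f' h" "\<not> 2 \<le> card (f \<inter> h)"
      using l1 l2 by blast
    then show "h \<in> ?B \<union> ?C f f' \<union> ?C f' f \<union> ?D"
    proof cases
      case 1
      obtain p where p: "p \<subseteq> f" "p \<subseteq> h" "card p = 2" using 1(1) by (rule obtain_pair_in_inter)
      obtain q where q: "q \<subseteq> f'" "q \<subseteq> h" "card q = 2" using 1(2) by (rule obtain_pair_in_inter)
      have fin: "finite p" "finite q" using p q ht finite_subset by blast+
      \<comment> \<open>The two pairs differ, as a common pair would lie in
        \<open>f \<inter> f'\<close>; hence they determine \<open>h\<close>.\<close>
      have "3 \<le> card (p \<union> q)"
      proof (rule ccontr)
        assume "\<not> ?thesis"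
        then have "card (p \<union> q) \<le> card p" using p by simp
        then have "p = p \<union> q" using fin by (intro card_seteq) auto
        then have "q \<subseteq> f \<inter> f'" using p q by blast
        then have "card q \<le> card (f \<inter> f')" using ft by (intro card_mono) auto
        then show False using q f(4) by simp
      qed
      then have "p \<union> q = h" using p q ht by (intro card_seteq) auto
      then have "h \<in> ?B" using p q by (intro image_eqI[where x = "(p, q)"]) auto
      then show ?thesis by blast
    next
      case 2
      then show ?thesis using conf_fam_pair[OF f(1,2) h] by blast
    next
      case 3
      then show ?thesis using conf_fam_pair[OF f(2,1) h] by blast
    next
      case 4
      obtain k H where fh: "h \<noteq> f" and k: "3 \<le> k" "k \<le> l" and H: "H \<in> configs n k" "h \<in> H" "f \<in> H"
        "H \<subseteq> insert h (insert f M)" using 4(1) unfolding conf_def by blast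
      obtain k' G where fh': "h \<noteq> f'" and k': "3 \<le> k'" "k' \<le> l" and G: "G \<in> configs n k'" "h \<in> G" "f' \<in> G"
        "G \<subseteq> insert h (insert f' M)" using 4(2) unfolding conf_def by blast
      note Hf = configs_facts[OF H(1) k(1)]
      have fG: "f \<notin> G" using G fh f MA by blast
      have cI: "card (H - {f, h}) = k - 2" using Hf H fh by (simp add: card_Diff_subset)
      \<comment> \<open>Here \<open>h\<close> is the triple shared by the two configurations, and
        the roots are \<open>f\<close> and \<open>f'\<close>.\<close>
      have "(H, h, (H - {f, h}) \<union> (G - {h, f'}), G) \<in> fam_linked n f f' k (k - 2) k'"
        using H G fG fh' f(4) cI unfolding fam_linked_def by blast
      moreover have "st_chosen (H, h, (H - {f, h}) \<union> (G - {h, f'}), G) \<subseteq> M"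
        using H G by (auto simp: st_chosen_def)
      ultimately have "(H, h, (H - {f, h}) \<union> (G - {h, f'}), G) \<in> good_structs (fam_linked n f f' k (k - 2) k')" by blast
      then have "h \<in> (fst \<circ> snd) ` good_structs (fam_linked n f f' k (k - 2) k')" by (rule rev_image_eqI) simp
      moreover have "k \<in> {3..l}" "k' \<in> {3..l}" using k k' by simp_all
      ultimately have "h \<in> ?D" by blast
      then show ?thesis by (rule UnI2)
    qed
  qed
  note sub = this
  have fin3: "finite ((fst \<circ> snd) ` good_structs (fam_pair n e q k c))" for e q k c using finite_fam(2) by simp
  have fin4: "finite ((fst \<circ> snd) ` good_structs (fam_linked n f f' k c k'))" for k c k' using finite_fam(3) by simp
  have finC: "finite (?C e e')" if "e' \<in> A" for e e'
    by (intro finite_UN_I fin3 finite_atLeastAtMost cQ(2)[OF that])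
  have finB: "finite ?B" by (intro finite_imageI finite_cartesian_product cQ(2) f)
  have finD: "finite ?D" by (intro finite_UN_I fin4 finite_atLeastAtMost)
  have "card ?S \<le> card (?B \<union> ?C f f' \<union> ?C f' f \<union> ?D)"
    by (rule card_mono[OF _ sub]) (intro finite_UnI finB finC finD f)
  also have "\<dots> \<le> card ?B + card (?C f f') + card (?C f' f) + card ?D"
    using card_Un_le[of "?B \<union> ?C f f' \<union> ?C f' f" ?D] card_Un_le[of "?B \<union> ?C f f'" "?C f' f"]
      card_Un_le[of ?B "?C f f'"] by linarith
  finally have S: "real (card ?S) \<le> real (card ?B) + real (card (?C f f')) + real (card (?C f' f)) + real (card ?D)"
    by linarith
  have "card ?B \<le> card (?Q f \<times> ?Q f')" by (intro card_image_le finite_cartesian_product cQ(2) f)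
  then have B: "card ?B \<le> 9" by (simp only: card_cartesian_product cQ(1)[OF f(1)] cQ(1)[OF f(2)])
  have lY: "real (card {3..l}) * Y \<le> real l * Y" using Y1 card_ks by (intro mult_right_mono) auto
  have C: "real (card (?C e e')) \<le> 3 * (real l * Y)" if e: "e \<in> A" "e' \<in> A" for e e'
  proof -
    have "real (card (?C e e')) \<le> real (card (?Q e')) * (real l * Y)"
    proof (intro card_UN_real_le cQ(2)[OF e(2)])
      fix q assume "q \<in> ?Q e'"
      then have q: "q \<in> pairs n" using cQ(3)[OF e(2)] by blast
      have "real (card (\<Union>k\<in>{3..l}. (fst \<circ> snd) ` good_structs (fam_pair n e q k (k - 2)))) \<le> real (card {3..l}) * Y"
      proof (rule card_UN_real_le)
        fix k assume k: "k \<in> {3..l}"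
        have "(fam_pair n e q k (k - 2), k - 2 - (k - 2)) \<in> fams n l"
          using k A_triple[OF e(1)] q by (intro fam_pair_mem) auto
        from card_image_structs[OF this, of "fst \<circ> snd"]
        show "real (card ((fst \<circ> snd) ` good_structs (fam_pair n e q k (k - 2)))) \<le> Y" by simp
      qed simp
      then show "real (card (\<Union>k\<in>{3..l}. (fst \<circ> snd) ` good_structs (fam_pair n e q k (k - 2)))) \<le> real l * Y"
        using lY by linarith
    qed
    then show ?thesis by (simp only: cQ(1)[OF e(2)] of_nat_numeral)
  qed
  have Dl: "real (card ?D) \<le> real l * (real l * Y)"
  proof -
    have "real (card ?D) \<le> real (card {3..l}) * (real l * Y)"
    proof (rule card_UN_real_le)
      fix k assume k: "k \<in> {3..l}"
      have "real (card (\<Union>k'\<in>{3..l}. (fst \<circ> snd) ` good_structs (fam_linked n f f' k (k - 2) k'))) \<le> real (card {3..l}) * Y"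
      proof (rule card_UN_real_le)
        fix k' assume k': "k' \<in> {3..l}"
        have "(fam_linked n f f' k (k - 2) k', k - 2 - (k - 2)) \<in> fams n l"
          using k k' A_triple[OF f(1)] A_triple[OF f(2)] by (intro fam_linked_mem) auto
        from card_image_structs[OF this, of "fst \<circ> snd"]
        show "real (card ((fst \<circ> snd) ` good_structs (fam_linked n f f' k (k - 2) k'))) \<le> Y" by simp
      qed simp
      then show "real (card (\<Union>k'\<in>{3..l}. (fst \<circ> snd) ` good_structs (fam_linked n f f' k (k - 2) k'))) \<le> real l * Y"
        using lY by linarith
    qed simp
    also have "\<dots> \<le> real l * (real l * Y)" using Y1 card_ks by (intro mult_right_mono) auto
    finally show ?thesis .
  qed
  have "real (card ?S) \<le> 9 + 6 * (real l * Y) + real l * (real l * Y)"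
    using S B C[OF f(1,2)] C[OF f(2,1)] Dl by linarith
  also have "\<dots> \<le> 9 * Y + 6 * (real l * Y) + real l * (real l * Y)" using Y1 by simp
  also have "\<dots> = (real l + 3)\<^sup>2 * Y" by (simp add: power2_eq_square algebra_simps)
  finally show ?thesis .
qed

end

section \<open>Drift of the tracked quantities\<close>

text \<open>A Freedman-type estimate: the second moment of the increment is at most its maximal size
  \<open>J\<close> times the mean total movement. Gains and losses are kept apart since the linear
  term needs losses bounded from below and the quadratic term needs them bounded from above.\<close>

lemma weighted_exp_drift:
  fixes w Z' gn ls :: "'m \<Rightarrow> real"
  assumes w: "\<And>m. m \<in> K \<Longrightarrow> 0 \<le> w m" "sum w K \<le> 1"
    and Z: "\<And>m. m \<in> K \<Longrightarrow> Z' m \<le> Z + gn m - ls m"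
    and gn: "\<And>m. m \<in> K \<Longrightarrow> 0 \<le> gn m \<and> gn m \<le> J" and ls: "\<And>m. m \<in> K \<Longrightarrow> 0 \<le> ls m \<and> ls m \<le> J"
    and \<alpha>: "(\<Sum>m\<in>K. w m * gn m) \<le> \<alpha>" and \<beta>: "\<beta> \<le> (\<Sum>m\<in>K. w m * ls m)" "(\<Sum>m\<in>K. w m * ls m) \<le> \<beta>'"
    and \<mu>: "0 \<le> \<mu>" "0 \<le> G" "\<mu> * G * J \<le> 1" and J: "0 \<le> J"
  shows "(\<Sum>m\<in>K. w m * exp (\<mu> * (G * Z' m - x)))
    \<le> exp (\<mu> * (G * Z - x) + \<mu> * G * (\<alpha> - \<beta>) + (\<mu> * G)\<^sup>2 * J * (\<alpha> + \<beta>'))"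
proof -
  define y where "y m = \<mu> * G * (gn m - ls m)" for m
  have \<mu>G: "0 \<le> \<mu> * G" using \<mu> by simp
  have "(\<Sum>m\<in>K. w m * exp (\<mu> * (G * Z' m - x))) \<le> (\<Sum>m\<in>K. w m * exp (\<mu> * (G * Z - x) + y m))"
  proof (intro sum_mono mult_left_mono)
    fix m assume m: "m \<in> K"
    have "(\<mu> * G) * Z' m \<le> (\<mu> * G) * (Z + gn m - ls m)" using Z[OF m] \<mu>G by (rule mult_left_mono)
    then show "exp (\<mu> * (G * Z' m - x)) \<le> exp (\<mu> * (G * Z - x) + y m)"
      by (simp add: y_def algebra_simps)
  qed (use w in auto)
  also have "\<dots> \<le> exp (\<mu> * (G * Z - x) + (\<Sum>m\<in>K. w m * y m) + (\<Sum>m\<in>K. w m * (y m)\<^sup>2))"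
  proof (rule weighted_exp_sum_le[OF w])
    fix m assume m: "m \<in> K"
    have "y m \<le> \<mu> * G * J" unfolding y_def using gn[OF m] ls[OF m] \<mu>G by (intro mult_left_mono) auto
    then show "y m \<le> 1" using \<mu> by simp
  qed
  also have "(\<Sum>m\<in>K. w m * y m) = \<mu> * G * ((\<Sum>m\<in>K. w m * gn m) - (\<Sum>m\<in>K. w m * ls m))"
    by (simp add: y_def sum_distrib_left sum_subtractf algebra_simps)
  also have "(\<Sum>m\<in>K. w m * (y m)\<^sup>2) \<le> (\<Sum>m\<in>K. (\<mu> * G)\<^sup>2 * J * (w m * gn m + w m * ls m))"
  proof (rule sum_mono)
    fix m assume m: "m \<in> K"
    have "(gn m - ls m)\<^sup>2 = \<bar>gn m - ls m\<bar> * \<bar>gn m - ls m\<bar>" by (simp add: power2_eq_square)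
    also have "\<dots> \<le> J * (gn m + ls m)" using gn[OF m] ls[OF m] J by (intro mult_mono) auto
    finally have "(\<mu> * G)\<^sup>2 * w m * (gn m - ls m)\<^sup>2 \<le> (\<mu> * G)\<^sup>2 * w m * (J * (gn m + ls m))"
      using w(1)[OF m] by (intro mult_left_mono) auto
    moreover have "w m * (y m)\<^sup>2 = (\<mu> * G)\<^sup>2 * w m * (gn m - ls m)\<^sup>2"
      unfolding y_def by (simp only: power_mult_distrib mult_ac)
    moreover have "(\<mu> * G)\<^sup>2 * w m * (J * (gn m + ls m)) = (\<mu> * G)\<^sup>2 * J * (w m * gn m + w m * ls m)"
      by (simp only: distrib_left mult_ac)
    ultimately show "w m * (y m)\<^sup>2 \<le> (\<mu> * G)\<^sup>2 * J * (w m * gn m + w m * ls m)" by linarith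
  qed
  also have "\<dots> = (\<mu> * G)\<^sup>2 * J * ((\<Sum>m\<in>K. w m * gn m) + (\<Sum>m\<in>K. w m * ls m))"
    by (simp add: sum_distrib_left sum.distrib distrib_left)
  also have "\<dots> \<le> (\<mu> * G)\<^sup>2 * J * (\<alpha> + \<beta>')"
    using \<alpha> \<beta> J by (intro mult_left_mono) auto
  finally have "(\<Sum>m\<in>K. w m * exp (\<mu> * (G * Z' m - x)))
      \<le> exp (\<mu> * (G * Z - x) + \<mu> * G * ((\<Sum>m\<in>K. w m * gn m) - (\<Sum>m\<in>K. w m * ls m)) + (\<mu> * G)\<^sup>2 * J * (\<alpha> + \<beta>'))"
    by simp
  also have "\<dots> \<le> exp (\<mu> * (G * Z - x) + \<mu> * G * (\<alpha> - \<beta>) + (\<mu> * G)\<^sup>2 * J * (\<alpha> + \<beta>'))"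
  proof -
    have "\<mu> * G * ((\<Sum>m\<in>K. w m * gn m) - (\<Sum>m\<in>K. w m * ls m)) \<le> \<mu> * G * (\<alpha> - \<beta>)"
      using \<alpha> \<beta> \<mu>G by (intro mult_left_mono) auto
    then show ?thesis by simp
  qed
  finally show ?thesis .
qed

lemma sum_card_swap:
  fixes w :: "'m \<Rightarrow> real"
  assumes "finite K" "finite S"
  shows "(\<Sum>m\<in>K. w m * real (card {x \<in> S. R x m})) = (\<Sum>x\<in>S. \<Sum>m\<in>{m \<in> K. R x m}. w m)"
proof -
  have "(\<Sum>m\<in>K. w m * real (card {x \<in> S. R x m})) = (\<Sum>m\<in>K. \<Sum>x\<in>S. if R x m then w m else 0)"
    using assms(2) by (intro sum.cong refl) (simp add: sum.inter_filter[symmetric])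
  also have "\<dots> = (\<Sum>x\<in>S. \<Sum>m\<in>K. if R x m then w m else 0)" by (rule sum.swap)
  finally show ?thesis using assms(1) by (simp add: sum.inter_filter)
qed

text \<open>Either \<open>e\<close> survives and at most one triple of \<open>B\<close> is hit,
  which is immediate, or every hit triple of \<open>B\<close> has a hit partner in
  \<open>insert e B\<close>, and the double sum outweighs the single one. Admitting \<open>e\<close>
  as a partner discounts the moves that remove \<open>e\<close>.\<close>

lemma bonferroni_indicator:
  assumes "finite B" "e \<notin> B"
  shows "(\<Sum>f\<in>B. of_bool (f \<in> L)) - (\<Sum>f\<in>B. \<Sum>f'\<in>insert e B - {f}. of_bool (f \<in> L \<and> f' \<in> L))
    \<le> (of_bool (e \<notin> L \<and> (\<exists>f\<in>B. f \<in> L)) :: real)"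
proof (cases "e \<notin> L \<and> card (B \<inter> L) \<le> 1")
  case True
  have s1: "(\<Sum>f\<in>B. of_bool (f \<in> L)) = real (card (B \<inter> L))"
    using assms by (simp add: of_bool_def sum.inter_filter[symmetric] Int_def)
  have s2: "0 \<le> (\<Sum>f\<in>B. \<Sum>f'\<in>insert e B - {f}. of_bool (f \<in> L \<and> f' \<in> L) :: real)"
    by (intro sum_nonneg) auto
  show ?thesis
  proof (cases "B \<inter> L = {}")
    case True
    then have "card (B \<inter> L) = 0" by (simp only: card.empty)
    then show ?thesis using s1 s2 by simp
  next
    case False
    then have "e \<notin> L \<and> (\<exists>f\<in>B. f \<in> L)" using True by blast
    then show ?thesis using s1 s2 True by simp
  qed
next
  case False
  have "(\<Sum>f\<in>B. of_bool (f \<in> L) :: real) \<le> (\<Sum>f\<in>B. \<Sum>f'\<in>insert e B - {f}. of_bool (f \<in> L \<and> f' \<in> L))"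
  proof (rule sum_mono)
    fix f assume f: "f \<in> B"
    show "(of_bool (f \<in> L) :: real) \<le> (\<Sum>f'\<in>insert e B - {f}. of_bool (f \<in> L \<and> f' \<in> L))"
    proof (cases "f \<in> L")
      case fL: True
      have "\<exists>f'\<in>insert e B - {f}. f' \<in> L"
      proof (cases "e \<in> L")
        case True
        then show ?thesis using assms f by blast
      next
        case eL: False
        then have "\<not> card (B \<inter> L) \<le> 1" using False by blast
        then have "\<not> B \<inter> L \<subseteq> {f}" using card_mono[of "{f}" "B \<inter> L"] by auto
        then show ?thesis by blast
      qed
      then obtain f' where f': "f' \<in> insert e B - {f}" "f' \<in> L" by blast
      have "(of_bool (f \<in> L \<and> f' \<in> L) :: real) \<le> (\<Sum>f'\<in>insert e B - {f}. of_bool (f \<in> L \<and> f' \<in> L))"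
        using f' assms by (intro member_le_sum) auto
      then show ?thesis using fL f' by simp
    qed simp
  qed
  then show ?thesis by (simp add: of_bool_def)
qed

lemma exp_add_small_le:
  fixes z t :: real
  assumes "0 \<le> t" "t \<le> 1"
  shows "exp (z + t) \<le> exp z * (1 + 2 * t)"
proof -
  have "exp t \<le> 1 + t + t\<^sup>2" using exp_bound assms by simp
  also have "t\<^sup>2 \<le> t" using assms by (simp add: power2_eq_square mult_left_le)
  finally have "exp t \<le> 1 + 2 * t" by simp
  then show ?thesis by (simp add: exp_add)
qed

context good_state
begin

lemma sum_pr_sub_le: "sum pr {m \<in> moves A P. Q m} \<le> 1"
proof -
  have "sum pr {m \<in> moves A P. Q m} \<le> sum pr (moves A P)"
    using pr_nonneg by (intro sum_mono2) auto
  then show ?thesis by (simp add: sum_pr)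
qed

text \<open>The mean loss is exactly \<open>a \<delta> d\<close>, which by \<open>g_Suc\<close>
  matches the change of scale, so the first-order terms cancel for the degree as well as for its
  negative and only a second-order term is left. The shifts \<open>1 + \<epsilon>\<close> and
  \<open>\<epsilon> - 1\<close> encode the two-sided bound.\<close>

lemma deg_drift:
  assumes p: "p \<in> P"
  defines "K \<equiv> {m \<in> moves A P. p \<notin> gone P m}"
  shows "(\<Sum>m\<in>K. pr m * exp (\<mu> * (g (Suc i) * real (deg (A - los m) p) - (1 + \<epsilon>))))
      \<le> exp (\<mu> * (g i * real (deg A p) - (1 + \<epsilon>))) * (1 + 8 * a * \<mu>\<^sup>2 * J1 * \<delta>)" (is ?upper)
    and "(\<Sum>m\<in>K. pr m * exp (\<mu> * (g (Suc i) * - real (deg (A - los m) p) - (\<epsilon> - 1))))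
      \<le> exp (\<mu> * (g i * - real (deg A p) - (\<epsilon> - 1))) * (1 + 8 * a * \<mu>\<^sup>2 * J1 * \<delta>)" (is ?lower)
proof -
  define G where "G = g (Suc i)"
  define d where "d = real (deg A p)"
  define J where "J = (real l + 3) * Y"
  define r where "r m = real (card {f \<in> A. p \<subseteq> f \<and> f \<in> los m})" for m
  have finK: "finite K" by (simp add: K_def)
  have G0: "0 \<le> G" using g_pos[of "Suc i"] by (simp add: G_def)
  have J0: "0 \<le> J" using Y1 by (simp add: J_def)
  have deg': "real (deg (A - los m) p) = d - r m" for m
  proof -
    have "{f \<in> A. p \<subseteq> f} = {f \<in> A - los m. p \<subseteq> f} \<union> {f \<in> A. p \<subseteq> f \<and> f \<in> los m}" by blast
    moreover have "{f \<in> A - los m. p \<subseteq> f} \<inter> {f \<in> A. p \<subseteq> f \<and> f \<in> los m} = {}" by blast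
    ultimately have "card {f \<in> A. p \<subseteq> f} = card {f \<in> A - los m. p \<subseteq> f} + card {f \<in> A. p \<subseteq> f \<and> f \<in> los m}"
      by (simp add: card_Un_disjoint)
    then show ?thesis by (simp add: deg_def d_def r_def)
  qed
  have rJ: "0 \<le> r m \<and> r m \<le> J" if "m \<in> K" for m
    using deg_jump[OF p, of m] that by (simp add: r_def J_def K_def)
  have Er: "(\<Sum>m\<in>K. pr m * r m) = a * \<delta> * d"
  proof -
    have "(\<Sum>m\<in>K. pr m * r m) = (\<Sum>m\<in>K. pr m * real (card {f \<in> {f \<in> A. p \<subseteq> f}. f \<in> los m}))"
      unfolding r_def by (simp add: conj_assoc)
    also have "\<dots> = (\<Sum>f\<in>{f \<in> A. p \<subseteq> f}. \<Sum>m\<in>{m \<in> K. f \<in> los m}. pr m)"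
      by (rule sum_card_swap[OF finK]) simp
    also have "\<dots> = (\<Sum>f\<in>{f \<in> A. p \<subseteq> f}. a * \<delta>)"
    proof (rule sum.cong)
      fix f assume f: "f \<in> {f \<in> A. p \<subseteq> f}"
      have "{m \<in> K. f \<in> los m} = {m \<in> moves A P. p \<notin> gone P m \<and> f \<in> los m}" by (auto simp: K_def)
      then show "(\<Sum>m\<in>{m \<in> K. f \<in> los m}. pr m) = a * \<delta>"
        using pr_lost_kept[of f p] f p by (simp add: a_def)
    qed simp
    finally show ?thesis by (simp add: d_def deg_def)
  qed
  have g1: "g i \<le> 1 / (n * \<theta> ^ l)" using g_power_n[of i 1] iN l4 by simp
  have G2: "G \<le> 2 * g i" using g_Suc_le(2)[of 1 i] l4 by (simp add: G_def)
  have GJ: "G * J \<le> J1"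
  proof -
    have "G * J \<le> (2 * (1 / (n * \<theta> ^ l))) * ((real l + 4) * Y)"
      unfolding J_def using G2 g1 J0 Y1 n0 \<theta>0 by (intro mult_mono mult_right_mono) (auto intro: order_trans)
    also have "\<dots> = J1" by (simp add: J1_def)
    finally show ?thesis .
  qed
  have Gd: "G * d \<le> 4"
  proof -
    have "G * d \<le> (2 * g i) * ((1 + \<epsilon>) * sc i)"
      using G2 deg_upper[OF p] g_pos[of i] G0 by (intro mult_mono) (auto simp: d_def)
    also have "\<dots> = 2 * (1 + \<epsilon>) * (g i * sc i)" by simp
    also have "\<dots> \<le> 4" using g_sc[of i] \<epsilon>_half by simp
    finally show ?thesis .
  qed
  have d0: "0 \<le> d" by (simp add: d_def)
  define t where "t = 4 * a * \<mu>\<^sup>2 * J1 * \<delta>"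
  have t0: "0 \<le> t" using a2 J1_pos \<delta>0 by (simp add: t_def)
  have t1: "t \<le> 1" using second by (simp add: t_def a_def J1_def)
  \<comment> \<open>One factor \<open>G\<close> normalises the jump and the other the
    degree.\<close>
  have sec: "(\<mu> * G)\<^sup>2 * J * (a * \<delta> * d) \<le> t"
  proof -
    have "(\<mu> * G)\<^sup>2 * J * (a * \<delta> * d) = \<mu>\<^sup>2 * (a * \<delta>) * ((G * J) * (G * d))"
      by (simp add: power2_eq_square algebra_simps)
    also have "\<dots> \<le> \<mu>\<^sup>2 * (a * \<delta>) * (J1 * 4)"
      using GJ Gd a2 \<delta>0 G0 J0 d0 J1_pos by (intro mult_left_mono mult_mono) auto
    finally show ?thesis by (simp add: t_def algebra_simps)
  qed
  have \<mu>GJ: "\<mu> * G * J \<le> 1"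
  proof -
    have "\<mu> * (G * J) \<le> \<mu> * J1" using GJ \<mu>0 by (intro mult_left_mono) auto
    then show ?thesis using \<mu>J1(2) by (simp add: mult.assoc)
  qed
  have prK: "\<And>m. m \<in> K \<Longrightarrow> 0 \<le> pr m" "sum pr K \<le> 1" using pr_nonneg sum_pr_sub_le by (auto simp: K_def)
  have gG: "g i = G * (1 - a * \<delta>)" using g_Suc[of i] by (simp add: G_def)
  have gd: "G * d - G * (a * \<delta> * d) = g i * d" by (simp add: gG algebra_simps)
  show ?upper
  proof -
    have "(\<Sum>m\<in>K. pr m * exp (\<mu> * (G * real (deg (A - los m) p) - (1 + \<epsilon>))))
        \<le> exp (\<mu> * (G * d - (1 + \<epsilon>)) + \<mu> * G * (0 - a * \<delta> * d) + (\<mu> * G)\<^sup>2 * J * (0 + a * \<delta> * d))"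
      by (rule weighted_exp_drift[where gn = "\<lambda>_. 0" and ls = r]) (use prK rJ Er J0 G0 \<mu>0 \<mu>GJ deg' in auto)
    also have "\<mu> * (G * d - (1 + \<epsilon>)) + \<mu> * G * (0 - a * \<delta> * d) = \<mu> * (g i * d - (1 + \<epsilon>))"
      unfolding gd[symmetric] by (simp add: algebra_simps)
    also have "exp (\<mu> * (g i * d - (1 + \<epsilon>)) + (\<mu> * G)\<^sup>2 * J * (0 + a * \<delta> * d)) \<le> exp (\<mu> * (g i * d - (1 + \<epsilon>)) + t)"
      using sec by simp
    also have "\<dots> \<le> exp (\<mu> * (g i * d - (1 + \<epsilon>))) * (1 + 2 * t)" by (rule exp_add_small_le[OF t0 t1])
    finally show ?thesis by (simp add: G_def d_def t_def mult.assoc)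
  qed
  show ?lower
  proof -
    have "(\<Sum>m\<in>K. pr m * exp (\<mu> * (G * - real (deg (A - los m) p) - (\<epsilon> - 1))))
        \<le> exp (\<mu> * (G * - d - (\<epsilon> - 1)) + \<mu> * G * (a * \<delta> * d - 0) + (\<mu> * G)\<^sup>2 * J * (a * \<delta> * d + 0))"
      by (rule weighted_exp_drift[where gn = r and ls = "\<lambda>_. 0"]) (use prK rJ Er J0 G0 \<mu>0 \<mu>GJ deg' in auto)
    also have "\<mu> * (G * - d - (\<epsilon> - 1)) + \<mu> * G * (a * \<delta> * d - 0) = \<mu> * (g i * - d - (\<epsilon> - 1))"
    proof -
      have "g i * - d = - (G * d - G * (a * \<delta> * d))" using gd by simp
      then show ?thesis by (simp add: algebra_simps)
    qed
    also have "exp (\<mu> * (g i * - d - (\<epsilon> - 1)) + (\<mu> * G)\<^sup>2 * J * (a * \<delta> * d + 0)) \<le> exp (\<mu> * (g i * - d - (\<epsilon> - 1)) + t)"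
      using sec by simp
    also have "\<dots> \<le> exp (\<mu> * (g i * - d - (\<epsilon> - 1))) * (1 + 2 * t)" by (rule exp_add_small_le[OF t0 t1])
    finally show ?thesis by (simp add: G_def d_def t_def mult.assoc)
  qed
qed


text \<open>Bonferroni: two triples of a configuration rarely disappear in the same move.\<close>

lemma loss_probability_ge:
  assumes k: "3 \<le> k" "k \<le> l" and c: "c + 2 \<le> k" and e: "e \<in> A" and H: "H \<in> live_configs n k c M A e"
  shows "real (k - 1 - c) * ((a + 1 / 2) * \<delta>)
    \<le> (\<Sum>m\<in>{m \<in> moves A P. e \<notin> los m \<and> (\<exists>f\<in>H \<inter> A - {e}. f \<in> los m)}. pr m)"
proof -
  let ?B = "H \<inter> A - {e}"
  let ?q = "k - 1 - c"
  have cB: "card ?B = ?q" and finH: "finite H" using live_configs_card[OF k(1) H e] by auto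
  have finB: "finite ?B" using finH by simp
  have HC: "H \<in> configs n k" "e \<in> H" using H by (auto simp: live_configs_def)
  note Hc = configs_facts(1)[OF HC(1) k(1)]
  have joint1: "(\<Sum>m\<in>{m \<in> moves A P. f \<in> los m \<and> f' \<in> los m}. pr m) \<le> \<delta> / Dm i * ((real l + 3)\<^sup>2 * Y)"
    if "f \<in> ?B" "f' \<in> insert e ?B - {f}" for f f'
  proof -
    have ff: "f \<in> A" "f' \<in> A" "f \<noteq> f'" "f \<in> H" "f' \<in> H" using that e HC by blast+
    have c1: "card (f \<inter> f') \<le> 1" by (rule config_two(2)[OF Hc k(1) ff(4,5,3)])
    show ?thesis
      unfolding pr_lost_both[OF ff(1-3) c1]
      using joint_loss[OF ff(1-3) c1] \<delta>0 Dm_ge by (intro mult_left_mono) auto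
  qed
  \<comment> \<open>A bound for the probability of one simultaneous loss. At most \<open>l\<close>
    partners per triple cost \<open>l \<eta> \<le> \<delta> / 2\<close>, which lowers the rate from
    \<open>(a + 1) \<delta>\<close> to \<open>(a + 1 / 2) \<delta>\<close>.\<close>
  define \<eta> where "\<eta> = \<delta> / Dm i * ((real l + 3)\<^sup>2 * Y)"
  have \<eta>0: "0 \<le> \<eta>" using \<delta>0 Dm_ge Y1 by (simp add: \<eta>_def)
  have l\<eta>: "real l * \<eta> \<le> \<delta> / 2"
  proof -
    have "\<delta> / Dm i \<le> \<delta> / (n * \<theta>)" using Dm_ge n0 \<theta>0 \<delta>0 by (intro divide_left_mono mult_pos_pos) auto
    then have "\<eta> \<le> \<delta> / (n * \<theta>) * ((real l + 3)\<^sup>2 * Y)"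
      unfolding \<eta>_def using Y1 by (intro mult_right_mono) auto
    then have "real l * \<eta> \<le> real l * (\<delta> / (n * \<theta>) * ((real l + 3)\<^sup>2 * Y))" by (intro mult_left_mono) auto
    also have "\<dots> = \<delta> * (real l * (real l + 3)\<^sup>2 * Y / (n * \<theta>))" by simp
    also have "\<dots> \<le> \<delta> * (1 / 2)" using joint \<delta>0 by (intro mult_left_mono) auto
    finally show ?thesis by simp
  qed
  have "real ?q * ((a + 1 / 2) * \<delta>) \<le> real ?q * ((a + 1) * \<delta> - real ?q * \<eta>)"
  proof (rule mult_left_mono)
    have "real ?q * \<eta> \<le> real l * \<eta>" using k \<eta>0 by (intro mult_right_mono) auto
    then show "(a + 1 / 2) * \<delta> \<le> (a + 1) * \<delta> - real ?q * \<eta>" using l\<eta> by (simp add: algebra_simps)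
  qed simp
  also have "\<dots> = (\<Sum>f\<in>?B. (a + 1) * \<delta>) - (\<Sum>f\<in>?B. \<Sum>f'\<in>insert e ?B - {f}. \<eta>)"
  proof -
    have "card (insert e ?B - {f}) = ?q" if "f \<in> ?B" for f
    proof -
      have "card (insert e ?B) = Suc (card ?B)" by (rule card_insert_disjoint[OF finB]) simp
      moreover have "card (insert e ?B - {f}) = card (insert e ?B) - 1"
        by (rule card_Diff_singleton) (use that in blast)
      ultimately show ?thesis by (simp only: cB diff_Suc_1)
    qed
    then have "(\<Sum>f\<in>?B. \<Sum>f'\<in>insert e ?B - {f}. \<eta>) = (\<Sum>f\<in>?B. real ?q * \<eta>)"
      by (intro sum.cong refl) simp
    then show ?thesis using cB by (simp add: algebra_simps)
  qed
  also have "\<dots> \<le> (\<Sum>f\<in>?B. \<Sum>m\<in>{m \<in> moves A P. f \<in> los m}. pr m)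
      - (\<Sum>f\<in>?B. \<Sum>f'\<in>insert e ?B - {f}. \<Sum>m\<in>{m \<in> moves A P. f \<in> los m \<and> f' \<in> los m}. pr m)"
  proof (rule diff_mono)
    show "(\<Sum>f\<in>?B. (a + 1) * \<delta>) \<le> (\<Sum>f\<in>?B. \<Sum>m\<in>{m \<in> moves A P. f \<in> los m}. pr m)"
      using pr_lost by (intro sum_mono) (simp add: a_def)
    show "(\<Sum>f\<in>?B. \<Sum>f'\<in>insert e ?B - {f}. \<Sum>m\<in>{m \<in> moves A P. f \<in> los m \<and> f' \<in> los m}. pr m)
        \<le> (\<Sum>f\<in>?B. \<Sum>f'\<in>insert e ?B - {f}. \<eta>)"
      using joint1 by (intro sum_mono) (simp only: \<eta>_def)
  qed
  also have "\<dots> = (\<Sum>m\<in>moves A P. pr m * ((\<Sum>f\<in>?B. of_bool (f \<in> los m))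
      - (\<Sum>f\<in>?B. \<Sum>f'\<in>insert e ?B - {f}. of_bool (f \<in> los m \<and> f' \<in> los m))))"
  proof -
    have "(\<Sum>f\<in>?B. \<Sum>m\<in>moves A P. pr m * of_bool (f \<in> los m)) = (\<Sum>m\<in>moves A P. pr m * (\<Sum>f\<in>?B. of_bool (f \<in> los m)))"
      unfolding sum_distrib_left by (rule sum.swap)
    moreover have "(\<Sum>f\<in>?B. \<Sum>f'\<in>insert e ?B - {f}. \<Sum>m\<in>moves A P. pr m * of_bool (f \<in> los m \<and> f' \<in> los m))
        = (\<Sum>m\<in>moves A P. pr m * (\<Sum>f\<in>?B. \<Sum>f'\<in>insert e ?B - {f}. of_bool (f \<in> los m \<and> f' \<in> los m)))"
    proof -
      have "(\<Sum>f\<in>?B. \<Sum>f'\<in>insert e ?B - {f}. \<Sum>m\<in>moves A P. pr m * of_bool (f \<in> los m \<and> f' \<in> los m))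
        = (\<Sum>f\<in>?B. \<Sum>m\<in>moves A P. \<Sum>f'\<in>insert e ?B - {f}. pr m * of_bool (f \<in> los m \<and> f' \<in> los m))"
        by (intro sum.cong refl sum.swap)
      also have "\<dots> = (\<Sum>m\<in>moves A P. \<Sum>f\<in>?B. \<Sum>f'\<in>insert e ?B - {f}. pr m * of_bool (f \<in> los m \<and> f' \<in> los m))"
        by (rule sum.swap)
      finally show ?thesis by (simp only: sum_distrib_left)
    qed
    ultimately show ?thesis unfolding sum_pr_filter by (simp only: right_diff_distrib sum_subtractf)
  qed
  also have "\<dots> \<le> (\<Sum>m\<in>moves A P. pr m * of_bool (e \<notin> los m \<and> (\<exists>f\<in>?B. f \<in> los m)))"
    using pr_nonneg finB by (intro sum_mono mult_left_mono bonferroni_indicator) auto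
  finally show ?thesis unfolding sum_pr_filter .
qed

text \<open>A configuration counted afterwards either was counted before and lost no triple, or has
  just received the added triple and had one member less in \<open>M\<close>.\<close>

lemma live_configs_next_card_le:
  assumes k: "3 \<le> k" and e: "e \<in> A" and m: "m \<in> moves A P" "e \<notin> los m"
  shows "real (card (live_configs n k c (M \<union> added m) (A - los m) e)) \<le> real (card (live_configs n k c M A e))
    + real (card {H \<in> configs n k. e \<in> H \<and> H \<subseteq> M \<union> A \<and> card (H \<inter> M) + 1 = c \<and> added m \<inter> H \<noteq> {}})
    - real (card {H \<in> live_configs n k c M A e. \<exists>f\<in>H \<inter> A - {e}. f \<in> los m})"
proof -
  let ?G = "{H \<in> configs n k. e \<in> H \<and> H \<subseteq> M \<union> A \<and> card (H \<inter> M) + 1 = c \<and> added m \<inter> H \<noteq> {}}"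
  let ?L = "{H \<in> live_configs n k c M A e. \<exists>f\<in>H \<inter> A - {e}. f \<in> los m}"
  let ?X = "live_configs n k c M A e"
  have sub: "live_configs n k c (M \<union> added m) (A - los m) e \<subseteq> (?X - ?L) \<union> ?G"
  proof
    fix H assume "H \<in> live_configs n k c (M \<union> added m) (A - los m) e"
    then have H: "H \<in> configs n k" "e \<in> H" "H \<subseteq> M \<union> added m \<union> (A - los m)" "card (H \<inter> (M \<union> added m)) = c"
      by (auto simp: live_configs_def)
    show "H \<in> (?X - ?L) \<union> ?G"
    proof (cases "added m \<inter> H = {}")
      case True
      then have "H \<inter> (M \<union> added m) = H \<inter> M" by blast
      then have "H \<in> ?X" using H True by (auto simp: live_configs_def)
      moreover have "H \<notin> ?L" using H True MA by blast
      ultimately show ?thesis by blast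
    next
      case False
      then obtain h where mh: "m = Add h" by (cases m) auto
      then have h: "h \<in> A" "h \<in> H" using m False by (auto simp: moves_def)
      then have hM: "h \<notin> M" using MA by blast
      have "H \<inter> (M \<union> added m) = insert h (H \<inter> M)" using mh h by auto
      then have "card (H \<inter> M) + 1 = c" using H hM configs_facts(4)[OF H(1) k] by simp
      moreover have "H \<subseteq> M \<union> A" using H mh h by auto
      ultimately show ?thesis using H False by blast
    qed
  qed
  have finG: "finite ?G" by (rule finite_subset[OF _ finite_configs[of n k]]) blast
  have "card (live_configs n k c (M \<union> added m) (A - los m) e) \<le> card ((?X - ?L) \<union> ?G)"
    using finG by (intro card_mono sub) simp
  also have "\<dots> \<le> card (?X - ?L) + card ?G" by (rule card_Un_le)
  finally have "card (live_configs n k c (M \<union> added m) (A - los m) e) \<le> card (?X - ?L) + card ?G" .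
  moreover have "card (?X - ?L) = card ?X - card ?L" by (intro card_Diff_subset) auto
  moreover have "card ?L \<le> card ?X" by (intro card_mono) auto
  ultimately show ?thesis by linarith
qed

text \<open>A configuration one level below has at most \<open>l\<close> members, each added with
  probability at most \<open>\<delta> / Dm i \<le> \<delta> / sc i\<close>; the ratio
  \<open>16 l\<close> of consecutive values of \<open>live_bound\<close> turns this into the factor
  1/16.\<close>

lemma gain_expectation_le:
  assumes k: "3 \<le> k" "k \<le> l" and c: "c + 2 \<le> k" and e: "e \<in> A"
  shows "(\<Sum>m\<in>{m \<in> moves A P. e \<notin> los m}. pr m *
      real (card {H \<in> configs n k. e \<in> H \<and> H \<subseteq> M \<union> A \<and> card (H \<inter> M) + 1 = c \<and> added m \<inter> H \<noteq> {}}))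
    \<le> \<delta> * live_bound l c * sc i ^ (k - 1 - c) / 16"
proof -
  let ?K = "{m \<in> moves A P. e \<notin> los m}"
  let ?Gs = "{H \<in> configs n k. e \<in> H \<and> H \<subseteq> M \<union> A \<and> card (H \<inter> M) + 1 = c}"
  have finG: "finite ?Gs" by (rule finite_subset[OF _ finite_configs[of n k]]) blast
  have r0: "0 \<le> \<delta> * live_bound l c * sc i ^ (k - 1 - c) / 16"
    using \<delta>0 live_bound_ge1[of l c] l4 sc_pos[of i] by simp
  show ?thesis
  proof (cases c)
    case 0
    then have "{H \<in> configs n k. e \<in> H \<and> H \<subseteq> M \<union> A \<and> card (H \<inter> M) + 1 = c \<and> added m \<inter> H \<noteq> {}} = {}" for m by auto
    then show ?thesis using r0 by (simp only: card.empty) simp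
  next
    case (Suc c')
    have GX: "?Gs = live_configs n k c' M A e" using Suc by (auto simp: live_configs_def)
    have "(\<Sum>m\<in>?K. pr m * real (card {H \<in> configs n k. e \<in> H \<and> H \<subseteq> M \<union> A \<and> card (H \<inter> M) + 1 = c \<and> added m \<inter> H \<noteq> {}}))
        = (\<Sum>m\<in>?K. pr m * real (card {H \<in> ?Gs. added m \<inter> H \<noteq> {}}))"
      by (simp add: conj_assoc)
    also have "\<dots> = (\<Sum>H\<in>?Gs. \<Sum>m\<in>{m \<in> ?K. added m \<inter> H \<noteq> {}}. pr m)"
      by (rule sum_card_swap) (use finG in auto)
    also have "\<dots> \<le> (\<Sum>H\<in>?Gs. real l * (\<delta> / Dm i))"
    proof (rule sum_mono)
      fix H assume "H \<in> ?Gs"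
      then have H: "H \<in> live_configs n k c' M A e" unfolding GX .
      have finH: "finite H" by (rule live_configs_card(2)[OF k(1) H e])
      have cH: "card H \<le> l" using configs_facts(2)[of H n k] H k by (simp add: live_configs_def)
      have "(\<Sum>m\<in>{m \<in> ?K. added m \<inter> H \<noteq> {}}. pr m) \<le> (\<Sum>m\<in>(\<Union>f\<in>H. {m \<in> moves A P. f \<in> added m}). pr m)"
        using finH pr_nonneg by (intro sum_mono2) auto
      also have "\<dots> \<le> (\<Sum>f\<in>H. \<Sum>m\<in>{m \<in> moves A P. f \<in> added m}. pr m)"
      proof -
        have "(\<Sum>m\<in>(\<Union>f\<in>H. {m \<in> moves A P. f \<in> added m}). pr m) = (\<Sum>f\<in>H. \<Sum>m\<in>{m \<in> moves A P. f \<in> added m}. pr m)"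
        proof (rule sum.UNION_disjoint)
          show "\<forall>f\<in>H. \<forall>f'\<in>H. f \<noteq> f' \<longrightarrow> {m \<in> moves A P. f \<in> added m} \<inter> {m \<in> moves A P. f' \<in> added m} = {}"
          proof (intro ballI impI equals0I)
            fix f f' m assume "f \<noteq> f'" "m \<in> {m \<in> moves A P. f \<in> added m} \<inter> {m \<in> moves A P. f' \<in> added m}"
            then show False by (cases m) simp_all
          qed
        qed (use finH in auto)
        then show ?thesis by simp
      qed
      also have "\<dots> \<le> (\<Sum>f\<in>H. \<delta> / Dm i)" by (intro sum_mono pr_added)
      also have "\<dots> = real (card H) * (\<delta> / Dm i)" by simp
      also have "\<dots> \<le> real l * (\<delta> / Dm i)" using cH \<delta>0 Dm_ge by (intro mult_right_mono) auto
      finally show "(\<Sum>m\<in>{m \<in> ?K. added m \<inter> H \<noteq> {}}. pr m) \<le> real l * (\<delta> / Dm i)" .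
    qed
    also have "\<dots> = real (card (live_configs n k c' M A e)) * (real l * (\<delta> / Dm i))" unfolding GX by simp
    also have "\<dots> \<le> (live_bound l c' * sc i ^ (k - 1 - c')) * (real l * (\<delta> / sc i))"
    proof (rule mult_mono)
      show "real (card (live_configs n k c' M A e)) \<le> live_bound l c' * sc i ^ (k - 1 - c')"
        using k c Suc e by (intro live_configs_le) auto
      have "\<delta> / Dm i \<le> \<delta> / sc i" using Dm_ge sc_pos[of i] \<delta>0 by (intro divide_left_mono mult_pos_pos) auto
      then show "real l * (\<delta> / Dm i) \<le> real l * (\<delta> / sc i)" by (intro mult_left_mono) auto
    qed (use live_bound_ge1[of l c'] l4 sc_pos[of i] \<delta>0 Dm_ge in auto)
    also have "k - 1 - c' = Suc (k - 1 - c)" using Suc c by simp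
    also have "(live_bound l c' * sc i ^ Suc (k - 1 - c)) * (real l * (\<delta> / sc i)) = \<delta> * live_bound l c * sc i ^ (k - 1 - c) / 16"
      using sc_pos[of i] by (simp add: Suc live_bound_Suc)
    finally show ?thesis .
  qed
qed

text \<open>The count is divided by \<open>sc i ^ q\<close>, which shrinks at rate about
  \<open>q a \<delta>\<close>, while configurations are lost at rate at least
  \<open>q (a + 1 / 2) \<delta>\<close>. The net outflow of at least \<open>\<delta> W / 2\<close>
  from the normalised count \<open>W\<close> competes with an inflow and a second-order term of at
  most \<open>\<delta> x / 8\<close> each.\<close>

lemma live_configs_drift:
  assumes k: "3 \<le> k" "k \<le> l" and c: "c + 2 \<le> k" and e: "e \<in> A"
  shows "(\<Sum>m\<in>{m \<in> moves A P. e \<notin> los m}. pr m *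
      exp (\<mu> * (g (Suc i) ^ (k - 1 - c) * real (card (live_configs n k c (M \<union> added m) (A - los m) e)) - live_bound l c)))
    \<le> exp (\<mu> * (g i ^ (k - 1 - c) * real (card (live_configs n k c M A e)) - live_bound l c)) + 2 * \<delta> * exp (- \<mu> / 4)"
proof -
  let ?K = "{m \<in> moves A P. e \<notin> los m}"
  define q where "q = k - 1 - c"
  define G where "G = g (Suc i) ^ q"
  define x where "x = live_bound l c"
  define X where "X = real (card (live_configs n k c M A e))"
  define gn where "gn m = real (card {H \<in> configs n k. e \<in> H \<and> H \<subseteq> M \<union> A \<and> card (H \<inter> M) + 1 = c \<and> added m \<inter> H \<noteq> {}})" for m
  define ls where "ls m = real (card {H \<in> live_configs n k c M A e. \<exists>f\<in>H \<inter> A - {e}. f \<in> los m})" for m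
  define J where "J = (real l + 4) * Y * real n ^ (q - 1)"
  define \<alpha> where "\<alpha> = \<delta> * x * sc i ^ q / 16"
  define \<beta> where "\<beta> = X * (real q * ((a + 1 / 2) * \<delta>))"
  define \<beta>' where "\<beta>' = X * (real q * ((a + 1) * \<delta>))"
  define W where "W = G * X"
  have q1: "1 \<le> q" "q \<le> l" and q2: "k - 2 - c = q - 1" using c k by (auto simp: q_def)
  have G0: "0 < G" using g_pos[of "Suc i"] by (simp add: G_def)
  have X0: "0 \<le> X" by (simp add: X_def)
  have x1: "1 \<le> x" using live_bound_ge1[of l c] l4 by (simp add: x_def)
  have J0: "0 \<le> J" using Y1 by (simp add: J_def)
  have gsc: "g i ^ q * sc i ^ q = 1" using g_sc[of i] by (metis power_mult_distrib power_one)
  have G2: "G \<le> 2 * g i ^ q" using g_Suc_le(2)[OF q1(2)] by (simp add: G_def)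
  have gqX: "g i ^ q * X \<le> x"
  proof -
    have "g i ^ q * X \<le> g i ^ q * (x * sc i ^ q)"
      using live_configs_le[OF k c e] g_pos[of i] by (intro mult_left_mono) (auto simp: X_def x_def q_def)
    also have "\<dots> = x * (g i ^ q * sc i ^ q)" by simp
    finally show ?thesis using gsc by simp
  qed
  have W0: "0 \<le> W" using G0 X0 by (simp add: W_def)
  have W2: "W \<le> 2 * x"
  proof -
    have "W \<le> (2 * g i ^ q) * X" unfolding W_def using G2 X0 by (intro mult_right_mono)
    then show ?thesis using gqX by simp
  qed
  have gW: "g i ^ q * X \<le> W" "W \<le> g i ^ q * X + real q * (a * \<delta>) * W"
  proof -
    show "g i ^ q * X \<le> W" unfolding W_def G_def using g_Suc_le(3)[OF q1(2)] X0 by (intro mult_right_mono)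
    have "(G * (1 - real q * (a * \<delta>))) * X \<le> g i ^ q * X"
      unfolding G_def using g_Suc_le(1)[OF q1(2)] X0 by (intro mult_right_mono)
    then show "W \<le> g i ^ q * X + real q * (a * \<delta>) * W" by (simp add: W_def algebra_simps)
  qed
  have GJ: "G * J \<le> J1"
  proof -
    have "G * J \<le> (2 * g i ^ q) * J" using G2 J0 by (intro mult_right_mono)
    also have "\<dots> = 2 * ((real l + 4) * Y) * (g i ^ q * real n ^ (q - 1))" by (simp add: J_def)
    also have "\<dots> \<le> 2 * ((real l + 4) * Y) * (1 / (n * \<theta> ^ l))"
      using g_power_n[of i q] iN q1 Y1 by (intro mult_left_mono) auto
    also have "\<dots> = J1" by (simp add: J1_def)
    finally show ?thesis .
  qed
  have \<mu>GJ: "\<mu> * G * J \<le> 1"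
  proof -
    have "\<mu> * (G * J) \<le> \<mu> * J1" using GJ \<mu>0 by (intro mult_left_mono) auto
    then show ?thesis using \<mu>J1(2) by (simp add: mult.assoc)
  qed
  have nq: "(1::real) \<le> real n ^ (q - 1)" using n0 by simp
  have gnJ: "0 \<le> gn m \<and> gn m \<le> J" if "m \<in> ?K" for m
  proof -
    have "gn m \<le> real n ^ (q - 1) * Y"
      using gain_jump[OF k c e, of m, unfolded q2] that by (simp add: gn_def)
    also have "\<dots> \<le> (real l + 4) * (real n ^ (q - 1) * Y)"
      using Y1 mult_right_mono[of 1 "real l + 4" "real n ^ (q - 1) * Y"] by simp
    also have "\<dots> = J" by (simp add: J_def)
    finally show ?thesis by (simp add: gn_def)
  qed
  have lsJ: "0 \<le> ls m \<and> ls m \<le> J" if "m \<in> ?K" for m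
    using loss_jump[OF k c e, of m, unfolded q2] that by (simp add: ls_def J_def)
  have finX: "finite (live_configs n k c M A e)" by simp
  have Els: "(\<Sum>m\<in>?K. pr m * ls m) = (\<Sum>H\<in>live_configs n k c M A e. \<Sum>m\<in>{m \<in> ?K. \<exists>f\<in>H \<inter> A - {e}. f \<in> los m}. pr m)"
    unfolding ls_def by (rule sum_card_swap) auto
  have \<beta>1: "\<beta> \<le> (\<Sum>m\<in>?K. pr m * ls m)"
  proof -
    have "\<beta> = (\<Sum>H\<in>live_configs n k c M A e. real q * ((a + 1 / 2) * \<delta>))" by (simp add: \<beta>_def X_def)
    also have "\<dots> \<le> (\<Sum>H\<in>live_configs n k c M A e. \<Sum>m\<in>{m \<in> ?K. \<exists>f\<in>H \<inter> A - {e}. f \<in> los m}. pr m)"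
    proof (rule sum_mono)
      fix H assume H: "H \<in> live_configs n k c M A e"
      have "{m \<in> ?K. \<exists>f\<in>H \<inter> A - {e}. f \<in> los m} = {m \<in> moves A P. e \<notin> los m \<and> (\<exists>f\<in>H \<inter> A - {e}. f \<in> los m)}"
        by blast
      then show "real q * ((a + 1 / 2) * \<delta>) \<le> (\<Sum>m\<in>{m \<in> ?K. \<exists>f\<in>H \<inter> A - {e}. f \<in> los m}. pr m)"
        using loss_probability_ge[OF k c e H] by (simp only: q_def)
    qed
    finally show ?thesis using Els by simp
  qed
  have \<beta>2: "(\<Sum>m\<in>?K. pr m * ls m) \<le> \<beta>'"
  proof -
    have "(\<Sum>m\<in>{m \<in> ?K. \<exists>f\<in>H \<inter> A - {e}. f \<in> los m}. pr m) \<le> real q * ((a + 1) * \<delta>)"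
      if H: "H \<in> live_configs n k c M A e" for H
    proof -
      have finH: "finite (H \<inter> A - {e})" and cH: "card (H \<inter> A - {e}) = q" using live_configs_card[OF k(1) H e] by (auto simp: q_def)
      have "(\<Sum>m\<in>{m \<in> ?K. \<exists>f\<in>H \<inter> A - {e}. f \<in> los m}. pr m)
          \<le> (\<Sum>m\<in>moves A P. pr m * (\<Sum>f\<in>H \<inter> A - {e}. of_bool (f \<in> los m)))"
      proof -
        have "(\<Sum>m\<in>{m \<in> ?K. \<exists>f\<in>H \<inter> A - {e}. f \<in> los m}. pr m)
            \<le> (\<Sum>m\<in>{m \<in> moves A P. \<exists>f\<in>H \<inter> A - {e}. f \<in> los m}. pr m)"
          using pr_nonneg by (intro sum_mono2) auto
        also have "\<dots> \<le> (\<Sum>m\<in>moves A P. pr m * (\<Sum>f\<in>H \<inter> A - {e}. of_bool (f \<in> los m)))"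
          unfolding sum_pr_filter
        proof (intro sum_mono mult_left_mono pr_nonneg)
          fix m
          show "(of_bool (\<exists>f\<in>H \<inter> A - {e}. f \<in> los m) :: real) \<le> (\<Sum>f\<in>H \<inter> A - {e}. of_bool (f \<in> los m))"
          proof (cases "\<exists>f\<in>H \<inter> A - {e}. f \<in> los m")
            case True
            then obtain f where f: "f \<in> H \<inter> A - {e}" "f \<in> los m" by blast
            have "(of_bool (f \<in> los m) :: real) \<le> (\<Sum>f\<in>H \<inter> A - {e}. of_bool (f \<in> los m))"
              by (rule member_le_sum[OF f(1)]) (use finH in auto)
            then show ?thesis using f True by simp
          next
            case False
            then have "(of_bool (\<exists>f\<in>H \<inter> A - {e}. f \<in> los m) :: real) = 0" by (simp only: of_bool_eq)
            also have "0 \<le> (\<Sum>f\<in>H \<inter> A - {e}. of_bool (f \<in> los m) :: real)" by (intro sum_nonneg) simp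
            finally show ?thesis .
          qed
        qed
        finally show ?thesis .
      qed
      also have "\<dots> = (\<Sum>f\<in>H \<inter> A - {e}. \<Sum>m\<in>moves A P. pr m * of_bool (f \<in> los m))"
        unfolding sum_distrib_left by (rule sum.swap)
      also have "\<dots> = (\<Sum>f\<in>H \<inter> A - {e}. (a + 1) * \<delta>)"
        using pr_lost by (intro sum.cong refl) (simp add: sum_pr_filter[symmetric] a_def)
      finally show ?thesis using cH by simp
    qed
    then have "(\<Sum>m\<in>?K. pr m * ls m) \<le> (\<Sum>H\<in>live_configs n k c M A e. real q * ((a + 1) * \<delta>))"
      unfolding Els by (intro sum_mono)
    then show ?thesis by (simp add: \<beta>'_def X_def)
  qed
  have \<alpha>1: "(\<Sum>m\<in>?K. pr m * gn m) \<le> \<alpha>"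
    using gain_expectation_le[OF k c e] by (simp only: gn_def \<alpha>_def x_def q_def)
  have "(\<Sum>m\<in>?K. pr m * exp (\<mu> * (G * real (card (live_configs n k c (M \<union> added m) (A - los m) e)) - x)))
      \<le> exp (\<mu> * (G * X - x) + \<mu> * G * (\<alpha> - \<beta>) + (\<mu> * G)\<^sup>2 * J * (\<alpha> + \<beta>'))"
  proof (rule weighted_exp_drift[where gn = gn and ls = ls])
    fix m assume m: "m \<in> ?K"
    show "0 \<le> pr m" using m pr_nonneg by simp
    show "real (card (live_configs n k c (M \<union> added m) (A - los m) e)) \<le> X + gn m - ls m"
      using live_configs_next_card_le[OF k(1) e] m by (simp add: X_def gn_def ls_def)
  qed (use gnJ lsJ \<alpha>1 \<beta>1 \<beta>2 \<mu>0 G0 \<mu>GJ J0 sum_pr_sub_le in auto)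
  also have "\<dots> \<le> exp (\<mu> * (g i ^ q * X - x) + \<mu> * \<delta> * (x / 4 - W / 2))"
  proof -
    have G\<alpha>: "G * \<alpha> \<le> \<delta> * x / 8"
    proof -
      have "G * \<alpha> \<le> (2 * g i ^ q) * \<alpha>" using G2 \<delta>0 x1 sc_pos[of i] by (intro mult_right_mono) (auto simp: \<alpha>_def)
      also have "\<dots> = \<delta> * x / 8 * (g i ^ q * sc i ^ q)" by (simp add: \<alpha>_def)
      finally show ?thesis using gsc by simp
    qed
    have G\<beta>: "G * \<beta> = W * (real q * ((a + 1 / 2) * \<delta>))" "G * \<beta>' = W * (real q * ((a + 1) * \<delta>))"
      by (simp_all add: \<beta>_def \<beta>'_def W_def)
    \<comment> \<open>The constant 32 in \<open>jump\<close> is what reduces the second-order term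
      to \<open>\<delta> x / 8\<close>.\<close>
    have sec: "(\<mu> * G)\<^sup>2 * J * (\<alpha> + \<beta>') \<le> \<mu> * \<delta> * (x / 8)"
    proof -
      have \<beta>'le: "G * \<beta>' \<le> 2 * x * (real l * ((a + 1) * \<delta>))"
        unfolding G\<beta> using W2 W0 q1 a2 \<delta>0 x1 by (intro mult_mono mult_right_mono mult_nonneg_nonneg) auto
      have "1 / 8 \<le> 2 * (real l * (a + 1))"
      proof -
        have "1 * 1 \<le> real l * (a + 1)" using l4 a2 by (intro mult_mono) auto
        then show ?thesis by simp
      qed
      then have "\<delta> * x * (1 / 8) \<le> \<delta> * x * (2 * (real l * (a + 1)))" using \<delta>0 x1 by (intro mult_left_mono) auto
      then have s: "G * \<alpha> + G * \<beta>' \<le> \<delta> * x * (4 * (real l * (a + 1)))"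
        using G\<alpha> \<beta>'le by (simp add: algebra_simps)
      have s0: "0 \<le> G * \<alpha> + G * \<beta>'"
        using G0 \<delta>0 x1 sc_pos[of i] X0 a2 by (auto simp: \<alpha>_def \<beta>'_def intro!: add_nonneg_nonneg mult_nonneg_nonneg)
      have "(\<mu> * G)\<^sup>2 * J * (\<alpha> + \<beta>') = \<mu> * ((\<mu> * (G * J)) * (G * \<alpha> + G * \<beta>'))"
        by (simp add: power2_eq_square algebra_simps)
      also have "\<dots> \<le> \<mu> * ((\<mu> * J1) * (\<delta> * x * (4 * (real l * (a + 1)))))"
        using s s0 GJ \<mu>0 G0 J0 J1_pos by (intro mult_left_mono mult_mono) auto
      also have "\<dots> = \<mu> * (\<delta> * x) / 8 * (32 * real l * (a + 1) * (\<mu> * J1))" by (simp add: algebra_simps)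
      also have "\<dots> \<le> \<mu> * (\<delta> * x) / 8 * 1"
        using \<mu>J1(1) \<mu>0 \<delta>0 x1 by (intro mult_left_mono) (auto simp: a_def add.commute add.assoc)
      finally show ?thesis by simp
    qed
    have main: "G * X + G * \<alpha> - G * \<beta> \<le> g i ^ q * X + \<delta> * (x / 8 - W / 2)"
    proof -
      have "G * X + G * \<alpha> - G * \<beta> \<le> g i ^ q * X + real q * (a * \<delta>) * W + \<delta> * x / 8 - W * (real q * ((a + 1 / 2) * \<delta>))"
        using gW(2) G\<alpha> G\<beta>(1) unfolding W_def by linarith
      also have "\<dots> = g i ^ q * X + \<delta> * (x / 8) - \<delta> * W / 2 * real q" by (simp add: algebra_simps)
      also have "\<dots> \<le> g i ^ q * X + \<delta> * (x / 8) - \<delta> * W / 2 * 1"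
        using q1 \<delta>0 W0 by (intro diff_left_mono mult_left_mono) auto
      finally show ?thesis by (simp add: algebra_simps)
    qed
    have "\<mu> * (G * X - x) + \<mu> * G * (\<alpha> - \<beta>) = \<mu> * ((G * X + G * \<alpha> - G * \<beta>) - x)" by (simp add: algebra_simps)
    also have "\<dots> \<le> \<mu> * ((g i ^ q * X + \<delta> * (x / 8 - W / 2)) - x)"
      using main \<mu>0 by (intro mult_left_mono) auto
    finally show ?thesis using sec by (simp add: algebra_simps)
  qed
  \<comment> \<open>Triples of \<open>A\<close> disappear at rate \<open>a + 1\<close> but are normalised with rate \<open>a\<close>, so the drift is negative
    unless the count is below half of its bound, where the exponential is negligible.\<close>
  also have "\<dots> \<le> exp (\<mu> * (g i ^ q * X - x)) + 2 * \<delta> * exp (- \<mu> / 4)"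
  proof (cases "x / 2 \<le> W")
    case True
    then have "\<mu> * \<delta> * (x / 4 - W / 2) \<le> 0" using \<mu>0 \<delta>0 by (intro mult_nonneg_nonpos) auto
    then have "exp (\<mu> * (g i ^ q * X - x) + \<mu> * \<delta> * (x / 4 - W / 2)) \<le> exp (\<mu> * (g i ^ q * X - x))" by simp
    also have "\<dots> \<le> exp (\<mu> * (g i ^ q * X - x)) + 2 * \<delta> * exp (- \<mu> / 4)" using \<delta>0 by simp
    finally show ?thesis .
  next
    case False
    define t where "t = \<mu> * \<delta> * x / 4"
    have t0: "0 \<le> t" using \<mu>0 \<delta>0 x1 by (simp add: t_def)
    have "x \<le> live_bound l l" unfolding x_def using k c l4 by (intro live_bound_mono) auto
    then have "\<mu> * \<delta> * x \<le> \<mu> * \<delta> * live_bound l l" using \<mu>0 \<delta>0 by (intro mult_left_mono) auto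
    then have t1: "t \<le> 1" using low by (simp add: t_def)
    have "\<mu> * \<delta> * (x / 4 - W / 2) \<le> \<mu> * \<delta> * (x / 4)" using \<mu>0 \<delta>0 W0 by (intro mult_left_mono) auto
    then have "exp (\<mu> * (g i ^ q * X - x) + \<mu> * \<delta> * (x / 4 - W / 2)) \<le> exp (\<mu> * (g i ^ q * X - x) + t)" by (simp add: t_def)
    also have "\<dots> \<le> exp (\<mu> * (g i ^ q * X - x)) * (1 + 2 * t)" by (rule exp_add_small_le[OF t0 t1])
    also have "\<dots> = exp (\<mu> * (g i ^ q * X - x)) + exp (\<mu> * (g i ^ q * X - x)) * (2 * t)" by (simp add: algebra_simps)
    also have "exp (\<mu> * (g i ^ q * X - x)) * (2 * t) \<le> 2 * \<delta> * exp (- \<mu> / 4)"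
    proof -
      have "\<mu> * (g i ^ q * X - x) \<le> \<mu> * (- (x / 2))" using False gW(1) \<mu>0 by (intro mult_left_mono) auto
      \<comment> \<open>The exponent is at most \<open>- \<mu> x / 2\<close>; one half of it absorbs
        the factor \<open>\<mu> x / 4\<close> inside \<open>t\<close>, the other half gives the
        claimed bound.\<close>
      then have "exp (\<mu> * (g i ^ q * X - x)) \<le> exp (- (\<mu> * x / 4) - \<mu> * x / 4)" by simp
      then have "exp (\<mu> * (g i ^ q * X - x)) * (2 * t) \<le> exp (- (\<mu> * x / 4) - \<mu> * x / 4) * (2 * t)"
        using t0 by (intro mult_right_mono) auto
      also have "\<dots> = (2 * \<delta>) * exp (- (\<mu> * x / 4)) * ((\<mu> * x / 4) * exp (- (\<mu> * x / 4)))"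
      proof -
        have "exp (- (\<mu> * x / 4) - \<mu> * x / 4) = exp (- (\<mu> * x / 4)) * exp (- (\<mu> * x / 4))"
          by (simp only: exp_add[symmetric] diff_conv_add_uminus)
        then show ?thesis by (simp only: t_def) (simp add: mult_ac)
      qed
      also have "\<dots> \<le> (2 * \<delta>) * exp (- \<mu> / 4) * 1"
      proof (intro mult_mono mult_left_mono)
        have "\<mu> * 1 \<le> \<mu> * x" using x1 \<mu>0 by (intro mult_left_mono) auto
        then show "exp (- (\<mu> * x / 4)) \<le> exp (- \<mu> / 4)" by simp
        have "\<mu> * x / 4 \<le> exp (\<mu> * x / 4)" using exp_ge_add_one_self[of "\<mu> * x / 4"] by linarith
        then show "(\<mu> * x / 4) * exp (- (\<mu> * x / 4)) \<le> 1" by (simp add: exp_minus field_simps)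
      qed (use \<delta>0 \<mu>0 x1 in auto)
      finally show ?thesis by simp
    qed
    finally show ?thesis by simp
  qed
  finally show ?thesis by (simp only: G_def X_def x_def q_def)
qed

end

section \<open>The potential\<close>

text \<open>Objects removed by a move drop out of the potential, so each object has to be followed
  only over the moves that keep it.\<close>

lemma sum_kept_swap:
  fixes w :: "'m \<Rightarrow> real"
  assumes "finite Q" "finite S"
  shows "(\<Sum>m\<in>Q. w m * (\<Sum>x\<in>S - R m. h x m)) = (\<Sum>x\<in>S. \<Sum>m\<in>{m \<in> Q. x \<notin> R m}. w m * h x m)"
proof -
  have "(\<Sum>x\<in>S - R m. h x m) = (\<Sum>x\<in>S. if x \<notin> R m then h x m else 0)" for m
    using assms(2) by (simp add: sum.inter_filter[symmetric] set_diff_eq)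
  then have "(\<Sum>m\<in>Q. w m * (\<Sum>x\<in>S - R m. h x m)) = (\<Sum>m\<in>Q. \<Sum>x\<in>S. if x \<notin> R m then w m * h x m else 0)"
    by (intro sum.cong refl) (simp add: sum_distrib_left if_distrib cong: if_cong)
  also have "\<dots> = (\<Sum>x\<in>S. \<Sum>m\<in>Q. if x \<notin> R m then w m * h x m else 0)" by (rule sum.swap)
  finally show ?thesis using assms(1) by (simp add: sum.inter_filter)
qed

text \<open>An instance of the structure count with no chosen triples: the root \<open>e\<close>
  fixes 3 of the \<open>k + 2\<close> points, leaving \<open>k - 1\<close> free ones.\<close>

lemma card_configs_containing_le:
  assumes k: "3 \<le> k" "k \<le> l" and n: "0 < n"
  shows "real (card {H \<in> configs n k. e \<in> H}) \<le> st_const (2 * l + 4) * real n ^ (k - 1)"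
proof -
  let ?F = "(\<lambda>H. (H, e, {}, {}) :: struct) ` {H \<in> configs n k. e \<in> H}"
  have "(\<Sum>x\<in>{x \<in> ?F. {} \<subseteq> st_chosen x}. (1 / n) ^ card (st_chosen x - {}))
      \<le> st_const (2 * l + 4) * real n ^ (k - 1) * 1 ^ 0"
  proof (rule sum_structs_le[where R = e])
    fix H f T G assume "(H, f, T, G) \<in> ?F"
    then have H: "H \<in> configs n k" "e \<in> H" and f: "f = e" "T = {}" "G = {}" by auto
    note Hf = configs_facts[OF H(1) k(1)]
    show "f \<in> H \<and> T \<subseteq> H \<union> G \<and> \<Union>H \<union> \<Union>G \<subseteq> {..<n} \<and> card (\<Union>H \<union> \<Union>G) \<le> 2 * l + 4 \<and>
        card T \<le> 0 \<and> finite T \<and> e \<subseteq> \<Union>H \<union> \<Union>G"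
    proof -
      have "e \<subseteq> \<Union>H" using H by blast
      then show ?thesis using H f Hf k configs_Union_subset[OF H(1)] by simp
    qed
    fix J assume "J \<subseteq> T"
    then have "J = {}" using f by simp
    moreover have "card e = 3" using Hf(1) H unfolding config_def by blast
    ultimately show "card (\<Union>H \<union> \<Union>G) \<le> card (e \<union> \<Union>J) + (k - 1) + card (T - J)"
      using f Hf k by simp
  qed (use n in auto)
  moreover have "(\<Sum>x\<in>{x \<in> ?F. {} \<subseteq> st_chosen x}. (1 / n) ^ card (st_chosen x - {})) = (\<Sum>x\<in>?F. 1)"
    by (rule sum.cong) (auto simp: st_chosen_def)
  moreover have "card ?F = card {H \<in> configs n k. e \<in> H}" by (intro card_image) (auto simp: inj_on_def)
  ultimately show ?thesis by simp
qed

lemma deg_triples: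
  assumes "p \<in> pairs n"
  shows "n \<le> deg (triples n) p + 2" "deg (triples n) p \<le> n"
proof -
  note pf = pairs_facts[OF assms]
  have "(\<lambda>w. insert w p) ` ({..<n} - p) \<subseteq> {f \<in> triples n. p \<subseteq> f}"
    using pf by (auto simp: triples_def)
  then have "card ((\<lambda>w. insert w p) ` ({..<n} - p)) \<le> deg (triples n) p"
    unfolding deg_def by (intro card_mono) auto
  moreover have "inj_on (\<lambda>w. insert w p) ({..<n} - p)" by (auto simp: inj_on_def)
  then have "card ((\<lambda>w. insert w p) ` ({..<n} - p)) = card ({..<n} - p)" by (rule card_image)
  moreover have "card ({..<n} - p) = n - 2" using pf by (simp add: card_Diff_subset)
  ultimately show "n \<le> deg (triples n) p + 2" by simp
  have "{f \<in> triples n. p \<subseteq> f} = {W. p \<subseteq> W \<and> W \<subseteq> {..<n} \<and> card W = 3}" by (auto simp: triples_def)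
  then show "deg (triples n) p \<le> n"
    using card_supersets_le[of "{..<n}" p 3] pf by (simp add: deg_def)
qed

context girth_params
begin

text \<open>Upper bound for the probability that a given triple is still added in the remaining
  \<open>N - i\<close> steps, each contributing at most
  \<open>\<delta> / (n \<theta>)\<close>.\<close>

definition rad :: "nat \<Rightarrow> real" where "rad i = real (N - i) * (\<delta> / (n * \<theta>))"

definition pot_deg :: "nat \<Rightarrow> nat set set \<Rightarrow> nat set set \<Rightarrow> real" where
  "pot_deg i A P = (\<Sum>p\<in>P. exp (\<mu> * (g i * real (deg A p) - (1 + \<epsilon>))) + exp (\<mu> * (g i * - real (deg A p) - (\<epsilon> - 1))))"

definition pot_live :: "nat \<Rightarrow> nat set set \<Rightarrow> nat set set \<Rightarrow> real" where
  "pot_live i M A = (\<Sum>k\<in>{3..l}. \<Sum>c\<in>{..k - 2}. \<Sum>e\<in>A. exp (\<mu> * (g i ^ (k - 1 - c) * real (card (live_configs n k c M A e)) - live_bound l c)))"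

definition pot_moment :: "nat \<Rightarrow> nat set set \<Rightarrow> real" where
  "pot_moment i M = (\<Sum>(F, v)\<in>fams n l. moment_weight st_chosen F (rad i) M s {} / (real n ^ v * Y) ^ s)"

definition pot_cov :: "nat \<Rightarrow> nat set set \<Rightarrow> real" where
  "pot_cov i P = real (card P) / ((1 - \<delta>) ^ i * (4 * real n ^ 2))"

text \<open>The first three terms give the number of pairs discarded so far. The extra
  \<open>4 \<epsilon> card P\<close> is a reserve: in one step it falls on average by
  \<open>4 \<epsilon> \<delta> card P\<close>, which exceeds the bound
  \<open>2 \<epsilon> \<delta> card P\<close> for the expected new waste.\<close>

definition pot_waste :: "nat set set \<Rightarrow> nat set set \<Rightarrow> real" where
  "pot_waste M P = (real (n choose 2) - 3 * real (card M) - real (card P) + 4 * \<epsilon> * real (card P)) / (16 * \<epsilon> * real n ^ 2)"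

definition pot :: "nat \<Rightarrow> nat set set \<Rightarrow> nat set set \<Rightarrow> nat set set \<Rightarrow> real" where
  "pot i M A P = pot_deg i A P + pot_live i M A + pot_moment i M + pot_cov i P + pot_waste M P"

text \<open>Growth of the potential per unit of \<open>\<delta>\<close>: the second-order term of
  the degrees and the additive errors of at most \<open>l l n ^ 3\<close> configuration
  counts.\<close>

definition \<omega> :: real where
  "\<omega> = 8 * a * \<mu>\<^sup>2 * J1 + real l * real l * real n ^ 3 * (2 * exp (- \<mu> / 4))"

lemma rad_nonneg: "0 \<le> rad i" using \<delta>0 \<theta>0 by (simp add: rad_def)

lemma \<delta>1: "\<delta> < 1"
proof -
  have "2 * \<delta> \<le> a * \<delta>" using a2 \<delta>0 by (intro mult_right_mono) auto
  then show ?thesis using a\<delta> by simp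
qed

lemma pot_nonneg:
  assumes "3 * card M + card P \<le> n choose 2"
  shows "0 \<le> pot_deg i A P" "0 \<le> pot_live i M A" "0 \<le> pot_moment i M" "0 \<le> pot_cov i P" "0 \<le> pot_waste M P"
proof -
  show "0 \<le> pot_deg i A P" unfolding pot_deg_def by (intro sum_nonneg add_nonneg_nonneg) auto
  show "0 \<le> pot_live i M A" unfolding pot_live_def by (intro sum_nonneg) auto
  show "0 \<le> pot_moment i M" unfolding pot_moment_def using Y1 rad_nonneg
    by (intro sum_nonneg) (auto intro!: divide_nonneg_nonneg moment_weight_nonneg)
  show "0 \<le> pot_cov i P" unfolding pot_cov_def using \<delta>1 by simp
  have "0 \<le> real (n choose 2) - 3 * real (card M) - real (card P)" using assms by linarith
  then show "0 \<le> pot_waste M P" unfolding pot_waste_def using \<epsilon>0 by simp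
qed

text \<open>All terms are nonnegative, so every single summand is at most 1: an exponential at most
  1 has a nonpositive exponent, and a normalised \<open>s\<close>-th moment at most 1 bounds the
  count itself.\<close>

lemma good_state_of_pot:
  assumes v: "valid_state n l M A P" and U: "3 * card M + card P \<le> n choose 2" and iN: "i < N" and s0: "0 < s"
    and pot: "pot i M A P \<le> 1"
  shows "good_state n l N \<delta> \<epsilon> \<mu> Y \<theta> i M A P"
proof unfold_locales
  note nn = pot_nonneg[OF U]
  have finP: "finite P" and finA: "finite A"
    using valid_stateD(2,3)[OF v] finite_subset[OF _ finite_triples] finite_subset[OF _ finite_pairs] by blast+
  have pd: "pot_deg i A P \<le> 1" "pot_live i M A \<le> 1" "pot_moment i M \<le> 1"
    using pot nn(1)[of i A] nn(2)[of i A] nn(3)[of i] nn(4)[of i] nn(5) by (auto simp: pot_def)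
  show "valid_state n l M A P" "i < N" by fact+
  fix p assume p: "p \<in> P"
  have "exp (\<mu> * (g i * real (deg A p) - (1 + \<epsilon>))) + exp (\<mu> * (g i * - real (deg A p) - (\<epsilon> - 1))) \<le> pot_deg i A P"
    unfolding pot_deg_def using p finP by (intro member_le_sum) (auto intro: add_nonneg_nonneg)
  moreover have "0 < exp (\<mu> * (g i * real (deg A p) - (1 + \<epsilon>)))" "0 < exp (\<mu> * (g i * - real (deg A p) - (\<epsilon> - 1)))" by auto
  ultimately have "exp (\<mu> * (g i * real (deg A p) - (1 + \<epsilon>))) \<le> 1" "exp (\<mu> * (g i * - real (deg A p) - (\<epsilon> - 1))) \<le> 1"
    using pd by linarith+
  then have "g i * real (deg A p) - (1 + \<epsilon>) \<le> 0" "g i * - real (deg A p) - (\<epsilon> - 1) \<le> 0"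
    using \<mu>0 by (simp_all add: mult_le_0_iff)
  then have *: "real (deg A p) / sc i \<le> 1 + \<epsilon>" "1 - \<epsilon> \<le> real (deg A p) / sc i" by (simp_all add: g_def)
  show "real (deg A p) \<le> (1 + \<epsilon>) * sc i" "(1 - \<epsilon>) * sc i \<le> real (deg A p)"
    using * sc_pos[of i] by (simp_all add: divide_le_eq le_divide_eq)
next
  note nn = pot_nonneg[OF U]
  have finA: "finite A" using valid_stateD(2)[OF v] by (rule finite_subset) simp
  have pd: "pot_live i M A \<le> 1" using pot nn(1)[of i A] nn(2)[of i A] nn(3)[of i] nn(4)[of i] nn(5) by (auto simp: pot_def)
  fix k c e assume k: "3 \<le> k" "k \<le> l" "c + 2 \<le> k" and e: "e \<in> A"
  let ?E = "\<lambda>k c e. exp (\<mu> * (g i ^ (k - 1 - c) * real (card (live_configs n k c M A e)) - live_bound l c))"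
  have "?E k c e \<le> (\<Sum>e\<in>A. ?E k c e)" using e finA by (intro member_le_sum) auto
  also have "\<dots> \<le> (\<Sum>c\<in>{..k - 2}. \<Sum>e\<in>A. ?E k c e)"
    using k by (intro member_le_sum[where f = "\<lambda>c. \<Sum>e\<in>A. ?E k c e"]) (auto intro: sum_nonneg)
  also have "\<dots> \<le> pot_live i M A"
    unfolding pot_live_def using k
    by (intro member_le_sum[where f = "\<lambda>k. \<Sum>c\<in>{..k - 2}. \<Sum>e\<in>A. ?E k c e"]) (auto intro!: sum_nonneg)
  finally have "?E k c e \<le> pot_live i M A" .
  then have "?E k c e \<le> 1" using pd by linarith
  then have "g i ^ (k - 1 - c) * real (card (live_configs n k c M A e)) - live_bound l c \<le> 0"
    using \<mu>0 by (simp add: mult_le_0_iff)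
  then have "real (card (live_configs n k c M A e)) / sc i ^ (k - 1 - c) \<le> live_bound l c"
    by (simp add: g_def power_one_over divide_inverse mult.commute power_inverse)
  then show "real (card (live_configs n k c M A e)) \<le> live_bound l c * sc i ^ (k - 1 - c)"
    using sc_pos[of i] by (simp add: divide_le_eq)
next
  note nn = pot_nonneg[OF U]
  have pd: "pot_moment i M \<le> 1" using pot nn(1)[of i A] nn(2)[of i A] nn(3)[of i] nn(4)[of i] nn(5) by (auto simp: pot_def)
  fix F v assume F: "(F, v) \<in> fams n l"
  let ?w = "\<lambda>(F, v). moment_weight st_chosen F (rad i) M s {} / (real n ^ v * Y) ^ s"
  have "?w (F, v) \<le> pot_moment i M"
    unfolding pot_moment_def using F finite_fams Y1 rad_nonneg
    by (intro member_le_sum[where f = ?w]) (auto intro!: divide_nonneg_nonneg moment_weight_nonneg)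
  then have "moment_weight st_chosen F (rad i) M s {} / (real n ^ v * Y) ^ s \<le> 1" using pd by simp
  then have "moment_weight st_chosen F (rad i) M s {} \<le> (real n ^ v * Y) ^ s"
    using n0 Y1 by (simp add: divide_le_eq split: if_splits)
  moreover have "real (card {x \<in> F. st_chosen x \<subseteq> M}) ^ s \<le> moment_weight st_chosen F (rad i) M s {}"
    using fams_facts(1)[OF F] rad_nonneg by (intro card_power_le_moment_weight) auto
  ultimately have "real (card {x \<in> F. st_chosen x \<subseteq> M}) ^ s \<le> (real n ^ v * Y) ^ s" by simp
  then show "real (card {x \<in> F. st_chosen x \<subseteq> M}) \<le> real n ^ v * Y"
    using s0 Y1 power_mono_iff[of "real (card {x \<in> F. st_chosen x \<subseteq> M})" "real n ^ v * Y" s] by simp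
qed

end

section \<open>Mean change of each term of the potential\<close>

context good_state
begin

definition wasted :: "move \<Rightarrow> nat" where
  "wasted m = (case m of Waste p \<Rightarrow> 1 | _ \<Rightarrow> 0)"

text \<open>An added triple consumes exactly three pairs because all pairs of a triple of
  \<open>A\<close> are still uncovered; only \<open>Waste\<close> breaks the balance.\<close>

lemma card_step:
  assumes m: "m \<in> moves A P"
  shows "3 * card (M \<union> added m) + card (P - gone P m) + wasted m = 3 * card M + card P"
proof (cases m)
  case (Add e)
  then have e: "e \<in> A" using m by (auto simp: moves_def)
  then have "e \<notin> M" using MA by blast
  then have "card (M \<union> added m) = card M + 1" using Add by simp
  moreover have "gone P m = {p \<in> P. p \<subseteq> e}" using Add by simp
  then have "card (P - gone P m) = card P - 3" "3 \<le> card P"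
    using card_Pf[OF e] card_mono[of P "{p \<in> P. p \<subseteq> e}"] by (auto simp: card_Diff_subset)
  ultimately show ?thesis by (simp add: wasted_def Add)
next
  case (Waste p)
  then have p: "p \<in> P" using m by (auto simp: moves_def)
  then have "gone P m = {p}" using Waste by simp
  moreover have "Suc (card (P - {p})) = card P" using p by (intro card_Suc_Diff1) auto
  ultimately show ?thesis using Waste by (simp add: wasted_def)
qed (simp_all add: wasted_def)

lemma gone_subset: "gone P m \<subseteq> P" by (cases m) auto

lemma cov_expectation: "(\<Sum>m\<in>moves A P. pr m * real (card (P - gone P m))) = (1 - \<delta>) * real (card P)"
proof -
  have c: "real (card (P - gone P m)) = real (card P) - real (card {p \<in> P. p \<in> gone P m})" for m
  proof -
    have "{p \<in> P. p \<in> gone P m} = gone P m" using gone_subset by blast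
    moreover have "card (gone P m) \<le> card P" using gone_subset by (intro card_mono) auto
    moreover have "finite (gone P m)" using gone_subset finite_subset by (metis finite_state(2))
    ultimately show ?thesis using gone_subset[of m] by (simp add: card_Diff_subset)
  qed
  have "(\<Sum>m\<in>moves A P. pr m * real (card {p \<in> P. p \<in> gone P m})) = (\<Sum>p\<in>P. \<Sum>m\<in>{m \<in> moves A P. p \<in> gone P m}. pr m)"
    by (rule sum_card_swap) auto
  also have "\<dots> = (\<Sum>p\<in>P. \<delta>)" using pr_gone by (intro sum.cong) auto
  finally have "(\<Sum>m\<in>moves A P. pr m * real (card {p \<in> P. p \<in> gone P m})) = real (card P) * \<delta>" by simp
  moreover have "(\<Sum>m\<in>moves A P. pr m * real (card P)) = real (card P)"
    using sum_pr by (simp only: sum_distrib_right[symmetric] mult_1)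
  ultimately show ?thesis unfolding c right_diff_distrib sum_subtractf by (simp add: algebra_simps)
qed

text \<open>All degrees lie within \<open>2 \<epsilon> sc i\<close> of the weight
  \<open>Dm i\<close>, so topping up requires few discarded pairs.\<close>

lemma waste_expectation: "(\<Sum>m\<in>moves A P. pr m * real (wasted m)) \<le> 2 * \<epsilon> * \<delta> * real (card P)"
proof -
  have "(\<Sum>m\<in>moves A P. pr m * real (wasted m)) = \<delta> / Dm i * (\<Sum>p\<in>P. Dm i - real (deg A p))"
    unfolding sum_pr_mult by (simp add: wasted_def)
  also have "\<dots> \<le> \<delta> / Dm i * (\<Sum>p\<in>P. 2 * \<epsilon> * Dm i)"
  proof (intro mult_left_mono sum_mono)
    fix p assume p: "p \<in> P"
    have "Dm i - real (deg A p) \<le> 2 * \<epsilon> * sc i" using deg_lower[OF p] by (simp add: Dm_def algebra_simps)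
    also have "\<dots> \<le> 2 * \<epsilon> * Dm i" using Dm_ge \<epsilon>0 by (intro mult_left_mono) auto
    finally show "Dm i - real (deg A p) \<le> 2 * \<epsilon> * Dm i" .
  qed (use \<delta>0 Dm_ge in auto)
  also have "\<dots> = 2 * \<epsilon> * \<delta> * real (card P)" using Dm_ge by simp
  finally show ?thesis .
qed

lemma pot_deg_step: "(\<Sum>m\<in>moves A P. pr m * pot_deg (Suc i) (A - los m) (P - gone P m))
    \<le> pot_deg i A P * (1 + 8 * a * \<mu>\<^sup>2 * J1 * \<delta>)"
proof -
  let ?u = "\<lambda>p m. exp (\<mu> * (g (Suc i) * real (deg (A - los m) p) - (1 + \<epsilon>)))"
  let ?v = "\<lambda>p m. exp (\<mu> * (g (Suc i) * - real (deg (A - los m) p) - (\<epsilon> - 1)))"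
  have "(\<Sum>m\<in>moves A P. pr m * pot_deg (Suc i) (A - los m) (P - gone P m))
      = (\<Sum>p\<in>P. \<Sum>m\<in>{m \<in> moves A P. p \<notin> gone P m}. pr m * (?u p m + ?v p m))"
    unfolding pot_deg_def by (rule sum_kept_swap) auto
  also have "\<dots> \<le> (\<Sum>p\<in>P. (exp (\<mu> * (g i * real (deg A p) - (1 + \<epsilon>))) + exp (\<mu> * (g i * - real (deg A p) - (\<epsilon> - 1)))) * (1 + 8 * a * \<mu>\<^sup>2 * J1 * \<delta>))"
  proof (rule sum_mono)
    fix p assume p: "p \<in> P"
    have "(\<Sum>m\<in>{m \<in> moves A P. p \<notin> gone P m}. pr m * (?u p m + ?v p m))
        = (\<Sum>m\<in>{m \<in> moves A P. p \<notin> gone P m}. pr m * ?u p m) + (\<Sum>m\<in>{m \<in> moves A P. p \<notin> gone P m}. pr m * ?v p m)"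
      by (simp only: distrib_left sum.distrib)
    also have "\<dots> \<le> exp (\<mu> * (g i * real (deg A p) - (1 + \<epsilon>))) * (1 + 8 * a * \<mu>\<^sup>2 * J1 * \<delta>)
        + exp (\<mu> * (g i * - real (deg A p) - (\<epsilon> - 1))) * (1 + 8 * a * \<mu>\<^sup>2 * J1 * \<delta>)"
      by (intro add_mono deg_drift[OF p])
    finally show "(\<Sum>m\<in>{m \<in> moves A P. p \<notin> gone P m}. pr m * (?u p m + ?v p m))
        \<le> (exp (\<mu> * (g i * real (deg A p) - (1 + \<epsilon>))) + exp (\<mu> * (g i * - real (deg A p) - (\<epsilon> - 1)))) * (1 + 8 * a * \<mu>\<^sup>2 * J1 * \<delta>)"
      by (simp only: distrib_right)
  qed
  also have "\<dots> = pot_deg i A P * (1 + 8 * a * \<mu>\<^sup>2 * J1 * \<delta>)"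
    by (simp only: pot_deg_def sum_distrib_right)
  finally show ?thesis .
qed

lemma pot_live_step: "(\<Sum>m\<in>moves A P. pr m * pot_live (Suc i) (M \<union> added m) (A - los m))
    \<le> pot_live i M A + real l * real l * real n ^ 3 * (2 * exp (- \<mu> / 4)) * \<delta>"
proof -
  let ?E = "\<lambda>k c e m. exp (\<mu> * (g (Suc i) ^ (k - 1 - c) * real (card (live_configs n k c (M \<union> added m) (A - los m) e)) - live_bound l c))"
  let ?F = "\<lambda>k c e. exp (\<mu> * (g i ^ (k - 1 - c) * real (card (live_configs n k c M A e)) - live_bound l c))"
  let ?t = "2 * \<delta> * exp (- \<mu> / 4)"
  have "(\<Sum>m\<in>moves A P. pr m * pot_live (Suc i) (M \<union> added m) (A - los m))
      = (\<Sum>k\<in>{3..l}. \<Sum>m\<in>moves A P. \<Sum>c\<in>{..k - 2}. pr m * (\<Sum>e\<in>A - los m. ?E k c e m))"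
    unfolding pot_live_def sum_distrib_left by (rule sum.swap)
  also have "\<dots> = (\<Sum>k\<in>{3..l}. \<Sum>c\<in>{..k - 2}. \<Sum>m\<in>moves A P. pr m * (\<Sum>e\<in>A - los m. ?E k c e m))"
    by (intro sum.cong refl sum.swap)
  also have "\<dots> = (\<Sum>k\<in>{3..l}. \<Sum>c\<in>{..k - 2}. \<Sum>e\<in>A. \<Sum>m\<in>{m \<in> moves A P. e \<notin> los m}. pr m * ?E k c e m)"
    by (intro sum.cong refl sum_kept_swap) auto
  also have "\<dots> \<le> (\<Sum>k\<in>{3..l}. \<Sum>c\<in>{..k - 2}. \<Sum>e\<in>A. ?F k c e + ?t)"
    by (intro sum_mono live_configs_drift) auto
  also have "\<dots> = pot_live i M A + (\<Sum>k\<in>{3..l}. \<Sum>c\<in>{..k - 2}. real (card A) * ?t)"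
    by (simp only: pot_live_def sum.distrib sum_constant)
  also have "(\<Sum>k\<in>{3..l}. \<Sum>c\<in>{..k - 2}. real (card A) * ?t) \<le> (\<Sum>k\<in>{3..l}. real l * (real n ^ 3 * ?t))"
  proof (rule sum_mono)
    fix k assume k: "k \<in> {3..l}"
    have "card A \<le> card (triples n)" using valid_stateD(2)[OF valid] by (intro card_mono) auto
    then have "card A \<le> n ^ 3" using card_triples_le[of n] by simp
    then have "real (card A) \<le> real n ^ 3" by (simp only: of_nat_power[symmetric] of_nat_le_iff)
    then have "real (k - 1) * (real (card A) * ?t) \<le> real l * (real n ^ 3 * ?t)"
      using k \<delta>0 by (intro mult_mono mult_right_mono) auto
    moreover have "card {..k - 2} = k - 1" using k by auto
    ultimately show "(\<Sum>c\<in>{..k - 2}. real (card A) * ?t) \<le> real l * (real n ^ 3 * ?t)"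
      by (simp only: sum_constant)
  qed
  also have "(\<Sum>k\<in>{3..l}. real l * (real n ^ 3 * ?t)) \<le> real l * (real l * (real n ^ 3 * ?t))"
    using card_ks \<delta>0 by (simp only: sum_constant, intro mult_right_mono) auto
  finally show ?thesis by (simp add: algebra_simps)
qed

text \<open>The radius drops in each step by \<open>\<delta> / (n \<theta>)\<close>, which is at
  least the probability that a given triple is added.\<close>

lemma pot_moment_step: "(\<Sum>m\<in>moves A P. pr m * pot_moment (Suc i) (M \<union> added m)) \<le> pot_moment i M"
proof -
  have radS: "rad i = rad (Suc i) + \<delta> / (n * \<theta>)"
  proof -
    have "real (N - i) = real (N - Suc i) + 1" using iN by simp
    then show ?thesis unfolding rad_def by (simp only: distrib_right mult_1)
  qed
  have "(\<Sum>m\<in>moves A P. pr m * pot_moment (Suc i) (M \<union> added m))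
      = (\<Sum>x\<in>fams n l. \<Sum>m\<in>moves A P. pr m * (case x of (F, v) \<Rightarrow> moment_weight st_chosen F (rad (Suc i)) (M \<union> added m) s {} / (real n ^ v * Y) ^ s))"
    unfolding pot_moment_def sum_distrib_left by (rule sum.swap)
  also have "\<dots> \<le> pot_moment i M"
    unfolding pot_moment_def
  proof (rule sum_mono)
    fix x assume x: "x \<in> fams n l"
    obtain F v where x': "x = (F, v)" by (cases x)
    have F: "(F, v) \<in> fams n l" using x x' by simp
    have "(\<Sum>m\<in>moves A P. pr m * moment_weight st_chosen F (rad (Suc i)) (M \<union> added m) s {})
        \<le> moment_weight st_chosen F (rad (Suc i) + \<delta> / (n * \<theta>)) M s {}"
    proof (rule moment_weight_average_le)
      show "finite (added m) \<and> card (added m) \<le> 1" for m by (cases m) auto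
      show "(\<Sum>m\<in>{m \<in> moves A P. y \<in> added m}. pr m) \<le> \<delta> / (n * \<theta>)" for y
      proof -
        have "\<delta> / Dm i \<le> \<delta> / (n * \<theta>)" using Dm_ge n0 \<theta>0 \<delta>0 by (intro divide_left_mono mult_pos_pos) auto
        then show ?thesis using pr_added[of y] by simp
      qed
      show "sum pr (moves A P) = 1" by (rule sum_pr)
      show "0 \<le> rad (Suc i)" by (rule rad_nonneg)
      show "0 \<le> \<delta> / (n * \<theta>)" using \<delta>0 \<theta>0 by simp
      show "\<And>x. x \<in> F \<Longrightarrow> finite (st_chosen x)" by (rule fams_facts(2)[OF F])
    qed (use pr_nonneg in auto)
    then have "(\<Sum>m\<in>moves A P. pr m * moment_weight st_chosen F (rad (Suc i)) (M \<union> added m) s {}) / (real n ^ v * Y) ^ s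
        \<le> moment_weight st_chosen F (rad i) M s {} / (real n ^ v * Y) ^ s"
      using Y1 unfolding radS by (intro divide_right_mono) auto
    then show "(\<Sum>m\<in>moves A P. pr m * (case x of (F, v) \<Rightarrow> moment_weight st_chosen F (rad (Suc i)) (M \<union> added m) s {} / (real n ^ v * Y) ^ s))
        \<le> (case x of (F, v) \<Rightarrow> moment_weight st_chosen F (rad i) M s {} / (real n ^ v * Y) ^ s)"
      by (simp add: x' sum_divide_distrib)
  qed
  finally show ?thesis .
qed

lemma pot_cov_step: "(\<Sum>m\<in>moves A P. pr m * pot_cov (Suc i) (P - gone P m)) = pot_cov i P"
proof -
  have "(\<Sum>m\<in>moves A P. pr m * pot_cov (Suc i) (P - gone P m))
      = (\<Sum>m\<in>moves A P. pr m * real (card (P - gone P m))) / ((1 - \<delta>) ^ Suc i * (4 * real n ^ 2))"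
    by (simp add: pot_cov_def sum_divide_distrib)
  also have "\<dots> = pot_cov i P" unfolding cov_expectation pot_cov_def using \<delta>1 by simp
  finally show ?thesis .
qed

lemma pot_waste_step: "(\<Sum>m\<in>moves A P. pr m * pot_waste (M \<union> added m) (P - gone P m)) \<le> pot_waste M P"
proof -
  let ?C = "real (n choose 2) - 3 * real (card M) - real (card P)"
  let ?d = "16 * \<epsilon> * real n ^ 2"
  have "(\<Sum>m\<in>moves A P. pr m * pot_waste (M \<union> added m) (P - gone P m))
      = (\<Sum>m\<in>moves A P. pr m * (?C + real (wasted m) + 4 * \<epsilon> * real (card (P - gone P m)))) / ?d"
    unfolding sum_divide_distrib
  proof (rule sum.cong)
    fix m assume m: "m \<in> moves A P"
    have "3 * real (card (M \<union> added m)) + real (card (P - gone P m)) + real (wasted m) = 3 * real (card M) + real (card P)"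
      using arg_cong[OF card_step[OF m], of real] by simp
    then have "real (n choose 2) - 3 * real (card (M \<union> added m)) - real (card (P - gone P m)) = ?C + real (wasted m)" by linarith
    then show "pr m * pot_waste (M \<union> added m) (P - gone P m)
        = pr m * (?C + real (wasted m) + 4 * \<epsilon> * real (card (P - gone P m))) / ?d"
      by (simp add: pot_waste_def)
  qed simp
  also have "(\<Sum>m\<in>moves A P. pr m * (?C + real (wasted m) + 4 * \<epsilon> * real (card (P - gone P m))))
      = ?C + (\<Sum>m\<in>moves A P. pr m * real (wasted m)) + 4 * \<epsilon> * (\<Sum>m\<in>moves A P. pr m * real (card (P - gone P m)))"
  proof -
    have "(\<Sum>m\<in>moves A P. pr m * ?C) = ?C" using sum_pr by (simp only: sum_distrib_right[symmetric] mult_1)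
    moreover have "(\<Sum>m\<in>moves A P. pr m * (4 * \<epsilon> * real (card (P - gone P m)))) = 4 * \<epsilon> * (\<Sum>m\<in>moves A P. pr m * real (card (P - gone P m)))"
      by (simp only: sum_distrib_left mult_ac)
    ultimately show ?thesis by (simp only: distrib_left sum.distrib)
  qed
  also have "\<dots> / ?d \<le> (?C + 4 * \<epsilon> * real (card P)) / ?d"
  proof (rule divide_right_mono)
    have "0 \<le> \<epsilon> * \<delta> * real (card P)" using \<epsilon>0 \<delta>0 by simp
    then show "?C + (\<Sum>m\<in>moves A P. pr m * real (wasted m)) + 4 * \<epsilon> * (\<Sum>m\<in>moves A P. pr m * real (card (P - gone P m))) \<le> ?C + 4 * \<epsilon> * real (card P)"
      using waste_expectation unfolding cov_expectation by (simp add: algebra_simps)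
  qed (use \<epsilon>0 in simp)
  also have "\<dots> = pot_waste M P" by (simp add: pot_waste_def)
  finally show ?thesis .
qed

lemma exists_good_move:
  assumes pd: "pot_deg i A P \<le> 1"
  shows "\<exists>m\<in>moves A P. pot (Suc i) (M \<union> added m) (A - los m) (P - gone P m) \<le> pot i M A P + \<delta> * \<omega>"
proof (rule exists_le_weighted_average[of _ pr])
  \<comment> \<open>The assumption \<open>pd\<close> turns multiplicative growth into the additive
    increment contained in \<open>\<omega>\<close>.\<close>
  have "pot_deg i A P * (1 + 8 * a * \<mu>\<^sup>2 * J1 * \<delta>) \<le> pot_deg i A P + 8 * a * \<mu>\<^sup>2 * J1 * \<delta>"
  proof -
    have "0 \<le> 8 * a * \<mu>\<^sup>2 * J1 * \<delta>" using a2 J1_pos \<delta>0 by simp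
    then have "pot_deg i A P * (8 * a * \<mu>\<^sup>2 * J1 * \<delta>) \<le> 1 * (8 * a * \<mu>\<^sup>2 * J1 * \<delta>)" using pd by (intro mult_right_mono)
    then show ?thesis by (simp add: distrib_left)
  qed
  then have "(\<Sum>m\<in>moves A P. pr m * pot_deg (Suc i) (A - los m) (P - gone P m)) + (\<Sum>m\<in>moves A P. pr m * pot_live (Suc i) (M \<union> added m) (A - los m))
      + (\<Sum>m\<in>moves A P. pr m * pot_moment (Suc i) (M \<union> added m)) + (\<Sum>m\<in>moves A P. pr m * pot_cov (Suc i) (P - gone P m))
      + (\<Sum>m\<in>moves A P. pr m * pot_waste (M \<union> added m) (P - gone P m)) \<le> pot i M A P + \<delta> * \<omega>"
    using pot_deg_step pot_live_step pot_moment_step pot_cov_step pot_waste_step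
    unfolding pot_def \<omega>_def by (simp add: algebra_simps)
  then show "(\<Sum>m\<in>moves A P. pr m * pot (Suc i) (M \<union> added m) (A - los m) (P - gone P m)) \<le> pot i M A P + \<delta> * \<omega>"
    unfolding pot_def by (simp only: distrib_left sum.distrib)
qed (use pr_nonneg sum_pr in auto)

end

text \<open>Each of the five terms of the potential is to start at no more than 1/8 and the total
  drift is at most another 1/8, so the potential never exceeds 1. For \<open>pot_cov\<close> and
  \<open>pot_waste\<close> the initial bound follows from their denominators.\<close>

locale girth_run = girth_params +
  assumes s0: "0 < s" and \<theta>N\<delta>: "\<theta> \<le> real N * \<delta>"
    and init_deg: "2 * real n ^ 2 * exp (- (\<mu> * (\<epsilon> - 2 / n))) \<le> 1 / 8"
    and init_x: "real l * real l * real n ^ 3 * exp (- \<mu>) \<le> 1 / 8"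
    and init_m: "3 * (real l + 1) ^ 3 * real n ^ 6 *
      (2 ^ (s * (2 * l)) * st_const (2 * l + 4) * (real N * \<delta> / \<theta>) ^ (2 * l) / Y) ^ s \<le> 1 / 8"
    and drift: "real N * \<delta> * \<omega> \<le> 1 / 8"
begin

lemma pot_initial: "pot 0 {} (triples n) (pairs n) \<le> 5 / 8"
proof -
  have g0: "g 0 = 1 / n" by (simp add: g_def sc_def)
  have cP: "real (card (pairs n)) \<le> real n ^ 2 / 2"
  proof -
    have "real (card (pairs n)) = real (n * (n - 1) div 2)" by (simp add: card_pairs choose_two)
    also have "\<dots> \<le> real (n * (n - 1)) / 2" using of_nat_div_le_of_nat[where 'a = real, of "n * (n - 1)" 2] by simp
    also have "\<dots> \<le> real n ^ 2 / 2"
    proof -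
      have "n * (n - 1) \<le> n ^ 2" by (simp add: power2_eq_square)
      then have "real (n * (n - 1)) \<le> real (n ^ 2)" by (simp only: of_nat_le_iff)
      then show ?thesis by simp
    qed
    finally show ?thesis .
  qed
  have d: "pot_deg 0 (triples n) (pairs n) \<le> 1 / 8"
  proof -
    let ?E = "exp (- (\<mu> * (\<epsilon> - 2 / n)))"
    have "pot_deg 0 (triples n) (pairs n) \<le> (\<Sum>p\<in>pairs n. ?E + ?E)"
      unfolding pot_deg_def
    proof (intro sum_mono add_mono)
      fix p assume p: "p \<in> pairs n"
      have d1: "real (deg (triples n) p) \<le> real n" "real n - 2 \<le> real (deg (triples n) p)" using deg_triples[OF p] by linarith+
      have g1: "g 0 * real (deg (triples n) p) \<le> 1" using d1 n0 by (simp add: g0 divide_le_eq)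
      have "(real n - 2) / n \<le> real (deg (triples n) p) / n" using d1 by (intro divide_right_mono) auto
      moreover have "(real n - 2) / n = 1 - 2 / n" using n0 by (simp add: diff_divide_distrib)
      ultimately have g2: "1 - 2 / n \<le> g 0 * real (deg (triples n) p)" by (simp add: g0)
      have n2: "0 \<le> 2 / real n" by simp
      have "\<mu> * (g 0 * real (deg (triples n) p) - (1 + \<epsilon>)) \<le> \<mu> * (- (\<epsilon> - 2 / n))"
        using g1 n2 \<mu>0 by (intro mult_left_mono) linarith+
      then show "exp (\<mu> * (g 0 * real (deg (triples n) p) - (1 + \<epsilon>))) \<le> ?E" by (simp only: exp_le_cancel_iff mult_minus_right)
      have "\<mu> * (g 0 * - real (deg (triples n) p) - (\<epsilon> - 1)) \<le> \<mu> * (- (\<epsilon> - 2 / n))"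
        using g2 \<mu>0 by (intro mult_left_mono) simp_all
      then show "exp (\<mu> * (g 0 * - real (deg (triples n) p) - (\<epsilon> - 1))) \<le> ?E" by (simp only: exp_le_cancel_iff mult_minus_right)
    qed
    also have "\<dots> = real (card (pairs n)) * (2 * ?E)" by simp
    also have "\<dots> \<le> real n ^ 2 * (2 * ?E)"
    proof (rule mult_right_mono)
      show "real (card (pairs n)) \<le> real n ^ 2" by (simp only: of_nat_power[symmetric] of_nat_le_iff card_pairs_le)
    qed simp
    also have "\<dots> \<le> 1 / 8" using init_deg by (simp add: mult_ac)
    finally show ?thesis .
  qed
  have x: "pot_live 0 {} (triples n) \<le> 1 / 8"
  proof -
    have bnd: "\<mu> * (g 0 ^ (k - 1 - c) * real (card (live_configs n k c {} (triples n) e)) - live_bound l c) \<le> - \<mu>"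
      if k: "k \<in> {3..l}" for k c e
    proof (cases "c = 0")
      case True
      have "real (card (live_configs n k c {} (triples n) e)) \<le> real (card {H \<in> configs n k. e \<in> H})"
        unfolding of_nat_le_iff live_configs_def by (intro card_mono) auto
      also have "\<dots> \<le> st_const (2 * l + 4) * real n ^ (k - 1)" using k n0 by (intro card_configs_containing_le) auto
      finally have "(1 / real n) ^ (k - 1) * real (card (live_configs n k c {} (triples n) e)) \<le> (1 / real n) ^ (k - 1) * (st_const (2 * l + 4) * real n ^ (k - 1))"
        by (intro mult_left_mono) auto
      also have "\<dots> = st_const (2 * l + 4)" using n0 by (simp add: power_one_over)
      finally have "g 0 ^ (k - 1 - c) * real (card (live_configs n k c {} (triples n) e)) - live_bound l c \<le> - st_const (2 * l + 4)"
        using True by (simp add: g0 live_bound_def)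
      also have "\<dots> \<le> - 1" using st_const_ge1[of "2 * l + 4"] by simp
      finally show ?thesis using \<mu>0 mult_left_mono[of _ "- 1" \<mu>] by fastforce
    next
      case False
      then have "live_configs n k c {} (triples n) e = {}" by (auto simp: live_configs_def)
      then have "card (live_configs n k c {} (triples n) e) = 0" by (simp only: card.empty)
      moreover have "\<mu> * 1 \<le> \<mu> * live_bound l c" using live_bound_ge1[of l c] l4 \<mu>0 by (intro mult_left_mono) auto
      ultimately show ?thesis by simp
    qed
    have "pot_live 0 {} (triples n) \<le> (\<Sum>k\<in>{3..l}. \<Sum>c\<in>{..k - 2}. \<Sum>e\<in>triples n. exp (- \<mu>))"
      unfolding pot_live_def using bnd by (intro sum_mono) simp
    also have "\<dots> \<le> (\<Sum>k\<in>{3..l}. real l * (real n ^ 3 * exp (- \<mu>)))"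
    proof (rule sum_mono)
      fix k assume k: "k \<in> {3..l}"
      have "real (card (triples n)) \<le> real n ^ 3" using card_triples_le[of n] by (simp only: of_nat_power[symmetric] of_nat_le_iff)
      then have "real (k - 1) * (real (card (triples n)) * exp (- \<mu>)) \<le> real l * (real n ^ 3 * exp (- \<mu>))"
        using k by (intro mult_mono mult_right_mono) auto
      moreover have "card {..k - 2} = k - 1" using k by auto
      ultimately show "(\<Sum>c\<in>{..k - 2}. \<Sum>e\<in>triples n. exp (- \<mu>)) \<le> real l * (real n ^ 3 * exp (- \<mu>))"
        by (simp only: sum_constant)
    qed
    also have "\<dots> = real (card {3..l}) * (real l * (real n ^ 3 * exp (- \<mu>)))" by (simp only: sum_constant)
    also have "\<dots> \<le> real l * (real l * (real n ^ 3 * exp (- \<mu>)))" by (intro mult_right_mono) auto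
    also have "\<dots> \<le> 1 / 8" using init_x by (simp add: mult_ac)
    finally show ?thesis .
  qed
  have m: "pot_moment 0 {} \<le> 1 / 8"
  proof -
    define y where "y = real N * \<delta> / \<theta>"
    have y1: "1 \<le> y" using \<theta>N\<delta> \<theta>0 by (simp add: y_def le_divide_eq)
    have r: "rad 0 = y / n" by (simp add: rad_def y_def)
    let ?b = "(2 ^ (s * (2 * l)) * st_const (2 * l + 4) * y ^ (2 * l) / Y) ^ s"
    have "pot_moment 0 {} \<le> (\<Sum>x\<in>fams n l. ?b)"
      unfolding pot_moment_def
    proof (rule sum_mono)
      fix x assume x: "x \<in> fams n l"
      obtain F v where x': "x = (F, v)" by (cases x)
      have F: "(F, v) \<in> fams n l" using x x' by simp
      let ?B = "st_const (2 * l + 4) * real n ^ v * y ^ (2 * l)"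
      have "moment_weight st_chosen F (y / n) {} s {} \<le> (2 ^ (s * (2 * l)) * ?B) ^ s * (y / n) ^ card ({} :: nat set set)"
      proof (rule moment_weight_empty_le[where b = "2 * l"])
        show "0 \<le> ?B" using st_const_ge1[of "2 * l + 4"] y1 by simp
        show "0 \<le> y / n" using y1 by simp
      qed (use fams_facts[OF F] n0 y1 in auto)
      then have "moment_weight st_chosen F (rad 0) {} s {} / (real n ^ v * Y) ^ s \<le> (2 ^ (s * (2 * l)) * ?B) ^ s / (real n ^ v * Y) ^ s"
        unfolding r using Y1 by (intro divide_right_mono) auto
      also have "\<dots> = ((2 ^ (s * (2 * l)) * ?B) / (real n ^ v * Y)) ^ s" by (simp only: power_divide)
      also have "(2 ^ (s * (2 * l)) * ?B) / (real n ^ v * Y) = 2 ^ (s * (2 * l)) * st_const (2 * l + 4) * y ^ (2 * l) / Y"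
        using n0 by simp
      finally show "(case x of (F, v) \<Rightarrow> moment_weight st_chosen F (rad 0) {} s {} / (real n ^ v * Y) ^ s) \<le> ?b"
        by (simp add: x')
    qed
    also have "\<dots> = real (card (fams n l)) * ?b" by simp
    also have "\<dots> \<le> (3 * (real l + 1) ^ 3 * real n ^ 6) * ?b"
    proof (rule mult_right_mono)
      have "real (card (fams n l)) \<le> real (3 * (l + 1) ^ 3 * n ^ 6)" using card_fams_le[OF n0, of l] by (simp only: of_nat_le_iff)
      then show "real (card (fams n l)) \<le> 3 * (real l + 1) ^ 3 * real n ^ 6" by (simp add: add.commute)
      show "0 \<le> ?b" using st_const_ge1[of "2 * l + 4"] y1 Y1 by simp
    qed
    also have "\<dots> \<le> 1 / 8" using init_m by (simp add: y_def)
    finally show ?thesis .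
  qed
  have c: "pot_cov 0 (pairs n) \<le> 1 / 8" using cP n0 by (simp add: pot_cov_def divide_le_eq)
  have w: "pot_waste {} (pairs n) \<le> 1 / 8"
  proof -
    have "pot_waste {} (pairs n) = (4 * \<epsilon> * real (card (pairs n))) / (16 * \<epsilon> * real n ^ 2)"
      by (simp add: pot_waste_def card_pairs)
    also have "\<dots> \<le> (4 * \<epsilon> * (real n ^ 2 / 2)) / (16 * \<epsilon> * real n ^ 2)"
      using cP \<epsilon>0 by (intro divide_right_mono mult_left_mono) auto
    also have "\<dots> = 1 / 8" using \<epsilon>0 n0 by simp
    finally show ?thesis .
  qed
  show ?thesis using d x m c w by (simp add: pot_def)
qed

text \<open>While the potential is at most 1 the state is good, and the averaging argument supplies
  the next move.\<close>

lemma run: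
  "i \<le> N \<Longrightarrow> \<exists>M A P. valid_state n l M A P \<and> 3 * card M + card P \<le> n choose 2 \<and>
     pot i M A P \<le> 5 / 8 + real i * (\<delta> * \<omega>)"
proof (induction i)
  case 0
  show ?case using valid_state_initial[of n l] pot_initial by (intro exI[of _ "{}"] exI[of _ "triples n"] exI[of _ "pairs n"]) (simp add: card_pairs)
next
  case (Suc i)
  then obtain M A P where v: "valid_state n l M A P" and U: "3 * card M + card P \<le> n choose 2"
    and p: "pot i M A P \<le> 5 / 8 + real i * (\<delta> * \<omega>)" by auto
  have w0: "0 \<le> \<delta> * \<omega>" using \<delta>0 a2 J1_pos by (simp add: \<omega>_def)
  have "real i * (\<delta> * \<omega>) \<le> real N * (\<delta> * \<omega>)" using Suc w0 by (intro mult_right_mono) auto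
  then have p1: "pot i M A P \<le> 1" using p drift by (simp add: mult.assoc)
  interpret good_state n l N s \<delta> \<epsilon> \<mu> Y \<theta> i M A P
    by (rule good_state_of_pot[OF v U _ s0 p1]) (use Suc in simp)
  have "pot_deg i A P \<le> 1" using p1 pot_nonneg(1)[OF U, of i A] pot_nonneg(2)[OF U, of i A] pot_nonneg(3)[OF U, of i] pot_nonneg(4)[OF U, of i] pot_nonneg(5)[OF U] by (auto simp: pot_def)
  then obtain m where m: "m \<in> moves A P"
    and pm: "pot (Suc i) (M \<union> added m) (A - los m) (P - gone P m) \<le> pot i M A P + \<delta> * \<omega>"
    using exists_good_move by blast
  have "valid_state n l (M \<union> added m) (A - los m) (P - gone P m)" by (rule valid_state_step[OF v m])
  moreover have "3 * card (M \<union> added m) + card (P - gone P m) \<le> n choose 2" using card_step[OF m] U by linarith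
  moreover have "pot (Suc i) (M \<union> added m) (A - los m) (P - gone P m) \<le> 5 / 8 + real (Suc i) * (\<delta> * \<omega>)"
    using pm p by (simp add: algebra_simps)
  ultimately show ?case by blast
qed

text \<open>\<open>pot_cov \<le> 1\<close> bounds the pairs left over and
  \<open>pot_waste \<le> 1\<close> the pairs discarded; the others are covered by \<open>M\<close>,
  three per triple.\<close>

lemma final_state:
  "\<exists>M. M \<subseteq> triples n \<and> (\<forall>e\<in>M. \<forall>f\<in>M. e \<noteq> f \<longrightarrow> card (e \<inter> f) \<le> 1) \<and>
     (\<forall>k H. 3 \<le> k \<longrightarrow> k \<le> l \<longrightarrow> H \<in> configs n k \<longrightarrow> \<not> H \<subseteq> M) \<and>
     real (n choose 2) - 4 * real n ^ 2 * (1 - \<delta>) ^ N - 16 * \<epsilon> * real n ^ 2 \<le> 3 * real (card M)"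
proof -
  obtain M A P where v: "valid_state n l M A P" and U: "3 * card M + card P \<le> n choose 2"
    and p: "pot N M A P \<le> 5 / 8 + real N * (\<delta> * \<omega>)" using run[of N] by auto
  note nn = pot_nonneg[OF U]
  have "pot N M A P \<le> 1" using p drift by (simp add: mult.assoc)
  then have c: "pot_cov N P \<le> 1" and w: "pot_waste M P \<le> 1" using nn(1)[of N A] nn(2)[of N A] nn(3)[of N] nn(4)[of N] nn(5) by (auto simp: pot_def)
  have "0 < (1 - \<delta>) ^ N * (4 * real n ^ 2)" using \<delta>1 n0 by simp
  then have cP: "real (card P) \<le> 4 * real n ^ 2 * (1 - \<delta>) ^ N" using c by (simp add: pot_cov_def divide_le_eq mult_ac split: if_splits)
  have "0 < 16 * \<epsilon> * real n ^ 2" using \<epsilon>0 n0 by simp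
  then have "real (n choose 2) - 3 * real (card M) - real (card P) + 4 * \<epsilon> * real (card P) \<le> 16 * \<epsilon> * real n ^ 2"
    using w by (simp add: pot_waste_def divide_le_eq split: if_splits)
  moreover have "0 \<le> 4 * \<epsilon> * real (card P)" using \<epsilon>0 by simp
  ultimately have "real (n choose 2) - 4 * real n ^ 2 * (1 - \<delta>) ^ N - 16 * \<epsilon> * real n ^ 2 \<le> 3 * real (card M)"
    using cP by linarith
  moreover have "M \<subseteq> triples n" by (rule valid_stateD(1)[OF v])
  moreover have "\<forall>e\<in>M. \<forall>f\<in>M. e \<noteq> f \<longrightarrow> card (e \<inter> f) \<le> 1" using valid_stateD(6)[OF v] by blast
  moreover have "\<forall>k H. 3 \<le> k \<longrightarrow> k \<le> l \<longrightarrow> H \<in> configs n k \<longrightarrow> \<not> H \<subseteq> M" using valid_stateD(7)[OF v] by blast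
  ultimately show ?thesis by blast
qed

end

section \<open>Choice of the parameters\<close>

lemma eventually_const_le_powr:
  fixes C p :: real
  assumes "0 < p"
  shows "eventually (\<lambda>n. C \<le> real n powr p) sequentially"
proof -
  define D where "D = max C 1"
  have "eventually (\<lambda>n. nat \<lceil>D powr (1 / p)\<rceil> \<le> n) sequentially" by (rule eventually_ge_at_top)
  then show ?thesis
  proof eventually_elim
    case (elim n)
    have "D powr (1 / p) \<le> real n" using elim by linarith
    then have "(D powr (1 / p)) powr p \<le> real n powr p" using assms by (intro powr_mono2) auto
    moreover have "(D powr (1 / p)) powr p = D" using assms by (simp add: powr_powr D_def)
    ultimately show ?case by (simp add: D_def)
  qed
qed

lemma eventually_ln_le_powr:
  fixes t p :: real
  assumes "0 < p"
  shows "eventually (\<lambda>n. t * ln (real n) + 1 \<le> real n powr p) sequentially"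
proof -
  have "eventually (\<lambda>n. \<bar>t\<bar> / (p / 2) + 1 \<le> real n powr (p / 2)) sequentially"
    using assms by (intro eventually_const_le_powr) simp
  moreover have "eventually (\<lambda>n. 1 \<le> n) sequentially" by (rule eventually_ge_at_top)
  ultimately show ?thesis
  proof eventually_elim
    case (elim n)
    let ?x = "real n powr (p / 2)"
    have x1: "1 \<le> ?x" using elim assms by (intro ge_one_powr_ge_zero) auto
    have ln: "0 \<le> ln (real n)" "ln (real n) \<le> ?x / (p / 2)"
      using elim assms ln_powr_bound[of "real n" "p / 2"] by simp_all
    have "t * ln (real n) \<le> \<bar>t\<bar> * ln (real n)" using ln by (intro mult_right_mono) auto
    also have "\<dots> \<le> \<bar>t\<bar> * (?x / (p / 2))" using ln by (intro mult_left_mono) auto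
    also have "\<dots> = \<bar>t\<bar> / (p / 2) * ?x" by simp
    finally have "t * ln (real n) + 1 \<le> \<bar>t\<bar> / (p / 2) * ?x + 1 * ?x" using x1 by linarith
    also have "\<dots> = (\<bar>t\<bar> / (p / 2) + 1) * ?x" by (simp only: distrib_right)
    also have "\<dots> \<le> ?x * ?x" using elim x1 by (intro mult_right_mono) auto
    also have "\<dots> = real n powr p" by (simp add: powr_add[symmetric])
    finally show ?case .
  qed
qed

lemma eventually_power_exp_le:
  fixes p :: real
  assumes "0 < p"
  shows "eventually (\<lambda>n. real n ^ j * exp (- (real n powr p)) \<le> 1) sequentially"
proof -
  define k where "k = nat \<lceil>real j / p\<rceil>"
  have "((\<lambda>x::real. x ^ k / exp x) \<longlongrightarrow> 0) at_top" by (rule tendsto_power_div_exp_0)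
  moreover have "filterlim (\<lambda>n. real n powr p) at_top sequentially"
    unfolding filterlim_at_top using eventually_const_le_powr[OF assms] by blast
  ultimately have "((\<lambda>n. (real n powr p) ^ k / exp (real n powr p)) \<longlongrightarrow> 0) sequentially"
    by (rule filterlim_compose)
  then have "eventually (\<lambda>n. (real n powr p) ^ k / exp (real n powr p) < 1) sequentially"
    by (rule order_tendstoD) simp
  moreover have "eventually (\<lambda>n. 1 \<le> n) sequentially" by (rule eventually_ge_at_top)
  ultimately show ?thesis
  proof eventually_elim
    case (elim n)
    have "real j / p \<le> real k" unfolding k_def by linarith
    then have "real j \<le> p * real k" using assms by (simp add: divide_le_eq mult.commute)
    then have "real n powr real j \<le> real n powr (p * real k)" using elim by (intro powr_mono) auto
    then have "real n ^ j \<le> (real n powr p) ^ k" using elim by (simp add: powr_realpow powr_powr[symmetric])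
    then have "real n ^ j / exp (real n powr p) \<le> (real n powr p) ^ k / exp (real n powr p)" by (intro divide_right_mono) auto
    then show ?case using elim by (simp add: exp_minus field_simps)
  qed
qed

text \<open>The exponent \<open>\<tau>\<close> for the uncovered proportion. With
  \<open>a = 2 + kill_ratio l\<close> the constant is chosen so that
  \<open>2 a \<tau> = 1 / (128 l)\<close>, half of the exponent in \<open>\<theta>\<close>; the
  other half leaves room for rounding \<open>N\<close> up.\<close>

definition rate :: "nat \<Rightarrow> real" where
  "rate l = 1 / (256 * real l * (2 + kill_ratio l))"

text \<open>Every constant that a power of \<open>n\<close> has to beat, collected so that one lower
  bound on \<open>n powr (1 / (128 l))\<close> covers all estimates.\<close>

definition big_consts :: "nat \<Rightarrow> real set" where
  "big_consts l = {4, 2 * real l * (2 + kill_ratio l), 5 + kill_ratio l, exp (2 * (2 + kill_ratio l)), 64 * real l * (3 + kill_ratio l) * (real l + 4),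
     2 * real l * (real l + 3)\<^sup>2, live_bound l l, 16 * exp 2, 32 * real l * real l, 24 * (real l + 1) ^ 3,
     2 ^ (64 * (2 * l)) * st_const (2 * l + 4), 256 * (2 + kill_ratio l) * (real l + 4)}"

text \<open>The exponents are balanced as follows. \<open>\<mu> \<epsilon> = n powr (1 / 16)\<close>
  makes the exponentials beat polynomials. \<open>\<theta> ^ l = n powr (- (1 / 64))\<close> and
  \<open>Y = n powr (1 / 4)\<close> give \<open>J1\<close> the order
  \<open>n powr (- (47 / 64))\<close>, so that \<open>\<mu> ^ 2 J1\<close> is still a negative
  power. The moment order 64 turns a factor \<open>n powr (- (1 / 8))\<close> into
  \<open>n powr (- 8)\<close>, which beats the \<open>n ^ 6\<close> families. The step size
  \<open>1 / n ^ 5\<close> keeps the total probability of the moves other than \<open>Null\<close>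
  below 1.\<close>

lemma girth_run_exists:
  fixes n l :: nat
  assumes l: "4 \<le> l" and big: "Max (big_consts l) \<le> real n powr (1 / (128 * real l))"
    and ln1: "rate l * ln (real n) + 1 \<le> real n powr (1 / (64 * real l))"
    and ex: "real n ^ 5 * exp (- (real n powr (1 / 16))) \<le> 1"
    and ln2: "1 \<le> rate l * ln (real n)"
  defines "N \<equiv> nat \<lceil>rate l * ln (real n) * real n ^ 5\<rceil>"
  shows "girth_run n l N 64 (1 / real n ^ 5) (real n powr (- (1 / 16))) (real n powr (1 / 8)) (real n powr (1 / 4)) (real n powr (- (1 / (64 * real l))))"
proof -
  define a where "a = 2 + kill_ratio l"
  define x where "x = real n"
  define \<delta> where "\<delta> = 1 / x ^ 5"
  define \<epsilon> where "\<epsilon> = x powr (- (1 / 16))"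
  define \<mu> where "\<mu> = x powr (1 / 8)"
  define Y where "Y = x powr (1 / 4)"
  define \<theta> where "\<theta> = x powr (- (1 / (64 * real l)))"
  have a2: "2 \<le> a" using kill_ratio_nonneg[of l] by (simp add: a_def)
  have bigs: "c \<le> x powr (1 / (128 * real l))" if "c \<in> big_consts l" for c
  proof -
    have "c \<le> Max (big_consts l)" by (rule Max_ge[OF _ that]) (simp add: big_consts_def)
    then show ?thesis using assms(2) by (simp add: x_def)
  qed
  have "4 \<le> x powr (1 / (128 * real l))" by (rule bigs) (simp add: big_consts_def)
  then have xn: "n \<noteq> 0" by (cases n) (auto simp: x_def)
  then have x1: "1 \<le> x" by (simp add: x_def)
  have x0: "0 < x" using x1 by simp
  have sig: "1 / (128 * real l) \<le> 1 / 512" using l by (intro divide_left_mono) auto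
  have big_p: "c \<le> x powr p" if "c \<in> big_consts l" "1 / 512 \<le> p" for c p
  proof -
    have "c \<le> x powr (1 / (128 * real l))" by (rule bigs[OF that(1)])
    also have "\<dots> \<le> x powr p" using x1 sig that(2) by (intro powr_mono) auto
    finally show ?thesis .
  qed
  have small: "c * x powr (- p) \<le> 1" if "c \<le> x powr p" for c p
  proof -
    have "c * x powr (- p) \<le> x powr p * x powr (- p)" using that by (intro mult_right_mono) auto
    also have "\<dots> = 1" using x0 by (simp add: powr_add[symmetric])
    finally show ?thesis .
  qed
  have xc: "c \<le> x" if "c \<le> x powr 1" for c using that x0 by simp
  have \<theta>l: "\<theta> ^ l = x powr (- (1 / 64))"
    using l x0 by (simp add: \<theta>_def powr_power)
  have Jx: "2 * (real l + 4) * Y / (real n * \<theta> ^ l) = 2 * (real l + 4) * x powr (- (47 / 64))"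
  proof -
    have "Y / (x * \<theta> ^ l) = x powr (1 / 4) / (x powr 1 * x powr (- (1 / 64)))" using x0 by (simp add: Y_def \<theta>l)
    also have "\<dots> = x powr (1 / 4 - (1 + - (1 / 64)))" by (simp only: powr_add[symmetric] powr_diff[symmetric])
    finally have "Y / (x * \<theta> ^ l) = x powr (- (47 / 64))" by simp
    then have "2 * (real l + 4) * (Y / (real n * \<theta> ^ l)) = 2 * (real l + 4) * x powr (- (47 / 64))"
      by (simp only: x_def)
    then show ?thesis by (simp only: times_divide_eq_right)
  qed
  have \<mu>2: "\<mu>\<^sup>2 = x powr (1 / 4)" using x0 by (simp add: \<mu>_def powr_power)
  have \<delta>0: "0 < \<delta>" using x0 by (simp add: \<delta>_def)
  have \<delta>x: "\<delta> \<le> 1 / x" "\<delta> \<le> 1"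
  proof -
    have "x ^ 1 \<le> x ^ 5" using x1 by (intro power_increasing) auto
    then show "\<delta> \<le> 1 / x" unfolding \<delta>_def using x0 by (intro divide_left_mono) auto
    also have "1 / x \<le> 1" using x1 by simp
    finally show "\<delta> \<le> 1" .
  qed
  have \<delta>_small: "real l * (2 + kill_ratio l) * \<delta> \<le> 1 / 2"
  proof -
    have "2 * real l * (2 + kill_ratio l) \<le> x" by (rule xc, rule big_p) (simp_all add: big_consts_def)
    then have "2 * real l * (2 + kill_ratio l) * (1 / x) \<le> 1" using x0 by simp
    moreover have "2 * real l * (2 + kill_ratio l) * \<delta> \<le> 2 * real l * (2 + kill_ratio l) * (1 / x)"
      using \<delta>x kill_ratio_nonneg[of l] by (intro mult_left_mono) auto
    ultimately show ?thesis by simp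
  qed
  have a\<delta>: "a * \<delta> \<le> 1 / 2"
  proof -
    have "1 * (a * \<delta>) \<le> real l * (a * \<delta>)" using l a2 \<delta>0 by (intro mult_right_mono) auto
    then show ?thesis using \<delta>_small by (simp add: a_def mult.assoc)
  qed
  have N1: "rate l * ln x \<le> real N * \<delta>" "real N * \<delta> \<le> rate l * ln x + 1"
  proof -
    define z where "z = rate l * ln x * x ^ 5"
    have z0: "0 \<le> z" using ln2 x0 by (simp add: z_def x_def)
    have Nz: "real N = of_int \<lceil>z\<rceil>" using z0 by (simp add: N_def z_def x_def)
    have "z \<le> real N" "real N \<le> z + 1" unfolding Nz by linarith+
    moreover have "z * \<delta> = rate l * ln x" using x0 by (simp add: z_def \<delta>_def)
    moreover have "z * \<delta> \<le> real N * \<delta>" "real N * \<delta> \<le> (z + 1) * \<delta>"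
      using calculation(1,2) \<delta>0 by (auto intro: mult_right_mono)
    ultimately show "rate l * ln x \<le> real N * \<delta>" "real N * \<delta> \<le> rate l * ln x + 1"
      using \<delta>x by (simp_all add: distrib_right)
  qed
  have N2: "real N * \<delta> \<le> x powr (1 / (64 * real l))" using N1(2) ln1 by (simp add: x_def)
  have N1': "1 \<le> real N * \<delta>" using N1(1) ln2 by (simp add: x_def)
  have \<theta>1: "0 < \<theta>" "\<theta> \<le> 1"
  proof -
    show "0 < \<theta>" using x0 by (simp add: \<theta>_def)
    have "\<theta> \<le> x powr 0" unfolding \<theta>_def using x1 by (intro powr_mono) auto
    then show "\<theta> \<le> 1" using x0 by simp
  qed
  have l64: "1 / (64 * real l) \<le> 1 / 64" using l by (intro divide_left_mono) auto
  have n\<theta>: "1 \<le> real n * \<theta>" "real n * \<theta> = x powr (1 - 1 / (64 * real l))"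
  proof -
    show e: "real n * \<theta> = x powr (1 - 1 / (64 * real l))"
      using x0 powr_add[of x 1 "- (1 / (64 * real l))"] by (simp add: \<theta>_def x_def)
    have "x powr 0 \<le> x powr (1 - 1 / (64 * real l))" using x1 l64 by (intro powr_mono) auto
    then show "1 \<le> real n * \<theta>" using x0 by (simp add: e)
  qed
  have \<theta>N: "\<theta> \<le> (1 - (2 + kill_ratio l) * \<delta>) ^ N"
  proof -
    \<comment> \<open>For \<open>u \<le> 1 / 2\<close> one has
      \<open>(1 - u) (1 + 2 u) \<ge> 1\<close>, which bounds \<open>1 - u\<close> from below by an
      exponential at the cost of a factor 2 in the exponent.\<close>
    have e1: "exp (- 2 * (a * \<delta>)) \<le> 1 - a * \<delta>"
    proof -
      define u where "u = a * \<delta>"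
      have u: "0 \<le> u" "u \<le> 1 / 2" using a\<delta> a2 \<delta>0 by (auto simp: u_def)
      have "1 + 2 * u \<le> exp (2 * u)" by (rule exp_ge_add_one_self)
      then have "(1 - u) * (1 + 2 * u) \<le> (1 - u) * exp (2 * u)" using u by (intro mult_left_mono) auto
      moreover have "1 \<le> (1 - u) * (1 + 2 * u)"
      proof -
        have "0 \<le> u * (1 - 2 * u)" using u by simp
        then show ?thesis by (simp add: algebra_simps)
      qed
      ultimately have "1 \<le> (1 - u) * exp (2 * u)" by linarith
      then have "exp (- (2 * u)) \<le> 1 - u" by (simp add: exp_minus divide_simps)
      then show ?thesis by (simp add: u_def)
    qed
    have "\<theta> = exp (- (1 / (64 * real l)) * ln x)" using x0 by (simp add: \<theta>_def powr_def)
    also have "\<dots> \<le> exp (- 2 * a * (real N * \<delta>))"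
    proof -
      \<comment> \<open>\<open>exp (2 a)\<close> is among \<open>big_consts\<close> to absorb the
        additive 1 in the upper bound for \<open>N \<delta>\<close>.\<close>
      have "exp (2 * a) \<le> exp (1 / (128 * real l) * ln x)"
        using bigs[of "exp (2 * (2 + kill_ratio l))"] x0 by (simp add: a_def powr_def big_consts_def)
      then have "2 * a \<le> 1 / (128 * real l) * ln x" by (simp only: exp_le_cancel_iff)
      moreover have "2 * a * (real N * \<delta>) \<le> 2 * a * (rate l * ln x + 1)" using N1(2) a2 by (intro mult_left_mono) auto
      moreover have "2 * a * rate l = 1 / (128 * real l)" using a2 l by (simp add: rate_def a_def divide_simps)
      then have "2 * a * (rate l * ln x + 1) = 1 / (128 * real l) * ln x + 2 * a"
        by (simp only: distrib_left mult.assoc[symmetric] mult_1_right)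
      moreover have "1 / (64 * real l) * ln x = 1 / (128 * real l) * ln x + 1 / (128 * real l) * ln x"
        using l by (simp add: field_simps)
      ultimately have "2 * a * (real N * \<delta>) \<le> 1 / (64 * real l) * ln x" by linarith
      then show ?thesis by simp
    qed
    also have "\<dots> = exp (- 2 * (a * \<delta>)) ^ N" by (simp add: exp_of_nat_mult[symmetric] algebra_simps)
    also have "\<dots> \<le> (1 - a * \<delta>) ^ N" using e1 by (intro power_mono) auto
    finally show ?thesis by (simp add: a_def)
  qed
  have \<epsilon>: "0 < \<epsilon>" "\<epsilon> \<le> 1 / 2"
  proof -
    show "0 < \<epsilon>" using x0 by (simp add: \<epsilon>_def)
    have "4 * x powr (- (1 / 16)) \<le> 1" by (rule small, rule big_p) (simp_all add: big_consts_def)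
    then show "\<epsilon> \<le> 1 / 2" by (simp add: \<epsilon>_def)
  qed
  have exx: "x ^ j * exp (- (x powr (1 / 16))) \<le> 1 / x" if "j \<le> 4" for j
  proof -
    have "x ^ Suc j * exp (- (x powr (1 / 16))) \<le> x ^ 5 * exp (- (x powr (1 / 16)))"
      using that x1 by (intro mult_right_mono power_increasing) auto
    also have "\<dots> \<le> 1" using ex by (simp add: x_def)
    finally show ?thesis using x0 by (simp add: le_divide_eq mult_ac)
  qed
  interpret girth_params n l N 64 \<delta> \<epsilon> \<mu> Y \<theta>
  proof unfold_locales
    show "4 \<le> l" "0 < n" using l xn by auto
    show "0 < \<delta>" "real l * (2 + kill_ratio l) * \<delta> \<le> 1 / 2" by fact+
    show "\<delta> * (real n ^ 3 * (4 + kill_ratio l) + real n ^ 2) \<le> 1"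
    proof -
      have "x ^ 2 \<le> x ^ 3" using x1 by (intro power_increasing) auto
      then have "\<delta> * (x ^ 3 * (4 + kill_ratio l) + x ^ 2) \<le> \<delta> * (x ^ 3 * (5 + kill_ratio l))" using \<delta>0 by (intro mult_left_mono) (auto simp: algebra_simps)
      also have "\<dots> \<le> \<delta> * (x ^ 3 * x)"
      proof -
        have "5 + kill_ratio l \<le> x" by (rule xc, rule big_p) (simp_all add: big_consts_def)
        then show ?thesis using \<delta>0 x0 by (intro mult_left_mono) auto
      qed
      also have "\<dots> = 1 / x" using x0 by (simp add: \<delta>_def power_numeral_reduce)
      also have "\<dots> \<le> 1" using x1 by simp
      finally show ?thesis by (simp add: x_def)
    qed
    show "0 < \<epsilon>" "\<epsilon> \<le> 1 / 2" "0 < \<theta>" "\<theta> \<le> 1" "\<theta> \<le> (1 - (2 + kill_ratio l) * \<delta>) ^ N" "1 \<le> real n * \<theta>" by fact+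
    show "1 \<le> Y" unfolding Y_def using x1 by (simp add: ge_one_powr_ge_zero)
    show "0 < \<mu>" using x0 by (simp add: \<mu>_def)
    show "32 * real l * (3 + kill_ratio l) * \<mu> * (2 * (real l + 4) * Y / (real n * \<theta> ^ l)) \<le> 1"
    proof -
      have "32 * real l * (3 + kill_ratio l) * \<mu> * (2 * (real l + 4) * x powr (- (47 / 64)))
          = 64 * real l * (3 + kill_ratio l) * (real l + 4) * (x powr (1 / 8) * x powr (- (47 / 64)))" by (simp add: \<mu>_def)
      also have "x powr (1 / 8) * x powr (- (47 / 64)) = x powr (- (39 / 64))" by (simp add: powr_add[symmetric])
      also have "64 * real l * (3 + kill_ratio l) * (real l + 4) * x powr (- (39 / 64)) \<le> 1" by (rule small, rule big_p) (simp_all add: big_consts_def)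
      finally show ?thesis unfolding Jx .
    qed
    show "4 * (2 + kill_ratio l) * \<mu>\<^sup>2 * (2 * (real l + 4) * Y / (real n * \<theta> ^ l)) * \<delta> \<le> 1"
    proof -
      have "4 * (2 + kill_ratio l) * \<mu>\<^sup>2 * (2 * (real l + 4) * x powr (- (47 / 64)))
          = 8 * (2 + kill_ratio l) * (real l + 4) * (x powr (1 / 4) * x powr (- (47 / 64)))"
        unfolding \<mu>2 by (simp add: algebra_simps)
      also have "x powr (1 / 4) * x powr (- (47 / 64)) = x powr (- (31 / 64))" by (simp add: powr_add[symmetric])
      also have "8 * (2 + kill_ratio l) * (real l + 4) * x powr (- (31 / 64)) \<le> 256 * (2 + kill_ratio l) * (real l + 4) * x powr (- (31 / 64))"
        using kill_ratio_nonneg[of l] by (intro mult_right_mono) auto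
      also have "\<dots> \<le> 1" by (rule small, rule big_p) (simp_all add: big_consts_def)
      finally have "4 * (2 + kill_ratio l) * \<mu>\<^sup>2 * (2 * (real l + 4) * x powr (- (47 / 64))) * \<delta> \<le> 1 * \<delta>"
        using \<delta>0 by (intro mult_right_mono) auto
      then show ?thesis unfolding Jx using \<delta>x by simp
    qed
    show "real l * (real l + 3)\<^sup>2 * Y / (real n * \<theta>) \<le> 1 / 2"
    proof -
      have "Y / (real n * \<theta>) = x powr (1 / 4 - (1 - 1 / (64 * real l)))" unfolding n\<theta>(2) Y_def by (simp only: powr_diff[symmetric])
      also have "\<dots> \<le> x powr (- (47 / 64))" using x1 l64 by (intro powr_mono) auto
      finally have "2 * real l * (real l + 3)\<^sup>2 * (Y / (real n * \<theta>)) \<le> 2 * real l * (real l + 3)\<^sup>2 * x powr (- (47 / 64))"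
        by (intro mult_left_mono) auto
      also have "\<dots> \<le> 1" by (rule small, rule big_p) (simp_all add: big_consts_def)
      finally show ?thesis by (simp add: mult_ac)
    qed
    show "\<mu> * \<delta> * live_bound l l \<le> 1"
    proof -
      have "\<mu> * \<delta> * live_bound l l \<le> \<mu> * (1 / x) * live_bound l l"
        using \<delta>x live_bound_ge1[of l l] l by (intro mult_right_mono mult_left_mono) (auto simp: \<mu>_def)
      also have "\<mu> * (1 / x) = x powr (1 / 8 - 1)" using x0 powr_diff[of x "1 / 8" 1] by (simp add: \<mu>_def)
      also have "x powr (1 / 8 - 1) * live_bound l l = live_bound l l * x powr (- (7 / 8))" by simp
      also have "\<dots> \<le> 1" by (rule small, rule big_p) (simp_all add: big_consts_def)
      finally show ?thesis .
    qed
  qed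
  have "girth_run n l N 64 \<delta> \<epsilon> \<mu> Y \<theta>"
  proof unfold_locales
    show "(0::nat) < 64" by simp
    show "\<theta> \<le> real N * \<delta>" using \<theta>0 \<theta>1 N1' by simp
    show "2 * real n ^ 2 * exp (- (\<mu> * (\<epsilon> - 2 / real n))) \<le> 1 / 8"
    proof -
      have me: "\<mu> * \<epsilon> = x powr (1 / 16)" by (simp add: \<mu>_def \<epsilon>_def powr_add[symmetric])
      have "\<mu> / x = x powr (1 / 8 - 1)" using x0 powr_diff[of x "1 / 8" 1] by (simp add: \<mu>_def)
      also have "\<dots> \<le> x powr 0" using x1 by (intro powr_mono) auto
      finally have "\<mu> / x \<le> 1" using x0 by simp
      moreover have "\<mu> * (\<epsilon> - 2 / real n) = x powr (1 / 16) - 2 * (\<mu> / x)"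
        by (simp add: right_diff_distrib me x_def)
      ultimately have "- (\<mu> * (\<epsilon> - 2 / real n)) \<le> 2 - x powr (1 / 16)" by linarith
      then have "exp (- (\<mu> * (\<epsilon> - 2 / real n))) \<le> exp 2 * exp (- (x powr (1 / 16)))" by (simp add: exp_add[symmetric])
      then have "2 * x ^ 2 * exp (- (\<mu> * (\<epsilon> - 2 / real n))) \<le> 2 * x ^ 2 * (exp 2 * exp (- (x powr (1 / 16))))"
        by (intro mult_left_mono) auto
      also have "\<dots> = 2 * exp 2 * (x ^ 2 * exp (- (x powr (1 / 16))))" by simp
      also have "\<dots> \<le> 2 * exp 2 * (1 / x)" using exx[of 2] by (intro mult_left_mono) auto
      also have "\<dots> \<le> 1 / 8"
      proof -
        have "16 * exp 2 \<le> x" by (rule xc, rule big_p) (simp_all add: big_consts_def)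
        then show ?thesis using x0 by (simp add: field_simps)
      qed
      finally show ?thesis by (simp add: x_def)
    qed
    have mu16: "4 * x powr (1 / 16) \<le> \<mu>"
    proof -
      have "\<mu> = x powr (1 / 16) * x powr (1 / 16)" by (simp add: \<mu>_def powr_add[symmetric])
      moreover have "4 \<le> x powr (1 / 16)" by (rule big_p) (simp_all add: big_consts_def)
      ultimately show ?thesis using mult_right_mono[of 4 "x powr (1 / 16)" "x powr (1 / 16)"] by simp
    qed
    have l32: "32 * real l * real l \<le> x" by (rule xc, rule big_p) (simp_all add: big_consts_def)
    show "real l * real l * real n ^ 3 * exp (- \<mu>) \<le> 1 / 8"
    proof -
      have "x powr (1 / 16) \<le> \<mu>" using mu16 powr_ge_zero[of x "1 / 16"] by linarith
      then have "exp (- \<mu>) \<le> exp (- (x powr (1 / 16)))" by simp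
      then have "real l * real l * (x ^ 3 * exp (- \<mu>)) \<le> real l * real l * (x ^ 3 * exp (- (x powr (1 / 16))))"
        using x0 by (intro mult_left_mono) auto
      also have "\<dots> \<le> real l * real l * (1 / x)" using exx[of 3] by (intro mult_left_mono) auto
      also have "\<dots> \<le> 1 / 8" using l32 x0 by (simp add: field_simps)
      finally show ?thesis by (simp add: x_def mult.assoc)
    qed
    show "3 * (real l + 1) ^ 3 * real n ^ 6 *
      (2 ^ (64 * (2 * l)) * st_const (2 * l + 4) * (real N * \<delta> / \<theta>) ^ (2 * l) / Y) ^ 64 \<le> 1 / 8"
    proof -
      \<comment> \<open>Both \<open>N \<delta>\<close> and \<open>1 / \<theta>\<close> are at most
        \<open>n powr (1 / (64 l))\<close>, so the power \<open>2 l\<close> stays below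
        \<open>n powr (1 / 16)\<close>. With another \<open>n powr (1 / 16)\<close> for the
        constant, \<open>Y\<close> wins by \<open>n powr (1 / 8)\<close>.\<close>
      have "real N * \<delta> / \<theta> \<le> x powr (1 / (64 * real l)) / \<theta>" using N2 \<theta>0 \<theta>1 by (intro divide_right_mono) auto
      also have "\<dots> = x powr (1 / (64 * real l) - - (1 / (64 * real l)))"
        by (simp only: \<theta>_def powr_diff)
      also have "1 / (64 * real l) - - (1 / (64 * real l)) = 1 / (32 * real l)" using l by (simp add: field_simps)
      finally have "(real N * \<delta> / \<theta>) ^ (2 * l) \<le> (x powr (1 / (32 * real l))) ^ (2 * l)"
        using \<theta>0 \<theta>1 \<delta>0 by (intro power_mono) auto
      also have "\<dots> = x powr (real (2 * l) * (1 / (32 * real l)))" using x0 by (intro powr_power) simp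
      also have "real (2 * l) * (1 / (32 * real l)) = 1 / 16" using l by simp
      finally have y: "(real N * \<delta> / \<theta>) ^ (2 * l) \<le> x powr (1 / 16)" .
      have "2 ^ (64 * (2 * l)) * st_const (2 * l + 4) \<le> x powr (1 / 16)" by (rule big_p) (simp_all add: big_consts_def)
      then have "2 ^ (64 * (2 * l)) * st_const (2 * l + 4) * (real N * \<delta> / \<theta>) ^ (2 * l) / Y \<le> x powr (1 / 16) * x powr (1 / 16) / Y"
        using y \<theta>0 \<theta>1 \<delta>0 st_const_ge1[of "2 * l + 4"] by (intro divide_right_mono mult_mono) (auto simp: Y_def)
      also have "\<dots> = x powr (- (1 / 8))" by (simp add: Y_def powr_add[symmetric] powr_diff[symmetric])
      finally have "(2 ^ (64 * (2 * l)) * st_const (2 * l + 4) * (real N * \<delta> / \<theta>) ^ (2 * l) / Y) ^ 64 \<le> (x powr (- (1 / 8))) ^ 64"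
        using \<theta>0 \<theta>1 \<delta>0 st_const_ge1[of "2 * l + 4"] by (intro power_mono) (auto simp: Y_def)
      also have "\<dots> = x powr (- 8)" using x0 by (simp add: powr_power)
      also have "\<dots> = 1 / x ^ 8" using x0 by (simp add: powr_minus divide_inverse powr_numeral)
      finally have "3 * (real l + 1) ^ 3 * x ^ 6 * (2 ^ (64 * (2 * l)) * st_const (2 * l + 4) * (real N * \<delta> / \<theta>) ^ (2 * l) / Y) ^ 64
          \<le> 3 * (real l + 1) ^ 3 * x ^ 6 * (1 / x ^ 8)" using x0 by (intro mult_left_mono) auto
      also have "\<dots> = 3 * (real l + 1) ^ 3 * (1 / x) * (1 / x)" using x0 by (simp add: power_numeral_reduce)
      also have "\<dots> \<le> 3 * (real l + 1) ^ 3 * (1 / x) * 1" using x1 by (intro mult_left_mono) auto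
      also have "\<dots> \<le> 1 / 8"
      proof -
        have "24 * (real l + 1) ^ 3 \<le> x" by (rule xc, rule big_p) (simp_all add: big_consts_def)
        then show ?thesis using x0 by (simp add: field_simps)
      qed
      finally show ?thesis by (simp add: x_def)
    qed
    show "real N * \<delta> * \<omega> \<le> 1 / 8"
    proof -
      have N3: "real N * \<delta> \<le> x powr (1 / 64)"
      proof -
        have "x powr (1 / (64 * real l)) \<le> x powr (1 / 64)" using x1 l64 by (intro powr_mono) auto
        then show ?thesis using N2 by simp
      qed
      have N4: "real N * \<delta> \<le> x"
      proof -
        have "x powr (1 / 64) \<le> x powr 1" using x1 by (intro powr_mono) auto
        then show ?thesis using N3 x0 by simp
      qed
      have J1x: "J1 = 2 * (real l + 4) * x powr (- (47 / 64))" unfolding J1_def by (rule Jx)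
      have "real N * \<delta> * (8 * (2 + kill_ratio l) * \<mu>\<^sup>2 * J1) \<le> x powr (1 / 64) * (8 * (2 + kill_ratio l) * \<mu>\<^sup>2 * J1)"
        using N3 J1_pos kill_ratio_nonneg[of l] by (intro mult_right_mono) auto
      also have "\<dots> = 16 * (2 + kill_ratio l) * (real l + 4) * (x powr (1 / 64) * (x powr (1 / 4) * x powr (- (47 / 64))))"
        unfolding J1x \<mu>2 by (simp add: algebra_simps)
      also have "x powr (1 / 64) * (x powr (1 / 4) * x powr (- (47 / 64))) = x powr (- (15 / 32))" by (simp add: powr_add[symmetric])
      also have "16 * (2 + kill_ratio l) * (real l + 4) * x powr (- (15 / 32)) = (256 * (2 + kill_ratio l) * (real l + 4) * x powr (- (15 / 32))) / 16" by simp
      also have "\<dots> \<le> 1 / 16"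
      proof -
        have "256 * (2 + kill_ratio l) * (real l + 4) * x powr (- (15 / 32)) \<le> 1" by (rule small, rule big_p) (simp_all add: big_consts_def)
        then show ?thesis by simp
      qed
      finally have p1: "real N * \<delta> * (8 * (2 + kill_ratio l) * \<mu>\<^sup>2 * J1) \<le> 1 / 16" .
      have "exp (- \<mu> / 4) \<le> exp (- (x powr (1 / 16)))" using mu16 by simp
      then have "real N * \<delta> * (real l * real l * x ^ 3 * (2 * exp (- \<mu> / 4))) \<le> x * (real l * real l * x ^ 3 * (2 * exp (- (x powr (1 / 16)))))"
        using N4 \<delta>0 x0 by (intro mult_mono mult_left_mono) auto
      also have "\<dots> = 2 * real l * real l * (x ^ 4 * exp (- (x powr (1 / 16))))" by (simp add: power_numeral_reduce)
      also have "\<dots> \<le> 2 * real l * real l * (1 / x)" using exx[of 4] by (intro mult_left_mono) auto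
      also have "\<dots> \<le> 1 / 16" using l32 x0 by (simp add: field_simps)
      finally have p2: "real N * \<delta> * (real l * real l * x ^ 3 * (2 * exp (- \<mu> / 4))) \<le> 1 / 16" .
      have "real N * \<delta> * \<omega> = real N * \<delta> * (8 * (2 + kill_ratio l) * \<mu>\<^sup>2 * J1) + real N * \<delta> * (real l * real l * x ^ 3 * (2 * exp (- \<mu> / 4)))"
        unfolding \<omega>_def girth_params.a_def[OF girth_params_axioms] by (simp only: distrib_left x_def)
      then show ?thesis using p1 p2 by linarith
    qed
  qed
  then show ?thesis by (simp add: \<delta>_def \<epsilon>_def \<mu>_def Y_def \<theta>_def x_def)
qed

text \<open>From the triples spanned by a set of \<open>b\<close> points exactly
  \<open>b - 2\<close> are kept. They span at most two points more than their number and so contain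
  a configuration with at most \<open>b - 2 \<le> l\<close> triples.\<close>

lemma partial_sts_of_configuration_free:
  assumes M: "M \<subseteq> triples n" and lin: "\<And>e f. e \<in> M \<Longrightarrow> f \<in> M \<Longrightarrow> e \<noteq> f \<Longrightarrow> card (e \<inter> f) \<le> 1"
    and free: "\<And>k H. 3 \<le> k \<Longrightarrow> k \<le> l \<Longrightarrow> H \<in> configs n k \<Longrightarrow> \<not> H \<subseteq> M"
  shows "partial_steiner_triple_system {..<n} M" "enat l < girth {..<n} M"
proof -
  have finM: "finite M" using M by (rule finite_subset) simp
  have t: "e \<subseteq> {..<n} \<and> card e = 3 \<and> finite e" if "e \<in> M" for e using M that triples_facts by blast
  have "card {e \<in> M. p \<subseteq> e} \<le> 1" if p: "card p = 2" for p
  proof -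
    have "e = f" if ef: "e \<in> {e \<in> M. p \<subseteq> e}" "f \<in> {e \<in> M. p \<subseteq> e}" for e f
    proof (rule ccontr)
      assume ne: "e \<noteq> f"
      have "card p \<le> card (e \<inter> f)" using t ef by (intro card_mono) auto
      then show False using lin[of e f] ef ne p by auto
    qed
    then show ?thesis using finM by (auto simp: card_le_Suc0_iff_eq)
  qed
  then show "partial_steiner_triple_system {..<n} M"
    using t by (simp add: partial_steiner_triple_system_def three_uniform_hypergraph_def)
  show "enat l < girth {..<n} M"
    unfolding girth_greater_iff
  proof
    assume "\<exists>a\<ge>4. a \<le> l \<and> (\<exists>S\<subseteq>{..<n}. card S = a \<and> a - 2 \<le> card (spanned_triples M S))"
    then obtain b S where b: "4 \<le> b" "b \<le> l" and S: "S \<subseteq> {..<n}" "card S = b" "b - 2 \<le> card (spanned_triples M S)" by auto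
    obtain L where L: "L \<subseteq> spanned_triples M S" "card L = b - 2" "finite L"
      using obtain_subset_with_card_n[OF S(3)] by metis
    have LM: "L \<subseteq> M" and LS: "\<Union>L \<subseteq> S" using L by (auto simp: spanned_triples_def)
    have "card (\<Union>L) \<le> card S" using LS S(1) by (intro card_mono) (auto intro: finite_subset)
    then have dense: "card (\<Union>L) \<le> card L + 2" using S L b by simp
    have "\<exists>k H. 3 \<le> k \<and> k \<le> l \<and> H \<subseteq> L \<and> config k H"
    proof (rule exists_config_of_dense[OF L(3) _ _ _ dense])
      show "\<forall>e\<in>L. card e = 3" using LM t by blast
      show "2 \<le> card L" "card L \<le> l" using L b by simp_all
      show "card (e \<inter> f) \<le> 1" if "e \<in> L" "f \<in> L" "e \<noteq> f" for e f using LM that by (intro lin) auto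
    qed
    then obtain k H where k: "3 \<le> k" "k \<le> l" and H: "H \<subseteq> L" "config k H" by blast
    have "H \<in> configs n k" using H LM M by (auto simp: configs_def)
    then show False using free[OF k] H LM by blast
  qed
qed

theorem theorem1p3:
  fixes l :: nat
  assumes "l \<ge> 4"
  shows "\<exists>(n\<^sub>l :: nat) (\<beta> :: real). n\<^sub>l > 0 \<and> \<beta> > 0 \<and>
    (\<forall>n\<ge>n\<^sub>l. \<exists>(V :: nat set) E.
       card V = n \<and> partial_steiner_triple_system V E \<and>
       real (card E) \<ge> (1 - real n powr (- \<beta>)) * (real n)\<^sup>2 / 6 \<and>
       girth V E > enat l)"
proof -
  define \<tau> where "\<tau> = rate l"
  have \<tau>0: "0 < \<tau>" using assms kill_ratio_nonneg[of l] by (simp add: \<tau>_def rate_def)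
  have \<tau>1: "\<tau> \<le> 1 / 16"
  proof -
    have "16 * 1 * 1 \<le> 256 * real l * (2 + kill_ratio l)" using assms kill_ratio_nonneg[of l] by (intro mult_mono) auto
    then show ?thesis unfolding \<tau>_def rate_def by (intro divide_left_mono) auto
  qed
  have l0: "0 < real l" using assms by simp
  have "eventually (\<lambda>n. Max (big_consts l) \<le> real n powr (1 / (128 * real l)) \<and>
      \<tau> * ln (real n) + 1 \<le> real n powr (1 / (64 * real l)) \<and>
      real n ^ 5 * exp (- (real n powr (1 / 16))) \<le> 1 \<and> 1 \<le> \<tau> * ln (real n) \<and> 41 \<le> real n powr (\<tau> / 2)) sequentially"
  proof (intro eventually_conj)
    show "eventually (\<lambda>n. Max (big_consts l) \<le> real n powr (1 / (128 * real l))) sequentially"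
      using l0 by (intro eventually_const_le_powr) simp
    show "eventually (\<lambda>n. \<tau> * ln (real n) + 1 \<le> real n powr (1 / (64 * real l))) sequentially"
      using l0 by (intro eventually_ln_le_powr) simp
    show "eventually (\<lambda>n. real n ^ 5 * exp (- (real n powr (1 / 16))) \<le> 1) sequentially"
      by (intro eventually_power_exp_le) simp
    have "filterlim (\<lambda>n. ln (real n)) at_top sequentially"
      by (rule filterlim_compose[OF ln_at_top filterlim_real_sequentially])
    then have "eventually (\<lambda>n. 1 / \<tau> \<le> ln (real n)) sequentially" by (simp add: filterlim_at_top)
    then show "eventually (\<lambda>n. 1 \<le> \<tau> * ln (real n)) sequentially"
      by eventually_elim (use \<tau>0 in \<open>simp add: divide_le_eq mult.commute\<close>)
    \<comment> \<open>The constant 41 is twice \<open>1 / 2 + 4 + 16\<close>: the linear term of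
      \<open>n choose 2\<close>, the uncovered pairs and the discarded pairs. It is absorbed by
      giving up half of the exponent \<open>\<tau>\<close>.\<close>
    show "eventually (\<lambda>n. 41 \<le> real n powr (\<tau> / 2)) sequentially"
      using \<tau>0 by (intro eventually_const_le_powr) simp
  qed
  then obtain n0 where n0: "\<And>n. n \<ge> n0 \<Longrightarrow> Max (big_consts l) \<le> real n powr (1 / (128 * real l)) \<and>
      \<tau> * ln (real n) + 1 \<le> real n powr (1 / (64 * real l)) \<and>
      real n ^ 5 * exp (- (real n powr (1 / 16))) \<le> 1 \<and> 1 \<le> \<tau> * ln (real n) \<and> 41 \<le> real n powr (\<tau> / 2)"
    unfolding eventually_sequentially by blast
  have main: "\<exists>(V :: nat set) E. card V = n \<and> partial_steiner_triple_system V E \<and>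
       real (card E) \<ge> (1 - real n powr (- (\<tau> / 2))) * (real n)\<^sup>2 / 6 \<and> girth V E > enat l" if n: "n \<ge> max n0 1" for n
  proof -
    define N where "N = nat \<lceil>rate l * ln (real n) * real n ^ 5\<rceil>"
    define \<delta> where "\<delta> = 1 / real n ^ 5"
    have h: "Max (big_consts l) \<le> real n powr (1 / (128 * real l))" "rate l * ln (real n) + 1 \<le> real n powr (1 / (64 * real l))"
      "real n ^ 5 * exp (- (real n powr (1 / 16))) \<le> 1" "1 \<le> rate l * ln (real n)" "41 \<le> real n powr (\<tau> / 2)"
      using n0[of n] n by (auto simp: \<tau>_def)
    have x1: "1 \<le> real n" using n by simp
    interpret girth_run n l N 64 "1 / real n ^ 5" "real n powr (- (1 / 16))" "real n powr (1 / 8)" "real n powr (1 / 4)" "real n powr (- (1 / (64 * real l)))"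
      unfolding N_def by (rule girth_run_exists[OF assms h(1-4)])
    obtain M where M: "M \<subseteq> triples n" and lin: "\<forall>e\<in>M. \<forall>f\<in>M. e \<noteq> f \<longrightarrow> card (e \<inter> f) \<le> 1"
      and free: "\<forall>k H. 3 \<le> k \<longrightarrow> k \<le> l \<longrightarrow> H \<in> configs n k \<longrightarrow> \<not> H \<subseteq> M"
      and size: "real (n choose 2) - 4 * real n ^ 2 * (1 - 1 / real n ^ 5) ^ N - 16 * real n powr (- (1 / 16)) * real n ^ 2 \<le> 3 * real (card M)"
      using final_state by blast
    have pN: "(1 - 1 / real n ^ 5) ^ N \<le> real n powr (- \<tau>)"
    proof -
      have "1 - \<delta> \<le> exp (- \<delta>)" using exp_ge_add_one_self[of "- \<delta>"] by simp
      moreover have "0 \<le> 1 - \<delta>" using x1 by (simp add: \<delta>_def)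
      ultimately have "(1 - \<delta>) ^ N \<le> exp (- \<delta>) ^ N" by (intro power_mono)
      also have "\<dots> = exp (- (real N * \<delta>))" by (simp add: exp_of_nat_mult[symmetric])
      also have "\<dots> \<le> exp (- \<tau> * ln (real n))"
      proof -
        have "\<tau> * ln (real n) * real n ^ 5 \<le> real N" unfolding N_def \<tau>_def by linarith
        then have "\<tau> * ln (real n) * real n ^ 5 * \<delta> \<le> real N * \<delta>" using x1 by (intro mult_right_mono) (auto simp: \<delta>_def)
        then show ?thesis using x1 by (simp add: \<delta>_def)
      qed
      also have "\<dots> = real n powr (- \<tau>)" using x1 by (simp add: powr_def)
      finally show ?thesis by (simp add: \<delta>_def)
    qed
    \<comment> \<open>\<open>\<tau> \<le> 1 / 16\<close> lets the waste term, of order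
      \<open>\<epsilon> n ^ 2\<close>, be treated like the uncovered pairs.\<close>
    have p16: "real n powr (- (1 / 16)) \<le> real n powr (- \<tau>)" using x1 \<tau>1 by (intro powr_mono) auto
    have p1: "real n \<le> real n powr (- \<tau>) * real n ^ 2"
    proof -
      have "real n powr 1 \<le> real n powr (- \<tau> + 2)" using x1 \<tau>1 by (intro powr_mono) auto
      also have "\<dots> = real n powr (- \<tau>) * real n powr 2" by (rule powr_add)
      also have "real n powr 2 = real n ^ 2" using x1 by (simp add: powr_numeral)
      finally show ?thesis using x1 by simp
    qed
    have p41: "41 * real n powr (- \<tau>) \<le> real n powr (- (\<tau> / 2))"
    proof -
      have "41 * real n powr (- \<tau>) \<le> real n powr (\<tau> / 2) * real n powr (- \<tau>)" using h(5) by (intro mult_right_mono) auto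
      also have "\<dots> = real n powr (- (\<tau> / 2))" by (simp add: powr_add[symmetric])
      finally show ?thesis .
    qed
    have ch: "real (n choose 2) = (real n ^ 2 - real n) / 2"
    proof -
      have "even (n * (n - 1))" by (cases n) simp_all
      then have "2 * (n choose 2) = n * (n - 1)" unfolding choose_two by (rule dvd_mult_div_cancel)
      then have "2 * real (n choose 2) = real (n * (n - 1))" by (metis of_nat_mult of_nat_numeral)
      also have "\<dots> = real n ^ 2 - real n" using n by (simp add: of_nat_diff power2_eq_square algebra_simps)
      finally show ?thesis by simp
    qed
    let ?t = "real n powr (- \<tau>) * real n ^ 2"
    have "4 * real n ^ 2 * (1 - 1 / real n ^ 5) ^ N \<le> 4 * real n ^ 2 * real n powr (- \<tau>)"
      using pN by (intro mult_left_mono) auto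
    moreover have "16 * real n powr (- (1 / 16)) * real n ^ 2 \<le> 16 * real n powr (- \<tau>) * real n ^ 2"
      using p16 by (intro mult_right_mono) auto
    ultimately have "real n ^ 2 / 2 - 41 / 2 * ?t \<le> 3 * real (card M)" using size ch p1 by (simp add: algebra_simps)
    moreover have "41 * real n powr (- \<tau>) * real n ^ 2 \<le> real n powr (- (\<tau> / 2)) * real n ^ 2"
      using p41 by (intro mult_right_mono) auto
    ultimately have "(1 - real n powr (- (\<tau> / 2))) * (real n)\<^sup>2 / 6 \<le> real (card M)" by (simp add: algebra_simps)
    then show ?thesis
      using partial_sts_of_configuration_free[OF M, of l] lin free by (intro exI[of _ "{..<n}"] exI[of _ M]) auto
  qed
  show ?thesis
    by (rule exI[of _ "max n0 1"], rule exI[of _ "\<tau> / 2"]) (use main \<tau>0 in auto)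
qed

end
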